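(* Let $\mathfrak{R}$ be an expansion of $(\mathbb{R},<,+)$ by boolean combinations of open subsets of various $\mathbb{R}^n$ (any number of such sets, with $n$ allowed to vary), and suppose that $\mathfrak{R}$ is PCC, CC or QCC. Then one of the following holds. (1) $\mathfrak{R}$ is o-minimal. (2) There is a strictly increasing $\sigma\colon\mathbb{N}\to\mathbb{R}$ such that the set $\{(\sigma(m),\sigma(n)) : m,n\in\mathbb{N},\ m\mid n\}$ is definable in $\mathfrak{R}$.
   Context: $\mathbb{N}$ is the set of nonnegative integers, and $m\mid n$ means $n=dm$ for some $d\in\mathbb{N}$. All structures are first-order structures with underlying set $\mathbb{R}$. "Definable" means definable with parameters; definable sets are subsets of $\mathbb{R}^n$ for arbitrary $n$. Each $\mathbb{R}^n$ has its usual topology and subsets carry the subspace topology. A structure on $\mathbb{R}$ is PCC (path-component closed) if for every definable set $E$, each path component of $E$ is definable; it is CC (component closed) if for every definable set $E$, each connected component of $E$ is definable; it is QCC (quasicomponent closed) if for every definable set $E$, each quasicomponent of $E$ is definable. (The quasicomponent of a point $x$ in a space $E$ is the intersection of all clopen subsets of $E$ containing $x$.) An expansion of $(\mathbb{R},<)$ is o-minimal if every definable subset of $\mathbb{R}$ is a finite union of points and open intervals. *)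

theory Defs
  imports "HOL-Analysis.Analysis"
begin

section \<open>First-order structures with underlying set the reals\<close>

text \<open>
  Points of $n$-dimensional space are the elements of \<open>topspace (Euclidean_space n)\<close>: functions
  on the naturals that vanish from index \<open>n\<close> on. This allows the dimension to vary.
\<close>

type_synonym point = "nat \<Rightarrow> real"

definition point_of :: "real list \<Rightarrow> point" where
  "point_of xs = (\<lambda>i. if i < length xs then xs ! i else 0)"

text \<open>
  Every symbol is a primitive function or relation together with its arity, and is interpreted
  by itself. Only the values of an \<open>n\<close>-ary primitive on \<open>topspace (Euclidean_space n)\<close> matter.
\<close>

record rstruct =
  Funs :: "(nat \<times> (point \<Rightarrow> real)) set"
  Rels :: "(nat \<times> point set) set"

datatype tm =
    Var nat
  | App nat "point \<Rightarrow> real" "tm list"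

datatype fm =
    Eq tm tm
  | Rel nat "point set" "tm list"
  | Neg fm
  | Conj fm fm
  | Ex nat fm

fun wf_tm :: "rstruct \<Rightarrow> tm \<Rightarrow> bool" where
  "wf_tm M (Var i) \<longleftrightarrow> True"
| "wf_tm M (App n f ts) \<longleftrightarrow> (n, f) \<in> Funs M \<and> length ts = n \<and> (\<forall>t \<in> set ts. wf_tm M t)"

fun wf_fm :: "rstruct \<Rightarrow> fm \<Rightarrow> bool" where
  "wf_fm M (Eq s t) \<longleftrightarrow> wf_tm M s \<and> wf_tm M t"
| "wf_fm M (Rel n X ts) \<longleftrightarrow> (n, X) \<in> Rels M \<and> length ts = n \<and> (\<forall>t \<in> set ts. wf_tm M t)"
| "wf_fm M (Neg \<phi>) \<longleftrightarrow> wf_fm M \<phi>"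
| "wf_fm M (Conj \<phi> \<psi>) \<longleftrightarrow> wf_fm M \<phi> \<and> wf_fm M \<psi>"
| "wf_fm M (Ex i \<phi>) \<longleftrightarrow> wf_fm M \<phi>"

fun eval_tm :: "(nat \<Rightarrow> real) \<Rightarrow> tm \<Rightarrow> real" where
  "eval_tm e (Var i) = e i"
| "eval_tm e (App n f ts) = f (point_of (map (eval_tm e) ts))"

fun sat :: "(nat \<Rightarrow> real) \<Rightarrow> fm \<Rightarrow> bool" where
  "sat e (Eq s t) \<longleftrightarrow> eval_tm e s = eval_tm e t"
| "sat e (Rel n X ts) \<longleftrightarrow> point_of (map (eval_tm e) ts) \<in> X"
| "sat e (Neg \<phi>) \<longleftrightarrow> \<not> sat e \<phi>"
| "sat e (Conj \<phi> \<psi>) \<longleftrightarrow> sat e \<phi> \<and> sat e \<psi>"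
| "sat e (Ex i \<phi>) \<longleftrightarrow> (\<exists>r. sat (e(i := r)) \<phi>)"

text \<open>
  Definability with parameters: the variables below \<open>n\<close> are the coordinates, and the other free
  variables of \<open>\<phi>\<close>, which are finitely many, are replaced by the parameters \<open>a i\<close>.
\<close>

definition definable :: "rstruct \<Rightarrow> nat \<Rightarrow> point set \<Rightarrow> bool" where
  "definable M n E \<longleftrightarrow>
     (\<exists>\<phi> a. wf_fm M \<phi> \<and>
        E = {x \<in> topspace (Euclidean_space n). sat (\<lambda>i. if i < n then x i else a i) \<phi>})"

section \<open>Component-closed and o-minimal structures\<close>

definition PCC :: "rstruct \<Rightarrow> bool" where
  "PCC M \<longleftrightarrow> (\<forall>n E. definable M n E \<longrightarrow>
     (\<forall>C \<in> path_components_of (subtopology (Euclidean_space n) E). definable M n C))"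

definition CC :: "rstruct \<Rightarrow> bool" where
  "CC M \<longleftrightarrow> (\<forall>n E. definable M n E \<longrightarrow>
     (\<forall>C \<in> connected_components_of (subtopology (Euclidean_space n) E). definable M n C))"

definition QCC :: "rstruct \<Rightarrow> bool" where
  "QCC M \<longleftrightarrow> (\<forall>n E. definable M n E \<longrightarrow>
     (\<forall>C \<in> quasi_components_of (subtopology (Euclidean_space n) E). definable M n C))"

text \<open>Open intervals may be unbounded, so the endpoints \<open>a\<close>, \<open>b\<close> are extended reals.\<close>

definition o_minimal :: "rstruct \<Rightarrow> bool" where
  "o_minimal M \<longleftrightarrow> (\<forall>E. definable M 1 E \<longrightarrow>
     (\<exists>\<I>. finite \<I> \<and> (\<forall>I \<in> \<I>. (\<exists>c. I = {c}) \<or> (\<exists>a b. I = einterval a b)) \<and>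
        (\<lambda>x. x 0) ` E = \<Union>\<I>))"

section \<open>Expansions of the ordered additive group of reals\<close>

inductive boolean_combination_of_opens :: "'a topology \<Rightarrow> 'a set \<Rightarrow> bool" for X where
  "openin X U \<Longrightarrow> boolean_combination_of_opens X U"
| "boolean_combination_of_opens X A \<Longrightarrow> boolean_combination_of_opens X (topspace X - A)"
| "boolean_combination_of_opens X A \<Longrightarrow> boolean_combination_of_opens X B \<Longrightarrow>
     boolean_combination_of_opens X (A \<union> B)"
| "boolean_combination_of_opens X A \<Longrightarrow> boolean_combination_of_opens X B \<Longrightarrow>
     boolean_combination_of_opens X (A \<inter> B)"

definition expansion_of_reals :: "(nat \<times> point set) set \<Rightarrow> rstruct" where
  "expansion_of_reals \<S> =
     \<lparr>Funs = {(2, \<lambda>x. x 0 + x 1)},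
      Rels = insert (2, {x \<in> topspace (Euclidean_space 2). x 0 < x 1}) \<S>\<rparr>"

end

theory Submission
  imports Defs
begin

text \<open>
  Everything depends on whether there is an infinite definable discrete set, in any dimension.

  If there is one, then either its points or the distances from its points to the rest of the set
  yield a definable set of reals \<open>\<sigma> 0 < \<sigma> 1 < \<dots>\<close> of order type \<open>\<omega>\<close>. Component closedness allows
  transitive closures on a discrete set \<open>D\<close>: a definable relation \<open>G\<close> on \<open>D\<close> is realised as a
  definable topological graph whose components correspond to those of \<open>G\<close>. Counting modulo \<open>m\<close> is
  such a transitive closure, and it defines divisibility.

  If there is none, then no component closedness is needed for o-minimality. A projection of a
  definable locally closed set is a countable union of compact sets, its infinite coordinate images
  contain intervals, and by Baire category it is locally dense only where it has interior. Hence the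
  relative boundary of such a set in a definable closed set drops the dimension of the latter, so
  that after finitely many steps the projection is a finite union of definable locally closed sets.
  These unions therefore are closed under all logical operations and exhaust the definable sets.
\<close>

section \<open>A calculus of definable predicates\<close>

text \<open>The language offers only addition and order. Distances are therefore l1 distances,
  midpoints \<open>m\<close> are given by \<open>m + m = a + b\<close>, and suprema and infima enter
  through relations that characterise them.

  Path components, components and quasicomponents differ in general, but a clopen path-connected set
  is all three at once. The graph is realised so that the wanted vertices span such a set, which
  treats PCC, CC and QCC by one argument.

  In the o-minimal half, Baire category yields countable unions, while the hypothesis controls
  definable sets only. Compact exhaustions indexed by two real parameters mediate: they are monotone
  definable families, and if all members have finite coordinate images, then recording the parameter
  at which a value enters or leaves gives a definable discrete set, so the union of the images is
  finite too.

  A second obstacle is that the open sets combined in a primitive need not be definable. Definable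
  locally closed pieces must be extracted from the primitive itself, by closures and
  differences.\<close>

definition pts :: "nat set \<Rightarrow> point set" where
  "pts I = {x. \<forall>i. i \<notin> I \<longrightarrow> x i = 0}"

text \<open>Dropped coordinates are set to 0 and not removed, so projections compose by intersecting
  their index sets and all stay in one ambient space.\<close>

definition pr :: "nat set \<Rightarrow> point \<Rightarrow> point" where
  "pr I x = (\<lambda>i. if i \<in> I then x i else 0)"

lemma topspace_Euclidean_space_pts: "topspace (Euclidean_space n) = pts {..<n}"
  by (auto simp: topspace_Euclidean_space pts_def not_less)

lemma pr_in_pts [simp]: "pr I x \<in> pts I"
  by (simp add: pr_def pts_def)

lemma pr_id: "x \<in> pts I \<Longrightarrow> pr I x = x"
  by (auto simp: pr_def pts_def)

lemma pts_mono: "I \<subseteq> J \<Longrightarrow> pts I \<subseteq> pts J"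
  by (auto simp: pts_def)

section \<open>Renaming of variables\<close>

fun ren_tm :: "(nat \<Rightarrow> nat) \<Rightarrow> tm \<Rightarrow> tm" where
  "ren_tm f (Var i) = Var (f i)"
| "ren_tm f (App n g ts) = App n g (map (ren_tm f) ts)"

fun ren_fm :: "(nat \<Rightarrow> nat) \<Rightarrow> fm \<Rightarrow> fm" where
  "ren_fm f (Eq s t) = Eq (ren_tm f s) (ren_tm f t)"
| "ren_fm f (Rel n X ts) = Rel n X (map (ren_tm f) ts)"
| "ren_fm f (Neg \<phi>) = Neg (ren_fm f \<phi>)"
| "ren_fm f (Conj \<phi> \<psi>) = Conj (ren_fm f \<phi>) (ren_fm f \<psi>)"
| "ren_fm f (Ex i \<phi>) = Ex (f i) (ren_fm f \<phi>)"

lemma eval_ren_tm: "eval_tm e (ren_tm f t) = eval_tm (\<lambda>i. e (f i)) t"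
proof (induction t)
  case (App n g ts)
  then show ?case by (simp cong: map_cong)
qed simp

lemma wf_ren_tm: "wf_tm M (ren_tm f t) = wf_tm M t"
  by (induction t) auto

lemma wf_ren_fm: "wf_fm M (ren_fm f \<phi>) = wf_fm M \<phi>"
  by (induction \<phi>) (auto simp: wf_ren_tm)

text \<open>Bound variables are renamed together with the free ones. Injectivity of \<open>f\<close>
  excludes capture: an update at \<open>f i\<close> changes the pulled back environment at
  \<open>i\<close> alone.\<close>

lemma sat_ren_fm: "inj f \<Longrightarrow> sat e (ren_fm f \<phi>) = sat (\<lambda>i. e (f i)) \<phi>"
proof (induction \<phi> arbitrary: e)
  case (Rel n X ts)
  show ?case by (simp add: eval_ren_tm cong: map_cong)
next
  case (Ex i \<phi>)
  have "(\<lambda>j. (e(f i := r)) (f j)) = (\<lambda>j. e (f j))(i := r)" for r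
    using Ex.prems by (auto simp: inj_eq)
  then show ?case using Ex by simp
qed (auto simp: eval_ren_tm)

text \<open>Even variables carry the environment, odd ones the parameters.\<close>

definition mix :: "point \<Rightarrow> point \<Rightarrow> point" where
  "mix e a = (\<lambda>k. if even k then e (k div 2) else a (k div 2))"

lemma inj_parity:
  assumes "inj g" "inj h" "\<And>i j. g i \<noteq> h j"
  shows "inj (\<lambda>k::nat. if even k then g (k div 2) else h (k div 2))"
proof (rule injI)
  fix x y :: nat
  assume "(if even x then g (x div 2) else h (x div 2)) = (if even y then g (y div 2) else h (y div 2))"
  then have "(even x \<longleftrightarrow> even y) \<and> x div 2 = y div 2"
    using assms by (auto simp: inj_eq split: if_splits) (metis assms(3))+
  then show "x = y"
    by (metis even_two_times_div_two odd_two_times_div_two_succ)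
qed

text \<open>The predicate reads a whole environment and carries no arity, so one statement serves in
  every dimension and below any number of quantifiers. The closure rules that follow replace the
  writing of formulas.\<close>

definition dpred :: "rstruct \<Rightarrow> (point \<Rightarrow> bool) \<Rightarrow> bool" where
  "dpred M P \<longleftrightarrow> (\<exists>\<phi> a. wf_fm M \<phi> \<and> (\<forall>e. P e \<longleftrightarrow> sat (mix e a) \<phi>))"

lemma dpredI_ren:
  assumes "wf_fm M \<phi>" "inj f" "\<And>e. P e \<longleftrightarrow> sat (\<lambda>i. mix e a (f i)) \<phi>"
  shows "dpred M P"
  unfolding dpred_def using assms by (metis wf_ren_fm sat_ren_fm)

lemma dpred_not: "dpred M P \<Longrightarrow> dpred M (\<lambda>e. \<not> P e)"
  unfolding dpred_def by (metis wf_fm.simps(3) sat.simps(3))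

lemma dpred_conj:
  assumes "dpred M P" "dpred M Q"
  shows "dpred M (\<lambda>e. P e \<and> Q e)"
proof -
  obtain \<phi> a where \<phi>: "wf_fm M \<phi>" "\<And>e. P e \<longleftrightarrow> sat (mix e a) \<phi>"
    using assms(1) by (auto simp: dpred_def)
  obtain \<psi> b where \<psi>: "wf_fm M \<psi>" "\<And>e. Q e \<longleftrightarrow> sat (mix e b) \<psi>"
    using assms(2) by (auto simp: dpred_def)
  \<comment> \<open>The two parameter sequences are interleaved: parameter \<open>i\<close> of the
    first formula becomes parameter \<open>2 * i\<close>, hence variable \<open>4 * i + 1\<close>,
    and parameter \<open>i\<close> of the second becomes variable \<open>4 * i + 3\<close>.\<close>
  define f where "f = (\<lambda>k::nat. if even k then 2 * (k div 2) else 4 * (k div 2) + 1)"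
  define g where "g = (\<lambda>k::nat. if even k then 2 * (k div 2) else 4 * (k div 2) + 3)"
  have f: "inj f"
    unfolding f_def by (rule inj_parity) (auto simp: inj_def, presburger)
  have g: "inj g"
    unfolding g_def by (rule inj_parity) (auto simp: inj_def, presburger)
  have half: "(4 * i + 1) div 2 = 2 * i" "(4 * i + 3) div 2 = 2 * i + 1" for i :: nat
    by simp_all
  have "mix e (mix a b) (f k) = mix e a k" "mix e (mix a b) (g k) = mix e b k" for e k
    by (cases "even k"; elim evenE oddE; simp add: f_def g_def mix_def half)+
  then show ?thesis
    unfolding dpred_def using \<phi> \<psi> sat_ren_fm[OF f] sat_ren_fm[OF g]
    by (intro exI[of _ "Conj (ren_fm f \<phi>) (ren_fm g \<psi>)"] exI[of _ "mix a b"])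
      (simp add: wf_ren_fm)
qed

lemma dpred_disj: "dpred M P \<Longrightarrow> dpred M Q \<Longrightarrow> dpred M (\<lambda>e. P e \<or> Q e)"
  using dpred_not[OF dpred_conj[OF dpred_not dpred_not], of M P Q] by simp

lemma dpred_imp: "dpred M P \<Longrightarrow> dpred M Q \<Longrightarrow> dpred M (\<lambda>e. P e \<longrightarrow> Q e)"
  unfolding imp_conv_disj by (intro dpred_disj dpred_not)

lemma dpred_rename:
  assumes "dpred M P" "inj f"
  shows "dpred M (\<lambda>e. P (\<lambda>i. e (f i)))"
proof -
  obtain \<phi> a where \<phi>: "wf_fm M \<phi>" "\<And>e. P e \<longleftrightarrow> sat (mix e a) \<phi>"
    using assms(1) by (auto simp: dpred_def)
  define g where "g = (\<lambda>k. if even k then 2 * f (k div 2) else 2 * (k div 2) + 1)"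
  have g: "inj g"
    unfolding g_def using assms(2) by (intro inj_parity) (auto simp: inj_def, presburger)
  have "(\<lambda>k. mix e a (g k)) = mix (\<lambda>i. e (f i)) a" for e
    by (auto simp: mix_def g_def)
  then show ?thesis
    using \<phi> by (intro dpredI_ren[OF \<phi>(1) g, of _ a]) simp
qed

text \<open>In \<open>dpred_ex\<close>, as in de Bruijn notation, the bound variable is variable \<open>0\<close>.\<close>

lemma dpred_ex:
  assumes "dpred M (\<lambda>e. Q (\<lambda>i. e (Suc i)) (e 0))"
  shows "dpred M (\<lambda>e. \<exists>r. Q e r)"
proof -
  obtain \<phi> a where \<phi>: "wf_fm M \<phi>" "\<And>e. Q (\<lambda>i. e (Suc i)) (e 0) \<longleftrightarrow> sat (mix e a) \<phi>"
    using assms by (auto simp: dpred_def)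
  \<comment> \<open>The bound variable takes the slot of parameter 0, which is variable 1. The true
    parameters move up by one to make room, and the rest of the environment moves down by
    one.\<close>
  define f where "f = (\<lambda>k. if even k then (case k div 2 of 0 \<Rightarrow> 1 | Suc j \<Rightarrow> 2 * j)
    else 2 * (k div 2) + 3)"
  have f: "inj f"
    unfolding f_def by (rule inj_parity) (auto simp: inj_def split: nat.splits, presburger+)
  have eq: "(\<lambda>k. ((mix e (case_nat 0 a))(1 := r)) (f k)) = mix (case_nat r e) a" for e r
    by (auto simp: f_def mix_def split: nat.split)
  have Q: "Q e r \<longleftrightarrow> sat (mix (case_nat r e) a) \<phi>" for e r
    using \<phi>(2)[of "case_nat r e"] by simp
  have "sat (mix e (case_nat 0 a)) (Ex 1 (ren_fm f \<phi>)) \<longleftrightarrow> (\<exists>r. Q e r)" for e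
    by (simp only: sat.simps sat_ren_fm[OF f] eq Q)
  then show ?thesis
    unfolding dpred_def using \<phi>(1)
    by (intro exI[of _ "Ex 1 (ren_fm f \<phi>)"] exI[of _ "case_nat 0 a"]) (simp add: wf_ren_fm)
qed

lemma dpred_all:
  assumes "dpred M (\<lambda>e. Q (\<lambda>i. e (Suc i)) (e 0))"
  shows "dpred M (\<lambda>e. \<forall>r. Q e r)"
  using dpred_not[OF dpred_ex, OF dpred_not, OF assms] by simp

lemma dpred_ex_block:
  assumes "dpred M (\<lambda>e. Q (\<lambda>i. e (i + n)) (pr {..<n} e))"
  shows "dpred M (\<lambda>e. \<exists>y \<in> pts {..<n}. Q e y)"
  using assms
proof (induction n arbitrary: Q)
  case 0
  have "pts {..<0::nat} = {\<lambda>i. 0}" "pr {..<0} = (\<lambda>e i. 0)"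
    by (auto simp: pts_def pr_def)
  with 0 show ?case by simp
next
  case (Suc n)
  define R where "R e y \<longleftrightarrow> (\<exists>r. Q e (y(n := r)))" for e y
  have "dpred M (\<lambda>e. Q (\<lambda>i. e (i + Suc n)) (pr {..<Suc n} e))"
    by (rule Suc.prems)
  then have "dpred M (\<lambda>e. Q (\<lambda>i. e (Suc (i + n))) ((pr {..<n} (\<lambda>i. e (Suc i)))(n := e 0)))"
    (is "dpred M ?P")
  proof -
    \<comment> \<open>Coordinate \<open>n\<close>, the last of the block, is quantified innermost
      and so must sit at variable 0; the other coordinates of the block move up by one.\<close>
    define f where "f k = (if k < n then Suc k else if k = n then 0 else k)" for k
    have f: "inj f" by (auto simp: inj_def f_def split: if_splits)
    have 1: "pr {..<Suc n} (\<lambda>i. e (f i)) = (pr {..<n} (\<lambda>i. e (Suc i)))(n := e 0)" for e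
      by (auto simp: pr_def f_def fun_eq_iff)
    have 2: "(\<lambda>i. e (f (i + Suc n))) = (\<lambda>i. e (Suc (i + n)))" for e :: point
      by (auto simp: f_def)
    show ?thesis
      using dpred_rename[OF Suc.prems f] by (simp only: 1 2)
  qed
  then have "dpred M (\<lambda>e. R (\<lambda>i. e (i + n)) (pr {..<n} e))"
    unfolding R_def by (rule dpred_ex)
  then have "dpred M (\<lambda>e. \<exists>y \<in> pts {..<n}. R e y)"
    by (rule Suc.IH)
  moreover have "(\<exists>y \<in> pts {..<n}. R e y) \<longleftrightarrow> (\<exists>y \<in> pts {..<Suc n}. Q e y)" for e
  proof
    assume "\<exists>y \<in> pts {..<n}. R e y"
    then obtain y r where "y \<in> pts {..<n}" "Q e (y(n := r))" by (auto simp: R_def)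
    moreover have "y(n := r) \<in> pts {..<Suc n}" using \<open>y \<in> pts {..<n}\<close> by (auto simp: pts_def)
    ultimately show "\<exists>y \<in> pts {..<Suc n}. Q e y" by blast
  next
    assume "\<exists>y \<in> pts {..<Suc n}. Q e y"
    then obtain y where y: "y \<in> pts {..<Suc n}" "Q e y" by blast
    have "(y(n := 0))(n := y n) = y" by simp
    moreover have "y(n := 0) \<in> pts {..<n}" using y by (auto simp: pts_def less_Suc_eq)
    ultimately show "\<exists>y \<in> pts {..<n}. R e y" unfolding R_def using y by metis
  qed
  ultimately show ?case by simp
qed

lemma definable_subset: "definable M n E \<Longrightarrow> E \<subseteq> pts {..<n}"
  by (auto simp: definable_def topspace_Euclidean_space_pts)

lemma dpred_definable:
  assumes "definable M n E"
  shows "dpred M (\<lambda>e. pr {..<n} e \<in> E)"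
proof -
  obtain \<phi> a where \<phi>: "wf_fm M \<phi>" "E = {x \<in> pts {..<n}. sat (\<lambda>i. if i < n then x i else a i) \<phi>}"
    using assms by (auto simp: definable_def topspace_Euclidean_space_pts)
  define f where "f k = (if k < n then 2 * k else 2 * k + 1)" for k
  have f: "inj f"
  proof (rule injI)
    fix x y assume "f x = f y"
    then have "x < n \<longleftrightarrow> y < n" by (simp add: f_def split: if_splits)
    then show "x = y" using \<open>f x = f y\<close> by (auto simp: f_def split: if_splits)
  qed
  have "mix e a (f k) = (if k < n then pr {..<n} e k else a k)" for e k
    by (auto simp: mix_def f_def pr_def)
  then show ?thesis
    using \<phi>(2) by (intro dpredI_ren[OF \<phi>(1) f, of _ a]) simp
qed

lemma definable_dpred:
  assumes "dpred M P"
  shows "definable M n {x \<in> pts {..<n}. P x}"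
proof -
  obtain \<phi> a where \<phi>: "wf_fm M \<phi>" "\<And>e. P e \<longleftrightarrow> sat (mix e a) \<phi>"
    using assms by (auto simp: dpred_def)
  define f where "f = (\<lambda>k. if even k then (if k div 2 < n then k div 2 else n + 2 * (k div 2))
    else n + 2 * (k div 2) + 1)"
  \<comment> \<open>The value 0 stands for environment variables from \<open>n\<close> on, where a
    point of \<open>pts {..<n}\<close> vanishes anyway.\<close>
  define b where "b k = (if even (k - n) then 0 else a ((k - n) div 2))" for k
  have f: "inj f"
    unfolding f_def by (rule inj_parity) (auto simp: inj_def, presburger+)
  have eq: "(\<lambda>k. if f k < n then x (f k) else b (f k)) = mix x a" if "x \<in> pts {..<n}" for x
    using that by (auto simp: mix_def f_def b_def pts_def fun_eq_iff)
  show ?thesis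
    unfolding definable_def topspace_Euclidean_space_pts
    using \<phi> eq by (intro exI[of _ "ren_fm f \<phi>"] exI[of _ b]) (auto simp: wf_ren_fm sat_ren_fm[OF f])
qed

section \<open>Definable functions over the ordered group\<close>

locale ordered_group_structure =
  fixes M :: rstruct
  assumes plus_Funs: "(2, \<lambda>x. x 0 + x 1) \<in> Funs M"
    and less_Rels: "(2, {x \<in> topspace (Euclidean_space 2). x 0 < x 1}) \<in> Rels M"
begin

text \<open>The value sits at variable 0, in front of the arguments. Any function with definable
  graph counts, so absolute values and distances can be used like terms of the language.\<close>

definition dterm :: "(point \<Rightarrow> real) \<Rightarrow> bool" where
  "dterm t \<longleftrightarrow> dpred M (\<lambda>e. e 0 = t (\<lambda>i. e (Suc i)))"

lemma dpred_let:
  assumes "dterm t" "dpred M (\<lambda>e. Q (\<lambda>i. e (Suc i)) (e 0))"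
  shows "dpred M (\<lambda>e. Q e (t e))"
proof -
  have "dpred M (\<lambda>e. \<exists>r. r = t e \<and> Q e r)"
    by (rule dpred_ex) (intro dpred_conj assms assms(1)[unfolded dterm_def])
  then show ?thesis by simp
qed

lemma dpred_eq_var: "dpred M (\<lambda>e. e i = e j)"
  unfolding dpred_def
  by (intro exI[of _ "Eq (Var (2 * i)) (Var (2 * j))"] exI[of _ "\<lambda>_. 0"]) (simp add: mix_def)

lemma dpred_less_var: "dpred M (\<lambda>e. e i < e j)"
  unfolding dpred_def
  by (intro exI[of _ "Rel 2 {x \<in> topspace (Euclidean_space 2). x 0 < x 1} [Var (2 * i), Var (2 * j)]"]
      exI[of _ "\<lambda>_. 0"]) (use less_Rels in \<open>simp add: mix_def point_of_def topspace_Euclidean_space\<close>)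

lemma dpred_plus_var: "dpred M (\<lambda>e. e i = e j + e k)"
  unfolding dpred_def
  by (intro exI[of _ "Eq (Var (2 * i)) (App 2 (\<lambda>x. x 0 + x 1) [Var (2 * j), Var (2 * k)])"]
      exI[of _ "\<lambda>_. 0"]) (use plus_Funs in \<open>auto simp: mix_def point_of_def\<close>)

lemma dterm_var: "dterm (\<lambda>e. e i)"
  unfolding dterm_def by (rule dpred_eq_var)

lemma dterm_const: "dterm (\<lambda>e. c)"
  unfolding dterm_def dpred_def
  by (intro exI[of _ "Eq (Var 0) (Var 1)"] exI[of _ "\<lambda>_. c"]) (simp add: mix_def)

lemma dterm_rename: "dterm t \<Longrightarrow> inj f \<Longrightarrow> dterm (\<lambda>e. t (\<lambda>i. e (f i)))"
  unfolding dterm_def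
proof -
  assume t: "dpred M (\<lambda>e. e 0 = t (\<lambda>i. e (Suc i)))" and f: "inj f"
  have g: "inj (\<lambda>i. case i of 0 \<Rightarrow> 0 | Suc i \<Rightarrow> Suc (f i))"
    by (rule injI) (auto dest: injD[OF f] split: nat.splits)
  show "dpred M (\<lambda>e. e 0 = t (\<lambda>i. e (Suc (f i))))"
    using dpred_rename[OF t g] by simp
qed

lemma dterm_shift: "dterm t \<Longrightarrow> dterm (\<lambda>e. t (\<lambda>i. e (Suc i)))"
  by (rule dterm_rename) auto

lemma dpred_eq: "dterm s \<Longrightarrow> dterm t \<Longrightarrow> dpred M (\<lambda>e. s e = t e)"
  by (rule dpred_let[where t = s], assumption) (rule dpred_let[OF dterm_shift], assumption, rule dpred_eq_var)

lemma dpred_less: "dterm s \<Longrightarrow> dterm t \<Longrightarrow> dpred M (\<lambda>e. s e < t e)"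
  by (rule dpred_let[where t = s], assumption) (rule dpred_let[OF dterm_shift], assumption, rule dpred_less_var)

lemma dpred_le: "dterm s \<Longrightarrow> dterm t \<Longrightarrow> dpred M (\<lambda>e. s e \<le> t e)"
  using dpred_not[OF dpred_less[of t s]] by (simp add: not_less)

lemma dterm_plus: "dterm s \<Longrightarrow> dterm t \<Longrightarrow> dterm (\<lambda>e. s e + t e)"
  unfolding dterm_def[of "\<lambda>e. s e + t e"]
  by (rule dpred_let[OF dterm_shift[of s]], assumption)
    (rule dpred_let[OF dterm_shift[OF dterm_shift]], assumption, rule dpred_plus_var)

lemma dterm_diff: "dterm s \<Longrightarrow> dterm t \<Longrightarrow> dterm (\<lambda>e. s e - t e)"
  unfolding dterm_def[of "\<lambda>e. s e - t e"] eq_diff_eq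
  by (intro dpred_eq dterm_plus dterm_var dterm_shift)

lemma dterm_uminus: "dterm t \<Longrightarrow> dterm (\<lambda>e. - t e)"
  using dterm_diff[OF dterm_const[of 0]] by simp

lemma dterm_if: "dterm s \<Longrightarrow> dterm t \<Longrightarrow> dterm (\<lambda>e. if b then s e else t e)"
  by (cases b) simp_all

lemma dpred_const: "dpred M (\<lambda>e. b)"
  using dpred_eq[OF dterm_const[of 0] dterm_const[of "if b then 0 else 1"]] by (cases b) auto

lemma dterm_abs: "dterm t \<Longrightarrow> dterm (\<lambda>e. \<bar>t e\<bar>)"
proof -
  assume t: "dterm t"
  have eq: "e 0 = \<bar>u\<bar> \<longleftrightarrow> (0 \<le> u \<and> e 0 = u) \<or> (u < 0 \<and> e 0 = - u)" for e :: point and u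
    by auto
  show ?thesis
    unfolding dterm_def eq
    by (intro dpred_disj dpred_conj dpred_eq dpred_le dpred_less dterm_var dterm_const dterm_uminus
        dterm_shift t)
qed

lemma dterm_sum: "(\<And>k. k \<in> I \<Longrightarrow> dterm (t k)) \<Longrightarrow> dterm (\<lambda>e. \<Sum>k\<in>I. t k e)"
proof (induction I rule: infinite_finite_induct)
  case (insert x F)
  then show ?case by (simp add: dterm_plus)
qed (simp_all add: dterm_const)

lemma dterm_pr: "dterm (\<lambda>e. x e k) \<Longrightarrow> dterm (\<lambda>e. pr I (x e) k)"
  by (simp add: pr_def dterm_if dterm_const)

lemma dpred_finite_all: "finite I \<Longrightarrow> (\<And>k. k \<in> I \<Longrightarrow> dpred M (P k)) \<Longrightarrow> dpred M (\<lambda>e. \<forall>k\<in>I. P k e)"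
proof (induction I rule: finite_induct)
  case (insert x F)
  then show ?case by (simp add: dpred_conj)
qed (simp add: dpred_const)

lemma dpred_vec_eq:
  assumes "\<And>e. x e \<in> pts {..<n}" "\<And>e. y e \<in> pts {..<n}"
    "\<And>k. dterm (\<lambda>e. x e k)" "\<And>k. dterm (\<lambda>e. y e k)"
  shows "dpred M (\<lambda>e. x e = y e)"
proof -
  have eq: "x e = y e \<longleftrightarrow> (\<forall>k\<in>{..<n}. x e k = y e k)" for e
    using assms(1,2)[of e] by (auto simp: pts_def fun_eq_iff) (metis lessThan_iff)
  show ?thesis
    unfolding eq by (intro dpred_finite_all dpred_eq assms) auto
qed

lemma dpred_in:
  assumes "definable M n E" "\<And>e. x e \<in> pts {..<n}" "\<And>k. dterm (\<lambda>e. x e k)"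
  shows "dpred M (\<lambda>e. x e \<in> E)"
proof -
  \<comment> \<open>In the graph of coordinate \<open>k\<close> the value is read from position
    \<open>k\<close> of the new block of \<open>n\<close> variables, and the old environment is read
    above that block.\<close>
  define sh where "sh k i = (case i of 0 \<Rightarrow> k | Suc i \<Rightarrow> i + n)" for k i :: nat
  have sh: "inj (sh k)" if "k < n" for k
    using that by (auto simp: inj_def sh_def split: nat.splits)
  have "dpred M (\<lambda>e. e k = x (\<lambda>i. e (i + n)) k)" if "k < n" for k
    using dpred_rename[OF assms(3)[unfolded dterm_def, of k] sh[OF that]] by (simp add: sh_def)
  then have "dpred M (\<lambda>e. pr {..<n} e k = x (\<lambda>i. e (i + n)) k)" if "k < n" for k
    using that by (simp add: pr_def)
  then have "dpred M (\<lambda>e. \<exists>y \<in> pts {..<n}. (\<forall>k\<in>{..<n}. y k = x e k) \<and> y \<in> E)"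
    by (intro dpred_ex_block dpred_conj dpred_finite_all dpred_definable assms) auto
  moreover have "(\<exists>y \<in> pts {..<n}. (\<forall>k\<in>{..<n}. y k = x e k) \<and> y \<in> E) \<longleftrightarrow> x e \<in> E" for e
  proof
    assume "\<exists>y \<in> pts {..<n}. (\<forall>k\<in>{..<n}. y k = x e k) \<and> y \<in> E"
    then obtain y where y: "y \<in> pts {..<n}" "\<forall>k\<in>{..<n}. y k = x e k" "y \<in> E" by blast
    then have "y = x e"
      using assms(2)[of e] by (fastforce simp: pts_def)
    then show "x e \<in> E" using y by simp
  next
    assume "x e \<in> E"
    then show "\<exists>y \<in> pts {..<n}. (\<forall>k\<in>{..<n}. y k = x e k) \<and> y \<in> E"
      using assms(2) by auto
  qed
  ultimately show ?thesis by simp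
qed

lemma dpred_ex_in:
  assumes "definable M n A" "dpred M (\<lambda>e. Q (\<lambda>i. e (i + n)) (pr {..<n} e))"
  shows "dpred M (\<lambda>e. \<exists>y \<in> A. Q e y)"
proof -
  have "dpred M (\<lambda>e. \<exists>y \<in> pts {..<n}. y \<in> A \<and> Q e y)"
    by (intro dpred_ex_block dpred_conj assms dpred_definable)
  moreover have "(\<exists>y \<in> pts {..<n}. y \<in> A \<and> Q e y) \<longleftrightarrow> (\<exists>y \<in> A. Q e y)" for e
    using definable_subset[OF assms(1)] by blast
  ultimately show ?thesis by simp
qed

lemma dpred_all_in:
  assumes "definable M n A" "dpred M (\<lambda>e. Q (\<lambda>i. e (i + n)) (pr {..<n} e))"
  shows "dpred M (\<lambda>e. \<forall>y \<in> A. Q e y)"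
  using dpred_not[OF dpred_ex_in, OF assms(1) dpred_not, OF assms(2)] by simp

lemma definableI:
  assumes "E \<subseteq> pts {..<n}" "dpred M P" "\<And>x. x \<in> pts {..<n} \<Longrightarrow> x \<in> E \<longleftrightarrow> P x"
  shows "definable M n E"
proof -
  have "E = {x \<in> pts {..<n}. P x}" using assms by blast
  then show ?thesis using definable_dpred[OF assms(2)] by simp
qed

end

section \<open>Components of a graph on a discrete set\<close>

definition dist1 :: "nat \<Rightarrow> point \<Rightarrow> point \<Rightarrow> real" where
  "dist1 n x y = (\<Sum>i<n. \<bar>x i - y i\<bar>)"

lemma dist1_nonneg [simp]: "0 \<le> dist1 n x y"
  by (simp add: dist1_def sum_nonneg)

lemma dist1_self [simp]: "dist1 n x x = 0"
  by (simp add: dist1_def)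

lemma dist1_commute: "dist1 n x y = dist1 n y x"
  by (simp add: dist1_def abs_minus_commute)

lemma dist1_triangle: "dist1 n x z \<le> dist1 n x y + dist1 n y z"
  unfolding dist1_def sum.distrib[symmetric] by (rule sum_mono) linarith

lemma coord_le_dist1: "i < n \<Longrightarrow> \<bar>x i - y i\<bar> \<le> dist1 n x y"
  unfolding dist1_def by (rule member_le_sum[of i "{..<n}"]) auto

lemma dist1_eq_0D: "x \<in> pts {..<n} \<Longrightarrow> y \<in> pts {..<n} \<Longrightarrow> dist1 n x y \<le> 0 \<Longrightarrow> x = y"
proof
  fix i
  assume *: "x \<in> pts {..<n}" "y \<in> pts {..<n}" "dist1 n x y \<le> 0"
  show "x i = y i"
    using coord_le_dist1[of i n x y] * by (cases "i < n") (auto simp: pts_def)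
qed

lemma continuous_on_coord:
  fixes f :: "'a::topological_space \<Rightarrow> point"
  assumes "continuous_on S f"
  shows "continuous_on S (\<lambda>x. f x i)"
  using assms by (rule continuous_on_product_then_coordinatewise)

lemma continuous_on_coord_id [continuous_intros]: "continuous_on S (\<lambda>x::point. x i)"
  by (rule continuous_on_coord) (rule continuous_on_id)

lemma continuous_on_dist1 [continuous_intros]:
  fixes f g :: "'a::topological_space \<Rightarrow> point"
  assumes "continuous_on S f" "continuous_on S g"
  shows "continuous_on S (\<lambda>x. dist1 n (f x) (g x))"
  unfolding dist1_def
  by (rule continuous_on_sum, rule continuous_on_rabs, rule continuous_on_diff; rule continuous_on_coord, rule assms)

lemma continuous_on_pr [continuous_intros]:
  fixes f :: "'a::topological_space \<Rightarrow> point"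
  assumes "continuous_on S f"
  shows "continuous_on S (\<lambda>x. pr I (f x))"
  unfolding pr_def
proof (rule continuous_on_coordinatewise_then_product)
  show "continuous_on S (\<lambda>x. if i \<in> I then f x i else 0)" for i
    by (cases "i \<in> I") (auto intro!: continuous_on_const continuous_on_coord assms)
qed

lemma continuous_on_reindex [continuous_intros]: "continuous_on S (\<lambda>(x::point) i. x (h i))"
  by (rule continuous_on_coordinatewise_then_product) (rule continuous_on_coord_id)

lemma open_dist1_ball: "open {y. dist1 n x y < \<epsilon>}"
  by (intro open_Collect_less continuous_intros)

text \<open>Within \<open>pts {..<n}\<close> only finitely many coordinates vary, so finitely many
  radii have a positive minimum and the l1 distance induces the product topology there.\<close>

lemma open_contains_dist1_ball:
  assumes "open U" "x \<in> U" "x \<in> pts {..<n}"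
  obtains \<epsilon> where "\<epsilon> > 0" "\<And>y. y \<in> pts {..<n} \<Longrightarrow> dist1 n x y < \<epsilon> \<Longrightarrow> y \<in> U"
proof -
  have "openin (product_topology (\<lambda>i. euclidean) UNIV) U"
    using assms(1) unfolding open_fun_def .
  from product_topology_open_contains_basis[OF this assms(2)]
  obtain X where X: "x \<in> (\<Pi>\<^sub>E i\<in>UNIV. X i)" "\<And>i. open (X i)" "(\<Pi>\<^sub>E i\<in>UNIV. X i) \<subseteq> U"
    by auto
  have "\<exists>e>0. \<forall>r. \<bar>x i - r\<bar> < e \<longrightarrow> r \<in> X i" for i
  proof -
    have "x i \<in> X i" using X(1) by auto
    then obtain e where "e > 0" "\<And>r. dist r (x i) < e \<Longrightarrow> r \<in> X i"
      using X(2)[of i] unfolding open_dist by metis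
    then show ?thesis by (intro exI[of _ e]) (simp add: dist_real_def abs_minus_commute)
  qed
  then obtain e where e: "\<And>i. e i > 0" "\<And>i r. \<bar>x i - r\<bar> < e i \<Longrightarrow> r \<in> X i" by metis
  define \<epsilon> where "\<epsilon> = Min (insert 1 (e ` {..<n}))"
  have "\<epsilon> > 0" using e by (auto simp: \<epsilon>_def)
  moreover have "y \<in> U" if "y \<in> pts {..<n}" "dist1 n x y < \<epsilon>" for y
  proof -
    have "y i \<in> X i" for i
    proof (cases "i < n")
      case True
      then have "\<epsilon> \<le> e i" by (auto simp: \<epsilon>_def)
      then show ?thesis using coord_le_dist1[OF True, of x y] that e(2)[of i "y i"] by simp
    next
      case False
      then show ?thesis using that(1) assms(3) e(1)[of i] e(2)[of i "y i"] by (auto simp: pts_def)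
    qed
    then show ?thesis using X(3) by auto
  qed
  ultimately show ?thesis using that by blast
qed

lemma closed_pts: "closed (pts I)"
proof -
  have "pts I = (\<Inter>i \<in> - I. {x. x i = 0})" by (auto simp: pts_def)
  moreover have "closed {x::point. x i = 0}" for i
    by (intro closed_Collect_eq continuous_intros)
  ultimately show ?thesis by auto
qed

lemma subtopology_Euclidean_space:
  "E \<subseteq> pts {..<n} \<Longrightarrow> subtopology (Euclidean_space n) E = top_of_set E"
  unfolding Euclidean_space_def euclidean_product_topology[symmetric] subtopology_subtopology
  by (rule arg_cong[where f = "subtopology (powertop_real UNIV)"]) (auto simp: pts_def not_less)

lemma path_component_of_segment:
  fixes p q :: point
  assumes "\<And>t. 0 \<le> t \<Longrightarrow> t \<le> 1 \<Longrightarrow> (\<lambda>i. (1 - t) * p i + t * q i) \<in> E"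
  shows "path_component_of (top_of_set E) p q"
proof -
  define g where "g t = (\<lambda>i. (1 - t) * p i + t * q i)" for t :: real
  have "continuous_on {0..1} g"
    unfolding g_def
    by (rule continuous_on_coordinatewise_then_product) (intro continuous_intros)
  then have "pathin (top_of_set E) g"
    using assms by (auto simp: pathin_def continuous_map_in_subtopology g_def)
  then show ?thesis
    unfolding path_component_of_def by (intro exI[of _ g]) (simp add: g_def)
qed

text \<open>The path component lies in the component and this in the quasicomponent, which lies in
  every clopen set around the point. A clopen set contained in the path component closes this
  chain.\<close>

lemma clopen_path_component_of:
  assumes "openin X C" "closedin X C" "x \<in> C" "\<And>y. y \<in> C \<Longrightarrow> path_component_of X x y"
  shows "C \<in> path_components_of X" "C \<in> connected_components_of X" "C \<in> quasi_components_of X"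
proof -
  have x: "x \<in> topspace X" using assms(1,3) openin_subset by blast
  have q: "quasi_component_of_set X x \<subseteq> C"
    using assms(1-3) by (auto simp: quasi_component_of_def)
  have p: "C \<subseteq> path_component_of_set X x" using assms(4) by auto
  have pc: "path_component_of_set X x \<subseteq> connected_component_of_set X x"
    by (rule path_component_subset_connected_component_of)
  have cq: "connected_component_of_set X x \<subseteq> quasi_component_of_set X x"
    by (rule connected_component_subset_quasi_component_of)
  have "C = path_component_of_set X x" "C = connected_component_of_set X x"
    "C = quasi_component_of_set X x"
    using q p pc cq by blast+
  then show "C \<in> path_components_of X" "C \<in> connected_components_of X" "C \<in> quasi_components_of X"
    using x by (auto simp: path_components_of_def connected_components_of_def quasi_components_of_def)
qed

context ordered_group_structure
begin

lemma dterm_dist1: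
  "(\<And>k. dterm (\<lambda>e. x e k)) \<Longrightarrow> (\<And>k. dterm (\<lambda>e. y e k)) \<Longrightarrow> dterm (\<lambda>e. dist1 n (x e) (y e))"
  unfolding dist1_def by (intro dterm_sum dterm_abs dterm_diff)

lemmas dpred_intros = dpred_not dpred_conj dpred_imp dpred_ex dpred_all dpred_eq dpred_less dpred_le
  dterm_var dterm_const dterm_uminus dterm_pr dterm_dist1

text \<open>
  The graph is realised by \<open>E\<close>: the vertex \<open>x\<close> becomes the union of \<open>{x} \<times> \<real>\<^sup>k \<times> {0}\<close> and
  \<open>\<real>\<^sup>k \<times> {x} \<times> {1}\<close>, and an edge or loop \<open>(x, y)\<close> becomes the segment \<open>{(x, y)} \<times> [0, 1]\<close>. A union
  \<open>EK K'\<close> of components is open because near a point of \<open>E\<close> at height below \<open>1\<close> (above \<open>0\<close>) the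
  first (second) vertex is constant.
\<close>

lemma definable_graph_component:
  assumes closed_comp: "PCC M \<or> CC M \<or> QCC M"
    and D: "definable M k D"
    and discrete: "\<And>x. x \<in> D \<Longrightarrow> \<exists>\<epsilon>>0. \<forall>y\<in>D. dist1 k x y < \<epsilon> \<longrightarrow> y = x"
    and G: "dpred M (\<lambda>e. G (pr {..<k} e) (pr {..<k} (\<lambda>i. e (i + k))))"
    and K: "K \<subseteq> D" "x0 \<in> K"
    and K_closed: "\<And>x y. x \<in> D \<Longrightarrow> y \<in> D \<Longrightarrow> G x y \<Longrightarrow> x \<in> K \<longleftrightarrow> y \<in> K"
    and K_conn: "\<And>x. x \<in> K \<Longrightarrow> (x0, x) \<in> {(x, y). x \<in> K \<and> y \<in> K \<and> (G x y \<or> G y x)}\<^sup>*"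
  shows "definable M k K"
proof -
  define fs where "fs z = pr {..<k} z" for z
  define sn where "sn z = pr {..<k} (\<lambda>i. z (i + k))" for z :: point
  define m where "m = 2 * k"
  define enc where "enc x y t = (\<lambda>i. if i < k then x i else if i < m then y (i - k)
    else if i = m then t else 0)" for x y :: point and t :: real
  have D_pts: "D \<subseteq> pts {..<k}" using D by (rule definable_subset)
  \<comment> \<open>A loop is added at every vertex in order to join its two copies, at heights 0
    and 1.\<close>
  define H where "H x y \<longleftrightarrow> x \<in> D \<and> y \<in> D \<and> (x = y \<or> G x y)" for x y
  define P where "P z \<longleftrightarrow> z m = 0 \<and> fs z \<in> D \<or> z m = 1 \<and> sn z \<in> D \<or>
    0 \<le> z m \<and> z m \<le> 1 \<and> H (fs z) (sn z)" for z
  define E where "E = {z \<in> pts {..<Suc m}. P z}"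
  define EK where "EK K = {z \<in> E. (z m < 1 \<longrightarrow> fs z \<in> K) \<and> (0 < z m \<longrightarrow> sn z \<in> K)}" for K
  have fs_pts: "fs z \<in> pts {..<k}" and sn_pts: "sn z \<in> pts {..<k}" for z
    by (simp_all add: fs_def sn_def)
  have dfs: "dterm (\<lambda>e. fs e i)" and dsn: "dterm (\<lambda>e. sn e i)" for i
    unfolding fs_def sn_def by (intro dterm_pr dterm_var)+
  have "dpred M P"
    unfolding P_def H_def
    by (intro dpred_conj dpred_disj dpred_eq dpred_le dterm_var dterm_const dpred_in[OF D] fs_pts sn_pts
        dpred_vec_eq[of _ k] dfs dsn G[folded fs_def sn_def])
  then have E: "definable M (Suc m) E"
    unfolding E_def by (rule definable_dpred)
  have EK_open: "openin (top_of_set E) (EK K')"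
    if K': "K' \<subseteq> D" "\<And>x y. x \<in> D \<Longrightarrow> y \<in> D \<Longrightarrow> G x y \<Longrightarrow> x \<in> K' \<longleftrightarrow> y \<in> K'" for K'
  proof (subst openin_subopen, intro ballI)
    fix z assume z: "z \<in> EK K'"
    show "\<exists>T. openin (top_of_set E) T \<and> z \<in> T \<and> T \<subseteq> EK K'"
    proof (cases "z m < 1")
      case True
      then have "fs z \<in> K'" using z by (simp add: EK_def)
      with K'(1) obtain \<epsilon> where e: "\<epsilon> > 0" "\<And>y. y \<in> D \<Longrightarrow> dist1 k (fs z) y < \<epsilon> \<Longrightarrow> y = fs z"
        using discrete by blast
      define U where "U = {w. dist1 k (fs z) (fs w) < \<epsilon>} \<inter> {w. w m < 1}"
      have "open U"
        unfolding U_def fs_def by (intro open_Int open_Collect_less continuous_intros)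
      moreover have "z \<in> U" using True e by (simp add: U_def)
      moreover have "E \<inter> U \<subseteq> EK K'"
      proof
        fix w assume w: "w \<in> E \<inter> U"
        then have "fs w \<in> D" by (auto simp: E_def P_def U_def H_def)
        then have "fs w = fs z" using e w by (auto simp: U_def)
        then have "fs w \<in> K'" using \<open>fs z \<in> K'\<close> by simp
        moreover have "sn w \<in> K'" if "0 < w m"
        proof -
          have "H (fs w) (sn w)" using w that by (auto simp: E_def P_def U_def)
          then show ?thesis using K'(2) \<open>fs w \<in> K'\<close> by (auto simp: H_def)
        qed
        ultimately show "w \<in> EK K'" using w by (simp add: EK_def)
      qed
      ultimately show ?thesis
        using z by (intro exI[of _ "E \<inter> U"]) (auto simp: openin_open EK_def)
    next
      case False
      then have "z m = 1" using z by (auto simp: EK_def E_def P_def)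
      then have "sn z \<in> K'" using z by (simp add: EK_def)
      with K'(1) obtain \<epsilon> where e: "\<epsilon> > 0" "\<And>y. y \<in> D \<Longrightarrow> dist1 k (sn z) y < \<epsilon> \<Longrightarrow> y = sn z"
        using discrete by blast
      define U where "U = {w. dist1 k (sn z) (sn w) < \<epsilon>} \<inter> {w. 0 < w m}"
      have "open U"
        unfolding U_def sn_def by (intro open_Int open_Collect_less continuous_intros)
      moreover have "z \<in> U" using \<open>z m = 1\<close> e by (simp add: U_def)
      moreover have "E \<inter> U \<subseteq> EK K'"
      proof
        fix w assume w: "w \<in> E \<inter> U"
        then have "sn w \<in> D" by (auto simp: E_def P_def U_def H_def)
        then have "sn w = sn z" using e w by (auto simp: U_def)
        then have "sn w \<in> K'" using \<open>sn z \<in> K'\<close> by simp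
        moreover have "fs w \<in> K'" if "w m < 1"
        proof -
          have "H (fs w) (sn w)" using w that by (auto simp: E_def P_def U_def)
          then show ?thesis using K'(2) \<open>sn w \<in> K'\<close> by (auto simp: H_def)
        qed
        ultimately show "w \<in> EK K'" using w by (simp add: EK_def)
      qed
      ultimately show ?thesis
        using z by (intro exI[of _ "E \<inter> U"]) (auto simp: openin_open EK_def)
    qed
  qed
  \<comment> \<open>No edge leaves \<open>K\<close>, so the complement has the same shape with
    \<open>D - K\<close> in place of \<open>K\<close>. Openness of all such sets then gives
    closedness.\<close>
  have "z \<in> E - EK K \<longleftrightarrow> z \<in> EK (D - K)" for z
  proof -
    have "P z \<Longrightarrow> z m < 1 \<Longrightarrow> fs z \<in> D" "P z \<Longrightarrow> 0 < z m \<Longrightarrow> sn z \<in> D" "P z \<Longrightarrow> 0 \<le> z m \<and> z m \<le> 1"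
      by (auto simp: P_def H_def)
    moreover have "P z \<Longrightarrow> 0 < z m \<Longrightarrow> z m < 1 \<Longrightarrow> fs z \<in> K \<longleftrightarrow> sn z \<in> K"
      using K_closed[of "fs z" "sn z"] by (auto simp: P_def H_def)
    ultimately show ?thesis
      unfolding EK_def E_def by (cases "z m < 1"; cases "0 < z m"; simp; blast)
  qed
  then have "E - EK K = EK (D - K)" by blast
  moreover have "openin (top_of_set E) (EK (D - K))"
    by (rule EK_open) (use K_closed in blast)+
  ultimately have EK_closed: "closedin (top_of_set E) (EK K)"
    by (auto simp: closedin_def EK_def)
  let ?C = "path_component_of (top_of_set E)"
  have enc_E: "enc x y t \<in> E \<longleftrightarrow> t = 0 \<and> x \<in> D \<or> t = 1 \<and> y \<in> D \<or> 0 \<le> t \<and> t \<le> 1 \<and> H x y"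
    and fs_enc: "fs (enc x y t) = x" and sn_enc: "sn (enc x y t) = y"
    if "x \<in> pts {..<k}" "y \<in> pts {..<k}" for x y t
  proof -
    show *: "fs (enc x y t) = x" "sn (enc x y t) = y"
      using that by (auto simp: fs_def sn_def enc_def pr_def pts_def m_def fun_eq_iff)
    have "enc x y t \<in> pts {..<Suc m}" "enc x y t m = t"
      by (auto simp: enc_def pts_def m_def)
    then show "enc x y t \<in> E \<longleftrightarrow> t = 0 \<and> x \<in> D \<or> t = 1 \<and> y \<in> D \<or> 0 \<le> t \<and> t \<le> 1 \<and> H x y"
      by (simp add: E_def P_def *)
  qed
  have lin: "(\<lambda>i. (1 - s) * enc x y t i + s * enc x' y' t' i) =
    enc (\<lambda>i. (1 - s) * x i + s * x' i) (\<lambda>i. (1 - s) * y i + s * y' i) ((1 - s) * t + s * t')"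
    for x y t x' y' t' s
    by (auto simp: enc_def)
  have lin_pts: "(\<lambda>i. (1 - s) * x i + s * y i) \<in> pts {..<k}"
    if "x \<in> pts {..<k}" "y \<in> pts {..<k}" for x y s
    using that by (auto simp: pts_def)
  have triv: "(\<lambda>i. (1 - s) * x i + s * x i) = x" "(1 - s) * t + s * t = t" for x :: point and s t :: real
    by (auto simp: algebra_simps)
  have C0: "?C (enc x u 0) (enc x v 0)" if "x \<in> D" "u \<in> pts {..<k}" "v \<in> pts {..<k}" for x u v
    by (rule path_component_of_segment)
      (use that D_pts lin_pts enc_E in \<open>auto simp: lin triv\<close>)
  have C1: "?C (enc u y 1) (enc v y 1)" if "y \<in> D" "u \<in> pts {..<k}" "v \<in> pts {..<k}" for y u v
    by (rule path_component_of_segment)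
      (use that D_pts lin_pts enc_E in \<open>auto simp: lin triv\<close>)
  have CH: "?C (enc x y s) (enc x y t)" if "H x y" "0 \<le> s" "s \<le> 1" "0 \<le> t" "t \<le> 1" for x y s t
  proof (rule path_component_of_segment)
    fix r :: real assume r: "0 \<le> r" "r \<le> 1"
    have "0 \<le> (1 - r) * s + r * t" "(1 - r) * s + r * t \<le> 1"
      using that r by (auto intro: convex_bound_le)
    moreover have "x \<in> pts {..<k}" "y \<in> pts {..<k}" using that(1) D_pts by (auto simp: H_def)
    ultimately show "(\<lambda>i. (1 - r) * enc x y s i + r * enc x y t i) \<in> E"
      unfolding lin triv using enc_E that(1) by simp
  qed
  note sym = path_component_of_sym[of "top_of_set E"] and trans = path_component_of_trans[of "top_of_set E"]
  \<comment> \<open>The path shifts the free second vertex from \<open>x\<close> to \<open>y\<close>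
    at height 0, climbs the edge \<open>(x, y)\<close>, shifts the first vertex, now free, from
    \<open>x\<close> to \<open>y\<close> at height 1, and descends along the loop at
    \<open>y\<close>.\<close>
  have step: "?C (enc x x 0) (enc y y 0)" if "H x y" for x y
  proof -
    have xy: "x \<in> D" "y \<in> D" "H y y" using that by (auto simp: H_def)
    then have p: "x \<in> pts {..<k}" "y \<in> pts {..<k}" using D_pts by auto
    have "?C (enc x x 0) (enc x y 0)" using C0 xy p by blast
    moreover have "?C (enc x y 0) (enc x y 1)" using CH that by simp
    moreover have "?C (enc x y 1) (enc y y 1)" using C1 xy p by blast
    moreover have "?C (enc y y 1) (enc y y 0)" using CH xy by simp
    ultimately show ?thesis by (meson trans)
  qed
  have base: "?C (enc x0 x0 0) (enc x x 0)" if "x \<in> K" for x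
    using K_conn[OF that]
  proof (induction rule: rtrancl_induct)
    case base
    then show ?case using C0[of x0 x0 x0] K D_pts by blast
  next
    case (step y z)
    then have "H y z \<or> H z y" using K(1) by (auto simp: H_def)
    then have "?C (enc y y 0) (enc z z 0)" using \<open>\<And>x y. H x y \<Longrightarrow> ?C (enc x x 0) (enc y y 0)\<close> sym by blast
    then show ?case using step.IH trans by blast
  qed
  have all: "?C (enc x0 x0 0) z" if "z \<in> EK K" for z
  proof -
    define x y t where "x = fs z" and "y = sn z" and "t = z m"
    have z: "z = enc x y t"
      using that by (auto simp: x_def y_def t_def EK_def E_def fs_def sn_def enc_def pr_def pts_def m_def fun_eq_iff)
    have p: "x \<in> pts {..<k}" "y \<in> pts {..<k}" by (simp_all add: x_def y_def fs_pts sn_pts)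
    have "z \<in> E" using that by (simp add: EK_def)
    then consider "t = 0" "x \<in> D" | "t = 1" "y \<in> D" | "0 \<le> t" "t \<le> 1" "H x y" "t \<noteq> 1"
      using enc_E[OF p] by (auto simp: z H_def)
    then show ?thesis
    proof cases
      case 1
      then have "x \<in> K" using that by (simp add: EK_def x_def t_def)
      then show ?thesis using base[of x] C0[of x x y] 1 p trans unfolding z by blast
    next
      case 2
      then have "y \<in> K" using that by (simp add: EK_def y_def t_def)
      moreover have "?C (enc y y 0) (enc y y 1)" using CH[of y y 0 1] 2 by (simp add: H_def)
      ultimately show ?thesis using base[of y] C1[of y y x] 2 p trans unfolding z by blast
    next
      case 3
      then have "x \<in> K" using that by (simp add: EK_def x_def t_def)
      moreover have "?C (enc x x 0) (enc x y 0)" using C0[of x x y] 3 p by (simp add: H_def)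
      moreover have "?C (enc x y 0) (enc x y t)" using CH[of x y 0 t] 3 by simp
      ultimately show ?thesis using base[of x] trans unfolding z by blast
    qed
  qed
  have x0: "enc x0 x0 0 \<in> EK K"
  proof -
    have "x0 \<in> D" "x0 \<in> pts {..<k}" using K D_pts by auto
    then show ?thesis using K by (simp add: EK_def enc_E fs_enc) (simp add: enc_def m_def)
  qed
  have comp: "EK K \<in> path_components_of (top_of_set E)" "EK K \<in> connected_components_of (top_of_set E)"
    "EK K \<in> quasi_components_of (top_of_set E)"
    using clopen_path_component_of[OF EK_open[OF K(1) K_closed] EK_closed x0 all] by auto
  have sub: "subtopology (Euclidean_space (Suc m)) E = top_of_set E"
    by (rule subtopology_Euclidean_space) (auto simp: E_def)
  have EKdef: "definable M (Suc m) (EK K)"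
    using closed_comp
  proof (elim disjE)
    assume "PCC M"
    then show ?thesis using E comp(1) unfolding PCC_def by (metis sub)
  next
    assume "CC M"
    then show ?thesis using E comp(2) unfolding CC_def by (metis sub)
  next
    assume "QCC M"
    then show ?thesis using E comp(3) unfolding QCC_def by (metis sub)
  qed
  show ?thesis
  proof (rule definableI)
    show "K \<subseteq> pts {..<k}" using K D_pts by auto
    \<comment> \<open>At height 0 the second block is arbitrary; setting it to 0 recovers
      \<open>K\<close> as a slice of the component.\<close>
    show "dpred M (\<lambda>x. enc x (\<lambda>i. 0) 0 \<in> EK K)"
      unfolding enc_def
      by (intro dpred_in[OF EKdef] dterm_if dterm_var dterm_const) (auto simp: pts_def m_def)
    show "x \<in> K \<longleftrightarrow> enc x (\<lambda>i. 0) 0 \<in> EK K" if x: "x \<in> pts {..<k}" for x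
    proof -
      have "(\<lambda>i. 0) \<in> pts {..<k}" by (simp add: pts_def)
      moreover have "enc x (\<lambda>i. 0) 0 m = 0" by (simp add: enc_def m_def)
      ultimately show ?thesis using x K by (auto simp: EK_def enc_E fs_enc)
    qed
  qed
qed

end

section \<open>Divisibility from an infinite discrete set\<close>

text \<open>Finite initial segments give every nonempty subset a least element, so least elements
  above the previous value can be chosen forever. A point that is missed would have the infinite
  range of \<sigma> below it.\<close>

lemma enumerate_omega:
  fixes T :: "real set"
  assumes inf: "infinite T" and fin: "\<And>t. t \<in> T \<Longrightarrow> finite {u \<in> T. u \<le> t}"
  obtains \<sigma> :: "nat \<Rightarrow> real" where "strict_mono \<sigma>" "range \<sigma> = T"
proof -
  have "\<exists>m. m \<in> T \<and> P m \<and> (\<forall>s\<in>T. P s \<longrightarrow> m \<le> s)" if ex: "\<exists>t\<in>T. P t" for P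
  proof -
    obtain t where t: "t \<in> T" "P t" using ex by blast
    let ?F = "{u \<in> T. u \<le> t \<and> P u}"
    have f: "finite ?F" by (rule finite_subset[OF _ fin[OF t(1)]]) auto
    have ne: "?F \<noteq> {}" using t by auto
    have "Min ?F \<in> ?F" using Min_in[OF f ne] .
    moreover have "Min ?F \<le> s" if "s \<in> T" "P s" for s
    proof (cases "s \<le> t")
      case True
      then show ?thesis using that f by (intro Min_le) auto
    next
      case False
      then show ?thesis using Min_le[OF f, of t] t by auto
    qed
    ultimately show ?thesis by blast
  qed
  then obtain mn where mn: "\<And>P. \<exists>t\<in>T. P t \<Longrightarrow> mn P \<in> T \<and> P (mn P) \<and> (\<forall>s\<in>T. P s \<longrightarrow> mn P \<le> s)"
    by metis
  define \<sigma> where "\<sigma> = rec_nat (mn (\<lambda>_. True)) (\<lambda>_ r. mn (\<lambda>t. r < t))"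
  have \<sigma>0: "\<sigma> 0 = mn (\<lambda>_. True)" and \<sigma>S: "\<sigma> (Suc n) = mn (\<lambda>t. \<sigma> n < t)" for n
    by (simp_all add: \<sigma>_def)
  have above: "\<exists>u\<in>T. t < u" if "t \<in> T" for t
  proof (rule ccontr)
    assume "\<not> ?thesis"
    then have "T \<subseteq> {u \<in> T. u \<le> t}" by force
    then show False using inf fin[OF that] finite_subset by blast
  qed
  have T: "\<sigma> n \<in> T" for n
  proof (induction n)
    case 0
    then show ?case using mn[of "\<lambda>_. True"] infinite_imp_nonempty[OF inf] by (auto simp: \<sigma>0)
  next
    case (Suc n)
    then show ?case using mn[of "\<lambda>t. \<sigma> n < t"] above by (auto simp: \<sigma>S)
  qed
  have "\<sigma> n < \<sigma> (Suc n)" for n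
    using mn[of "\<lambda>t. \<sigma> n < t"] above[OF T] by (auto simp: \<sigma>S)
  then have mono: "strict_mono \<sigma>" by (simp add: strict_mono_Suc_iff)
  have "t \<in> range \<sigma>" if t: "t \<in> T" for t
  proof (rule ccontr)
    assume nr: "t \<notin> range \<sigma>"
    have "\<sigma> n < t" for n
    proof (induction n)
      case 0
      have "\<sigma> 0 \<le> t" using mn[of "\<lambda>_. True"] t by (auto simp: \<sigma>0)
      then show ?case using nr by (metis order_le_less rangeI)
    next
      case (Suc n)
      have "\<sigma> (Suc n) \<le> t" using mn[of "\<lambda>t. \<sigma> n < t"] t Suc by (auto simp: \<sigma>S)
      then show ?case using nr by (metis order_le_less rangeI)
    qed
    then have "range \<sigma> \<subseteq> {u \<in> T. u \<le> t}" using T by (auto intro: less_imp_le)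
    then have "finite (range \<sigma>)" using fin[OF t] finite_subset by blast
    then show False using mono strict_mono_imp_inj_on by (metis finite_imageD infinite_UNIV_nat)
  qed
  then have "range \<sigma> = T" using T by auto
  then show ?thesis using that mono by blast
qed

lemma compact_box: "compact {x \<in> pts {..<n}. \<forall>i<n. \<bar>x i\<bar> \<le> r}"
proof -
  define S where "S i = (if i < n then {-r..r} else {0::real})" for i
  have "compact (S i)" for i by (simp add: S_def)
  then have "compactin (product_topology (\<lambda>i. euclidean) UNIV) (Pi\<^sub>E UNIV S)"
    by (simp add: compactin_PiE)
  then have "compact (Pi\<^sub>E UNIV S)" unfolding euclidean_product_topology by simp
  moreover have "Pi\<^sub>E UNIV S = {x \<in> pts {..<n}. \<forall>i<n. \<bar>x i\<bar> \<le> r}"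
  proof -
    have "x \<in> Pi\<^sub>E UNIV S \<longleftrightarrow> (\<forall>i. if i < n then - r \<le> x i \<and> x i \<le> r else x i = 0)" for x
      unfolding PiE_iff S_def by (auto split: if_splits)
    then show ?thesis unfolding set_eq_iff by (auto simp: pts_def abs_le_iff not_less)
  qed
  ultimately show ?thesis by simp
qed

text \<open>An infinite bounded set has a limit point, and two points of \<open>S\<close> within
  \<open>\<epsilon> / 2\<close> of it violate the separation. The second is taken nearer to the
  limit than the first, so that they differ.\<close>

lemma finite_separated_bounded:
  assumes "S \<subseteq> pts {..<n}" "\<epsilon> > 0" "\<And>x y. x \<in> S \<Longrightarrow> y \<in> S \<Longrightarrow> dist1 n x y < \<epsilon> \<Longrightarrow> y = x"
    "\<And>x. x \<in> S \<Longrightarrow> dist1 n x (\<lambda>_. 0) \<le> r"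
  shows "finite S"
proof (rule ccontr)
  assume inf: "infinite S"
  have "\<bar>x i\<bar> \<le> r" if "x \<in> S" "i < n" for x i
    using coord_le_dist1[OF that(2), of x "\<lambda>_. 0"] assms(4)[OF that(1)] by simp
  then have "S \<subseteq> {x \<in> pts {..<n}. \<forall>i<n. \<bar>x i\<bar> \<le> r}"
    using assms(1) by blast
  then obtain x where x: "x \<in> pts {..<n}" "x islimpt S"
    using Heine_Borel_imp_Bolzano_Weierstrass[OF compact_box inf] by blast
  have near: "\<exists>y\<in>S. y \<noteq> x \<and> dist1 n x y < e" if "e > 0" for e
    using islimptE[OF x(2) _ open_dist1_ball, of n x e] that by auto
  obtain y where y: "y \<in> S" "y \<noteq> x" "dist1 n x y < \<epsilon> / 2"
    using near[of "\<epsilon> / 2"] assms(2) by auto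
  have "dist1 n x y > 0"
    using dist1_eq_0D[OF x(1)] y assms(1) by (metis linorder_not_le subsetD)
  then obtain z where z: "z \<in> S" "z \<noteq> x" "dist1 n x z < dist1 n x y"
    using near by blast
  have "dist1 n y z < \<epsilon>" using dist1_triangle[of n y z x] y(3) z(3) dist1_commute[of n x y] by linarith
  then have "z = y" using assms(3) y z by blast
  then show False using z by simp
qed

context ordered_group_structure
begin

definition rdefinable :: "real set \<Rightarrow> bool" where
  "rdefinable T \<longleftrightarrow> dpred M (\<lambda>e. e 0 \<in> T)"

lemma dpred_rdefinable: "rdefinable T \<Longrightarrow> dterm t \<Longrightarrow> dpred M (\<lambda>e. t e \<in> T)"
  unfolding rdefinable_def by (rule dpred_let)

lemma infinite_discrete_imp_omega:
  assumes D: "definable M n D" and inf: "infinite D"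
    and discrete: "\<And>x. x \<in> D \<Longrightarrow> \<exists>\<epsilon>>0. \<forall>y\<in>D. dist1 n x y < \<epsilon> \<longrightarrow> y = x"
  obtains T where "rdefinable T" "infinite T" "\<And>t. t \<in> T \<Longrightarrow> finite {u \<in> T. u \<le> t}"
proof -
  define Sep where "Sep \<epsilon> = {x \<in> D. \<forall>y\<in>D. dist1 n x y < \<epsilon> \<longrightarrow> y = x}" for \<epsilon>
  have D_pts: "D \<subseteq> pts {..<n}" using D by (rule definable_subset)
  show ?thesis
  proof (cases "\<exists>\<epsilon>>0. infinite (Sep \<epsilon>)")
    case True
    then obtain \<epsilon> where e: "\<epsilon> > 0" "infinite (Sep \<epsilon>)" by blast
    \<comment> \<open>A uniformly separated set has finitely many points in each ball. Its set of
      norms therefore has finite initial segments, and is infinite since otherwise the separated set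
      would be bounded.\<close>
    define T where "T = (\<lambda>x. dist1 n x (\<lambda>_. 0)) ` Sep \<epsilon>"
    have fin: "finite {x \<in> Sep \<epsilon>. dist1 n x (\<lambda>_. 0) \<le> r}" for r
      by (rule finite_separated_bounded[of _ n \<epsilon> r]) (use D_pts e in \<open>auto simp: Sep_def\<close>)
    have T_fin: "finite {u \<in> T. u \<le> t}" for t
    proof -
      have "{u \<in> T. u \<le> t} \<subseteq> (\<lambda>x. dist1 n x (\<lambda>_. 0)) ` {x \<in> Sep \<epsilon>. dist1 n x (\<lambda>_. 0) \<le> t}"
        by (auto simp: T_def)
      then show ?thesis using fin finite_surj by blast
    qed
    have "infinite T"
    proof
      assume "finite T"
      then obtain r where "\<forall>t\<in>T. t \<le> r" by (meson bdd_above_def bdd_above.I bdd_above_finite)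
      then have "Sep \<epsilon> \<subseteq> {x \<in> Sep \<epsilon>. dist1 n x (\<lambda>_. 0) \<le> r}" by (auto simp: T_def)
      then show False using e(2) fin finite_subset by blast
    qed
    moreover have "rdefinable T"
    proof -
      have eq: "t \<in> T \<longleftrightarrow> (\<exists>x\<in>D. (\<forall>y\<in>D. dist1 n x y < \<epsilon> \<longrightarrow> y = x) \<and> t = dist1 n x (\<lambda>_. 0))" for t
        by (auto simp: T_def Sep_def)
      show ?thesis
        unfolding rdefinable_def eq
        by (intro dpred_ex_in[OF D] dpred_all_in[OF D] dpred_vec_eq[of _ n] dpred_intros pr_in_pts)
    qed
    ultimately show ?thesis using that T_fin by blast
  next
    case False
    then have fin: "finite (Sep \<epsilon>)" if "\<epsilon> > 0" for \<epsilon> using that by blast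
    \<comment> \<open>Here \<open>- t\<close> is the infimum of the distances from \<open>x\<close>
      to the other points. The finiteness of all \<open>Sep \<epsilon>\<close> lets these distances
      accumulate at 0 only; the sign turns this into an increasing sequence of order type
      \<omega>.\<close>
    define P where "P x t \<longleftrightarrow> (\<forall>y\<in>D. y \<noteq> x \<longrightarrow> - t \<le> dist1 n x y) \<and>
      (\<forall>s. - t < s \<longrightarrow> (\<exists>y\<in>D. y \<noteq> x \<and> dist1 n x y < s))" for x t
    define T where "T = {t. \<exists>x\<in>D. P x t}"
    have ex: "\<exists>t. P x t" if "x \<in> D" for x
    proof -
      let ?A = "dist1 n x ` (D - {x})"
      have "?A \<noteq> {}" using inf by (metis Diff_eq_empty_iff finite.simps finite_subset image_is_empty)
      moreover have bdd: "bdd_below ?A" by (rule bdd_belowI[of _ 0]) auto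
      ultimately have "P x (- Inf ?A)"
        unfolding P_def by (auto simp: cInf_less_iff intro!: cInf_lower)
      then show ?thesis by blast
    qed
    have uniq: "t = u" if "P x t" "P x u" for x t u
    proof -
      have "\<not> - v < - w" if "P x v" "P x w" for v w
        using that unfolding P_def by (meson linorder_not_le)
      from this[OF that] this[OF that(2,1)] show ?thesis by simp
    qed
    have neg: "t < 0" if "x \<in> D" "P x t" for x t
    proof -
      obtain \<epsilon> where "\<epsilon> > 0" "\<forall>y\<in>D. dist1 n x y < \<epsilon> \<longrightarrow> y = x" using discrete[OF \<open>x \<in> D\<close>] by blast
      then have "\<not> - t < \<epsilon>" using that(2) unfolding P_def by blast
      then show ?thesis using \<open>\<epsilon> > 0\<close> by simp
    qed
    have PSep: "x \<in> Sep (- r)" if "x \<in> D" "P x t" "t \<le> r" for x t r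
      using that unfolding Sep_def P_def by force
    have "finite {u \<in> T. u \<le> t}" if "t \<in> T" for t
    proof -
      have "t < 0" using that neg by (auto simp: T_def)
      have "{u \<in> T. u \<le> t} \<subseteq> (\<lambda>x. THE u. P x u) ` Sep (- t)"
      proof
        fix u assume "u \<in> {u \<in> T. u \<le> t}"
        then obtain x where x: "x \<in> D" "P x u" "u \<le> t" by (auto simp: T_def)
        then have "(THE u. P x u) = u" using uniq by (intro the_equality) auto
        then show "u \<in> (\<lambda>x. THE u. P x u) ` Sep (- t)" using PSep[OF x] by force
      qed
      moreover have "finite (Sep (- t))" using fin \<open>t < 0\<close> by simp
      ultimately show ?thesis by (rule finite_surj[rotated])
    qed
    moreover have "infinite T"
    proof
      assume "finite T"
      moreover have "\<And>t. t \<in> T \<Longrightarrow> finite (Sep (- t))" using fin neg by (auto simp: T_def)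
      ultimately have "finite (\<Union>t\<in>T. Sep (- t))" by blast
      moreover have "D \<subseteq> (\<Union>t\<in>T. Sep (- t))" using ex PSep by (fastforce simp: T_def)
      ultimately show False using inf finite_subset by blast
    qed
    moreover have "rdefinable T"
      unfolding rdefinable_def T_def mem_Collect_eq P_def
      by (intro dpred_ex_in[OF D] dpred_all_in[OF D] dpred_vec_eq[of _ n] dpred_intros pr_in_pts)
    ultimately show ?thesis using that by blast
  qed
qed

lemma omega_imp_divisibility:
  fixes \<sigma> :: "nat \<Rightarrow> real"
  assumes closed_comp: "PCC M \<or> CC M \<or> QCC M"
    and mono: "strict_mono \<sigma>" and T: "rdefinable (range \<sigma>)"
  shows "definable M 2 {point_of [\<sigma> m, \<sigma> n] | m n. m dvd n}"
proof -
  define v where "v a b c = (\<lambda>i::nat. if i = 0 then a else if i = 1 then b else if i = 2 then c else 0::real)"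
    for a b c
  define w where "w m n c = v (\<sigma> m) (\<sigma> n) (\<sigma> c)" for m n c
  define D where "D = {x \<in> pts {..<3}. x 0 \<in> range \<sigma> \<and> x 1 \<in> range \<sigma> \<and> x 2 \<in> range \<sigma>}"
  define S where "S a b \<longleftrightarrow> a \<in> range \<sigma> \<and> b \<in> range \<sigma> \<and> a < b \<and>
    (\<forall>c. c \<in> range \<sigma> \<longrightarrow> \<not> (a < c \<and> c < b))" for a b
  text \<open>The triple of indices \<open>(m, n, c)\<close> counts up \<open>n\<close> while \<open>c\<close> runs through the residues modulo \<open>m\<close>.\<close>
  define G where "G x y \<longleftrightarrow>
    y 0 = x 0 \<and> S (x 1) (y 1) \<and> S (x 2) (y 2) \<and> y 2 < x 0 \<or>
    y 0 = x 0 \<and> S (x 1) (y 1) \<and> S (x 2) (x 0) \<and> y 2 = \<sigma> 0 \<or>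
    S (x 0) (y 0) \<and> x 1 = \<sigma> 0 \<and> y 1 = \<sigma> 0 \<and> x 2 = \<sigma> 0 \<and> y 2 = \<sigma> 0" for x y :: point
  \<comment> \<open>For \<open>m = 0\<close> neither counting edge exists, because no
    \<open>c'\<close> is below 0 and 0 is no successor. The slice is thus a single vertex, in
    accordance with 0 dividing only 0.\<close>
  define R where "R m n c \<longleftrightarrow> (if m = 0 then n = 0 \<and> c = 0 else c = n mod m)" for m n c :: nat
  \<comment> \<open>The third kind of edge joins the starting vertices \<open>(m, 0, 0)\<close> of
    all counters, so that \<open>K\<close> is a single component for all \<open>m\<close>
    together.\<close>
  define K where "K = {w m n c | m n c. R m n c}"
  have less_iff: "\<sigma> i < \<sigma> j \<longleftrightarrow> i < j" and eq_iff: "\<sigma> i = \<sigma> j \<longleftrightarrow> i = j" for i j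
    using mono by (simp_all add: strict_mono_less strict_mono_eq)
  have S_iff: "S (\<sigma> i) (\<sigma> j) \<longleftrightarrow> j = Suc i" for i j
  proof
    assume "S (\<sigma> i) (\<sigma> j)"
    then have "\<sigma> i < \<sigma> j" "\<not> (\<sigma> i < \<sigma> (Suc i) \<and> \<sigma> (Suc i) < \<sigma> j)" unfolding S_def by blast+
    then show "j = Suc i" by (simp add: less_iff)
  next
    assume "j = Suc i"
    then show "S (\<sigma> i) (\<sigma> j)" by (auto simp: S_def less_iff)
  qed
  have v_pts: "v a b c \<in> pts {..<3}" for a b c by (auto simp: v_def pts_def)
  have v_simps: "v a b c 0 = a" "v a b c 1 = b" "v a b c 2 = c" "v a b c (Suc 0) = b" for a b c
    by (simp_all add: v_def)
  have v_eta: "v (x 0) (x 1) (x 2) = x" if "x \<in> pts {..<3}" for x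
  proof
    fix i :: nat
    consider "i = 0" | "i = 1" | "i = 2" | "i \<ge> 3" by linarith
    then show "v (x 0) (x 1) (x 2) i = x i" using that by cases (auto simp: v_def pts_def)
  qed
  have w_D: "w m n c \<in> D" for m n c by (simp add: D_def w_def v_pts v_simps)
  have D_w: "\<exists>m n c. x = w m n c" if "x \<in> D" for x
    using that v_eta unfolding D_def w_def by fastforce
  have w_inj: "w m n c = w m' n' c' \<longleftrightarrow> m = m' \<and> n = n' \<and> c = c'" for m n c m' n' c'
    unfolding w_def by (metis v_simps eq_iff)
  have K_iff: "w m n c \<in> K \<longleftrightarrow> R m n c" for m n c by (auto simp: K_def w_inj)
  have G_iff: "G (w m n c) (w m' n' c') \<longleftrightarrow>
    m' = m \<and> n' = Suc n \<and> c' = Suc c \<and> c' < m \<or> m' = m \<and> n' = Suc n \<and> m = Suc c \<and> c' = 0 \<or>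
    m' = Suc m \<and> n = 0 \<and> n' = 0 \<and> c = 0 \<and> c' = 0" for m n c m' n' c'
    unfolding G_def w_def v_simps S_iff less_iff eq_iff by auto
  have gap: "\<exists>\<epsilon>>0. \<forall>u\<in>range \<sigma>. \<bar>\<sigma> i - u\<bar> < \<epsilon> \<longrightarrow> u = \<sigma> i" for i
  proof -
    define \<epsilon> where "\<epsilon> = min (\<sigma> (Suc i) - \<sigma> i) (if i = 0 then 1 else \<sigma> i - \<sigma> (i - 1))"
    have "\<epsilon> > 0" by (auto simp: \<epsilon>_def less_iff)
    moreover have "\<sigma> j = \<sigma> i" if "\<bar>\<sigma> i - \<sigma> j\<bar> < \<epsilon>" for j
    proof (rule ccontr)
      assume "\<sigma> j \<noteq> \<sigma> i"
      then consider "j < i" | "i < j" using less_iff eq_iff by (metis nat_neq_iff)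
      then show False
      proof cases
        case 1
        then have "\<sigma> j \<le> \<sigma> (i - 1)" using mono by (simp add: strict_mono_less_eq)
        then show ?thesis using that 1 by (auto simp: \<epsilon>_def)
      next
        case 2
        then have "\<sigma> (Suc i) \<le> \<sigma> j" using mono by (simp add: strict_mono_less_eq)
        then show ?thesis using that by (auto simp: \<epsilon>_def)
      qed
    qed
    ultimately show ?thesis by blast
  qed
  have D: "definable M 3 D"
    unfolding D_def by (intro definable_dpred dpred_conj dpred_rdefinable[OF T] dterm_var)
  have "definable M 3 K"
  proof (rule definable_graph_component[OF closed_comp D, where G = G and ?x0.0 = "w 0 0 0"])
    show "\<exists>\<epsilon>>0. \<forall>y\<in>D. dist1 3 x y < \<epsilon> \<longrightarrow> y = x" if "x \<in> D" for x
    proof -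
      obtain m n c where x: "x = w m n c" using D_w[OF \<open>x \<in> D\<close>] by blast
      obtain e1 e2 e3 where e: "e1 > 0" "\<forall>u\<in>range \<sigma>. \<bar>\<sigma> m - u\<bar> < e1 \<longrightarrow> u = \<sigma> m"
        "e2 > 0" "\<forall>u\<in>range \<sigma>. \<bar>\<sigma> n - u\<bar> < e2 \<longrightarrow> u = \<sigma> n"
        "e3 > 0" "\<forall>u\<in>range \<sigma>. \<bar>\<sigma> c - u\<bar> < e3 \<longrightarrow> u = \<sigma> c"
        using gap by metis
      have "y = x" if y: "y \<in> D" "dist1 3 x y < min e1 (min e2 e3)" for y
      proof -
        obtain m' n' c' where y': "y = w m' n' c'" using D_w y by blast
        have "\<bar>x 0 - y 0\<bar> < e1" "\<bar>x 1 - y 1\<bar> < e2" "\<bar>x 2 - y 2\<bar> < e3"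
          using coord_le_dist1[of 0 3 x y] coord_le_dist1[of 1 3 x y] coord_le_dist1[of 2 3 x y] y(2) by auto
        then have "\<sigma> m' = \<sigma> m" "\<sigma> n' = \<sigma> n" "\<sigma> c' = \<sigma> c"
          using e unfolding x y' w_def v_simps by blast+
        then show ?thesis by (simp add: x y' w_def)
      qed
      then show ?thesis using e by (intro exI[of _ "min e1 (min e2 e3)"]) auto
    qed
    show "dpred M (\<lambda>e. G (pr {..<3} e) (pr {..<3} (\<lambda>i. e (i + 3))))"
      unfolding G_def S_def
      by (intro dpred_conj dpred_disj dpred_all dpred_imp dpred_not dpred_less dpred_eq dterm_pr dterm_var
          dterm_const dpred_rdefinable[OF T])
    show "K \<subseteq> D" "w 0 0 0 \<in> K" by (auto simp: K_def w_D) (auto simp: R_def)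
    show "x \<in> K \<longleftrightarrow> y \<in> K" if "x \<in> D" "y \<in> D" "G x y" for x y
    proof -
      obtain m n c m' n' c' where xy: "x = w m n c" "y = w m' n' c'"
        using D_w[OF \<open>x \<in> D\<close>] D_w[OF \<open>y \<in> D\<close>] by blast
      have RS: "R m (Suc n) d \<longleftrightarrow> m \<noteq> 0 \<and> d = (if Suc (n mod m) = m then 0 else Suc (n mod m))" for m n d
        unfolding R_def mod_Suc by simp
      have RD: "R m n c \<longleftrightarrow> c = n mod m" if "m \<noteq> 0" for m n c
        using that by (simp add: R_def)
      consider "m' = m" "n' = Suc n" "c' = Suc c" "c' < m" | "m' = m" "n' = Suc n" "m = Suc c" "c' = 0"
        | "m' = Suc m" "n = 0" "n' = 0" "c = 0" "c' = 0"
        using \<open>G x y\<close> unfolding xy G_iff by blast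
      then show ?thesis
      proof cases
        case 1
        then have "m \<noteq> 0" by simp
        show ?thesis
          unfolding xy K_iff 1(1,2) RS RD[OF \<open>m \<noteq> 0\<close>] using 1(3,4) by auto
      next
        case 2
        then have "m \<noteq> 0" by simp
        show ?thesis
          unfolding xy K_iff 2(1,2) RS RD[OF \<open>m \<noteq> 0\<close>] using 2(3,4) by auto
      next
        case 3
        show ?thesis unfolding xy K_iff 3 by (simp add: R_def)
      qed
    qed
    let ?r = "{(x, y). x \<in> K \<and> y \<in> K \<and> (G x y \<or> G y x)}\<^sup>*"
    have hub: "(w 0 0 0, w m 0 0) \<in> ?r" for m
    proof (induction m)
      case (Suc m)
      have "(w m 0 0, w (Suc m) 0 0) \<in> {(x, y). x \<in> K \<and> y \<in> K \<and> (G x y \<or> G y x)}"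
        by (simp add: K_iff R_def G_iff)
      with Suc show ?case by (rule rtrancl_into_rtrancl)
    qed simp
    have walk: "(w 0 0 0, w m n (n mod m)) \<in> ?r" if "m > 0" for m n
    proof (induction n)
      case 0
      then show ?case using hub by simp
    next
      case (Suc n)
      have "n mod m < m" using that by simp
      then have "Suc (n mod m) \<le> m" by (rule Suc_leI)
      then have "(w m n (n mod m), w m (Suc n) (Suc n mod m)) \<in> {(x, y). x \<in> K \<and> y \<in> K \<and> (G x y \<or> G y x)}"
        using that by (auto simp: K_iff R_def G_iff mod_Suc)
      with Suc show ?case by (rule rtrancl_into_rtrancl)
    qed
    show "(w 0 0 0, x) \<in> ?r" if "x \<in> K" for x
    proof -
      obtain m n c where x: "x = w m n c" "R m n c" using \<open>x \<in> K\<close> by (auto simp: K_def)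
      then show ?thesis using hub[of 0] walk[of m n] by (auto simp: R_def split: if_splits)
    qed
  qed
  show ?thesis
  proof (rule definableI)
    show "{point_of [\<sigma> m, \<sigma> n] |m n. m dvd n} \<subseteq> pts {..<2}"
      by (auto simp: point_of_def pts_def)
    \<comment> \<open>Divisibility means residue 0, and the residue 0 is coded by
      \<open>\<sigma> 0\<close>.\<close>
    show "dpred M (\<lambda>x. v (x 0) (x 1) (\<sigma> 0) \<in> K)"
      by (rule dpred_in[OF \<open>definable M 3 K\<close> v_pts]) (unfold v_def, intro dterm_if dterm_var dterm_const)
    show "x \<in> {point_of [\<sigma> m, \<sigma> n] |m n. m dvd n} \<longleftrightarrow> v (x 0) (x 1) (\<sigma> 0) \<in> K" if "x \<in> pts {..<2}" for x
    proof -
      have dvd: "R m n 0 \<longleftrightarrow> m dvd n" for m n by (auto simp: R_def dvd_eq_mod_eq_0)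
      have "x = point_of [a, b] \<longleftrightarrow> x 0 = a \<and> x 1 = b" for a b
      proof
        assume *: "x 0 = a \<and> x 1 = b"
        show "x = point_of [a, b]"
        proof
          fix i :: nat
          consider "i = 0" | "i = 1" | "i \<ge> 2" by linarith
          then show "x i = point_of [a, b] i" using that * by cases (auto simp: pts_def point_of_def)
        qed
      qed (simp add: point_of_def)
      then have "x \<in> {point_of [\<sigma> m, \<sigma> n] |m n. m dvd n} \<longleftrightarrow> (\<exists>m n. x 0 = \<sigma> m \<and> x 1 = \<sigma> n \<and> R m n 0)"
        by (auto simp: dvd)
      also have "\<dots> \<longleftrightarrow> v (x 0) (x 1) (\<sigma> 0) \<in> K"
      proof
        assume "v (x 0) (x 1) (\<sigma> 0) \<in> K"
        then obtain m n c where *: "v (x 0) (x 1) (\<sigma> 0) = w m n c" "R m n c" by (auto simp: K_def)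
        have "x 0 = \<sigma> m" "x 1 = \<sigma> n" "\<sigma> 0 = \<sigma> c"
          using fun_cong[OF *(1), of 0] fun_cong[OF *(1), of 1] fun_cong[OF *(1), of 2]
          by (simp_all add: w_def v_simps)
        then show "\<exists>m n. x 0 = \<sigma> m \<and> x 1 = \<sigma> n \<and> R m n 0" using *(2) eq_iff by metis
      next
        assume "\<exists>m n. x 0 = \<sigma> m \<and> x 1 = \<sigma> n \<and> R m n 0"
        then obtain m n where *: "x 0 = \<sigma> m" "x 1 = \<sigma> n" "R m n 0" by blast
        then have "v (x 0) (x 1) (\<sigma> 0) = w m n 0" unfolding w_def by simp
        then show "v (x 0) (x 1) (\<sigma> 0) \<in> K" using *(3) by (simp add: K_iff)
      qed
      finally show ?thesis .
    qed
  qed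
qed

end

section \<open>Definable locally closed sets\<close>

definition lc :: "point set \<Rightarrow> bool" where
  "lc L \<longleftrightarrow> (\<exists>C U. closed C \<and> open U \<and> L = C \<inter> U)"

lemma lc_Int: "lc L \<Longrightarrow> lc L' \<Longrightarrow> lc (L \<inter> L')"
proof -
  assume "lc L" "lc L'"
  then obtain C U C' U' where "closed C" "open U" "L = C \<inter> U" "closed C'" "open U'" "L' = C' \<inter> U'"
    unfolding lc_def by metis
  then show "lc (L \<inter> L')"
    unfolding lc_def by (intro exI[of _ "C \<inter> C'"] exI[of _ "U \<inter> U'"]) auto
qed

lemma lc_closed: "closed C \<Longrightarrow> lc C"
  unfolding lc_def by (intro exI[of _ C] exI[of _ UNIV]) simp

lemma lc_open: "open U \<Longrightarrow> lc U"
  unfolding lc_def by (intro exI[of _ UNIV] exI[of _ U]) simp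

lemma closed_closure_diff_lc: "lc L \<Longrightarrow> closed (closure L - L)"
proof -
  assume "lc L"
  then obtain C U where *: "closed C" "open U" "L = C \<inter> U" by (auto simp: lc_def)
  then have "closure L \<subseteq> C" by (simp add: closure_minimal)
  then have "closure L - L = closure L - U" using * by blast
  then show ?thesis using * by (simp add: closed_Diff)
qed

section \<open>Closures and exhaustions by compact sets\<close>

lemma closure_iff_dist1:
  assumes "A \<subseteq> pts {..<n}"
  shows "x \<in> closure A \<longleftrightarrow> x \<in> pts {..<n} \<and> (\<forall>\<epsilon>>0. \<exists>y\<in>A. dist1 n x y < \<epsilon>)"
proof (intro iffI conjI allI impI)
  assume x: "x \<in> closure A"
  then show "x \<in> pts {..<n}" using closure_minimal[OF assms closed_pts] by blast
  fix \<epsilon> :: real assume "\<epsilon> > 0"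
  then have "x \<in> {y. dist1 n x y < \<epsilon>} \<inter> closure A" using x by simp
  then have "{y. dist1 n x y < \<epsilon>} \<inter> A \<noteq> {}"
    using open_Int_closure_eq_empty[OF open_dist1_ball, of n x \<epsilon> A] by blast
  then show "\<exists>y\<in>A. dist1 n x y < \<epsilon>" by blast
next
  assume x: "x \<in> pts {..<n} \<and> (\<forall>\<epsilon>>0. \<exists>y\<in>A. dist1 n x y < \<epsilon>)"
  have "U \<inter> A \<noteq> {}" if U: "open U" "x \<in> U" for U
  proof -
    obtain \<epsilon> where "\<epsilon> > 0" "\<And>y. y \<in> pts {..<n} \<Longrightarrow> dist1 n x y < \<epsilon> \<Longrightarrow> y \<in> U"
      by (rule open_contains_dist1_ball[OF U, of n]) (use x in auto)
    then show ?thesis using x assms by blast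
  qed
  then show "x \<in> closure A" unfolding closure_iff_nhds_not_empty by blast
qed

text \<open>Points of norm at most \<open>r\<close> that keep distance \<open>s\<close> from the
  frontier. For locally closed \<open>L\<close> the frontier is closed, so these sets exhaust
  \<open>L\<close> as \<open>r\<close> grows and \<open>s\<close> shrinks; for definable
  \<open>L\<close> they vary definably with both.\<close>

definition exhaust :: "nat \<Rightarrow> point set \<Rightarrow> real \<Rightarrow> real \<Rightarrow> point set" where
  "exhaust n L r s = {x \<in> L. dist1 n x (\<lambda>_. 0) \<le> r \<and> (\<forall>y \<in> closure L - L. s \<le> dist1 n x y)}"

lemma exhaust_mono: "r \<le> r' \<Longrightarrow> s' \<le> s \<Longrightarrow> exhaust n L r s \<subseteq> exhaust n L r' s'"
  by (force simp: exhaust_def)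

lemma compact_exhaust:
  assumes "L \<subseteq> pts {..<n}" "lc L" "s > 0"
  shows "compact (exhaust n L r s)"
proof -
  \<comment> \<open>\<open>L\<close> may be replaced by its closure, because a frontier point has
    distance 0 from itself and \<open>s > 0\<close> excludes it.\<close>
  have eq: "exhaust n L r s = closure L \<inter> {x. dist1 n x (\<lambda>_. 0) \<le> r} \<inter> (\<Inter>y \<in> closure L - L. {x. s \<le> dist1 n x y})"
    using closure_subset[of L] assms(3) by (force simp: exhaust_def)
  have "closed (exhaust n L r s)"
    unfolding eq by (intro closed_Int closed_INT ballI closed_closure closed_Collect_le continuous_on_dist1
        continuous_on_const continuous_on_id)
  moreover have "exhaust n L r s \<subseteq> {x \<in> pts {..<n}. \<forall>i<n. \<bar>x i\<bar> \<le> r}"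
  proof
    fix x assume x: "x \<in> exhaust n L r s"
    have "\<bar>x i\<bar> \<le> r" if "i < n" for i
      using coord_le_dist1[OF that, of x "\<lambda>_. 0"] x by (simp add: exhaust_def)
    then show "x \<in> {x \<in> pts {..<n}. \<forall>i<n. \<bar>x i\<bar> \<le> r}" using x assms(1) by (auto simp: exhaust_def)
  qed
  then have "{x \<in> pts {..<n}. \<forall>i<n. \<bar>x i\<bar> \<le> r} \<inter> exhaust n L r s = exhaust n L r s" by blast
  ultimately show ?thesis
    using compact_Int_closed[OF compact_box[of n r], of "exhaust n L r s"] by simp
qed

lemma exhaust_exhausts:
  assumes "L \<subseteq> pts {..<n}" "lc L" "x \<in> L"
  obtains s where "s > 0" "x \<in> exhaust n L (dist1 n x (\<lambda>_. 0)) s"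
proof -
  have "open (- (closure L - L))" using closed_closure_diff_lc[OF assms(2)] by (rule open_Compl)
  then obtain s where s: "s > 0" "\<And>y. y \<in> pts {..<n} \<Longrightarrow> dist1 n x y < s \<Longrightarrow> y \<in> - (closure L - L)"
    by (rule open_contains_dist1_ball[of _ x n]) (use assms in auto)
  have "closure L \<subseteq> pts {..<n}" by (rule closure_minimal[OF assms(1) closed_pts])
  then have "s \<le> dist1 n x y" if "y \<in> closure L - L" for y
    using s(2)[of y] that by force
  then show ?thesis using that[of s] s(1) assms(3) by (simp add: exhaust_def)
qed

lemma exhaust_UN_nat:
  assumes "L \<subseteq> pts {..<n}" "lc L"
  shows "L = (\<Union>k::nat. exhaust n L (real k) (1 / real (Suc k)))"
proof
  show "L \<subseteq> (\<Union>k::nat. exhaust n L (real k) (1 / real (Suc k)))"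
  proof
    fix x assume "x \<in> L"
    then obtain s where s: "s > 0" "x \<in> exhaust n L (dist1 n x (\<lambda>_. 0)) s"
      using exhaust_exhausts[OF assms] by blast
    obtain k1 where k1: "inverse (real (Suc k1)) < s" using reals_Archimedean s(1) by blast
    obtain k2 :: nat where k2: "dist1 n x (\<lambda>_. 0) \<le> real k2" using real_arch_simple by blast
    define k where "k = max k1 k2"
    have "1 / real (Suc k) \<le> 1 / real (Suc k1)" by (rule divide_left_mono) (auto simp: k_def)
    also have "\<dots> \<le> s" using k1 by (simp add: inverse_eq_divide)
    finally have "1 / real (Suc k) \<le> s" .
    moreover have "dist1 n x (\<lambda>_. 0) \<le> real k" using k2 by (simp add: k_def)
    ultimately show "x \<in> (\<Union>k::nat. exhaust n L (real k) (1 / real (Suc k)))"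
      using exhaust_mono[of "dist1 n x (\<lambda>_. 0)" "real k" "1 / real (Suc k)" s n L] s(2) by blast
  qed
qed (auto simp: exhaust_def)

context ordered_group_structure
begin

lemma definable_closure:
  assumes A: "definable M n A"
  shows "definable M n (closure A)"
proof (rule definableI)
  show "closure A \<subseteq> pts {..<n}"
    by (rule closure_minimal[OF definable_subset[OF A] closed_pts])
  show "dpred M (\<lambda>x. \<forall>\<epsilon>>0. \<exists>y\<in>A. dist1 n (pr {..<n} x) y < \<epsilon>)"
    by (intro dpred_ex_in[OF A] dpred_intros)
  show "x \<in> closure A \<longleftrightarrow> (\<forall>\<epsilon>>0. \<exists>y\<in>A. dist1 n (pr {..<n} x) y < \<epsilon>)" if "x \<in> pts {..<n}" for x
    using closure_iff_dist1[OF definable_subset[OF A]] that by (simp add: pr_id)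
qed

lemma definable_Int: "definable M n A \<Longrightarrow> definable M n B \<Longrightarrow> definable M n (A \<inter> B)"
proof -
  assume A: "definable M n A" and B: "definable M n B"
  show "definable M n (A \<inter> B)"
    by (rule definableI[OF _ dpred_conj[OF dpred_definable[OF A] dpred_definable[OF B]]])
      (use definable_subset[OF A] in \<open>auto simp: pr_id\<close>)
qed

lemma definable_Diff: "definable M n A \<Longrightarrow> definable M n B \<Longrightarrow> definable M n (A - B)"
proof -
  assume A: "definable M n A" and B: "definable M n B"
  show "definable M n (A - B)"
    by (rule definableI[OF _ dpred_conj[OF dpred_definable[OF A] dpred_not[OF dpred_definable[OF B]]]])
      (use definable_subset[OF A] in \<open>auto simp: pr_id\<close>)
qed

end

section \<open>Finiteness and intervals in one coordinate\<close>

locale no_infinite_discrete = ordered_group_structure +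
  assumes finite_discrete: "definable M n D \<Longrightarrow>
    (\<And>x. x \<in> D \<Longrightarrow> \<exists>\<epsilon>>0. \<forall>y\<in>D. dist1 n x y < \<epsilon> \<longrightarrow> y = x) \<Longrightarrow> finite D"
begin

lemma finite_locally_finite:
  assumes "definable M n D" "\<And>x. x \<in> D \<Longrightarrow> \<exists>\<delta>>0. finite {y \<in> D. dist1 n x y < \<delta>}"
  shows "finite D"
proof (rule finite_discrete[OF assms(1)])
  fix x assume x: "x \<in> D"
  then obtain \<delta> where d: "\<delta> > 0" "finite {y \<in> D. dist1 n x y < \<delta>}" using assms(2) by blast
  define \<epsilon> where "\<epsilon> = Min (insert \<delta> (dist1 n x ` ({y \<in> D. dist1 n x y < \<delta>} - {x})))"
  have fin: "finite (insert \<delta> (dist1 n x ` ({y \<in> D. dist1 n x y < \<delta>} - {x})))" using d by simp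
  have pos: "0 < dist1 n x y" if "y \<in> D" "y \<noteq> x" for y
    using dist1_eq_0D[of x n y] x that definable_subset[OF assms(1)] by (metis linorder_not_le subsetD)
  have "\<epsilon> > 0"
    unfolding \<epsilon>_def using fin d pos by (subst Min_gr_iff) auto
  moreover have "y = x" if "y \<in> D" "dist1 n x y < \<epsilon>" for y
  proof (rule ccontr)
    assume "y \<noteq> x"
    have "\<epsilon> \<le> \<delta>" unfolding \<epsilon>_def using fin by (intro Min_le) auto
    then have "dist1 n x y \<in> insert \<delta> (dist1 n x ` ({y \<in> D. dist1 n x y < \<delta>} - {x}))"
      using that \<open>y \<noteq> x\<close> by auto
    then have "\<epsilon> \<le> dist1 n x y" unfolding \<epsilon>_def using fin by (intro Min_le) auto
    then show False using that by simp
  qed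
  ultimately show "\<exists>\<epsilon>>0. \<forall>y\<in>D. dist1 n x y < \<epsilon> \<longrightarrow> y = x" by blast
qed

lemma rdefinable_finite_discrete:
  assumes "rdefinable G" "\<And>t. t \<in> G \<Longrightarrow> \<exists>\<epsilon>>0. \<forall>u\<in>G. \<bar>t - u\<bar> < \<epsilon> \<longrightarrow> u = t"
  shows "finite G"
proof -
  define D where "D = {x \<in> pts {..<1}. x 0 \<in> G}"
  have "finite D"
  proof (rule finite_discrete)
    show "definable M 1 D" unfolding D_def by (rule definable_dpred) (use assms(1) in \<open>simp add: rdefinable_def\<close>)
    fix x assume x: "x \<in> D"
    then obtain \<epsilon> where e: "\<epsilon> > 0" "\<forall>u\<in>G. \<bar>x 0 - u\<bar> < \<epsilon> \<longrightarrow> u = x 0"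
      using assms(2)[of "x 0"] by (auto simp: D_def)
    have "y = x" if "y \<in> D" "dist1 1 x y < \<epsilon>" for y
    proof
      fix i
      have "y 0 = x 0" using that e by (auto simp: D_def dist1_def)
      then show "y i = x i" using x that(1) by (cases "i = 0") (auto simp: D_def pts_def)
    qed
    then show "\<exists>\<epsilon>>0. \<forall>y\<in>D. dist1 1 x y < \<epsilon> \<longrightarrow> y = x" using e(1) by blast
  qed
  moreover have "G \<subseteq> (\<lambda>x. x 0) ` D"
  proof
    fix t assume "t \<in> G"
    then have "(\<lambda>i::nat. if i = 0 then t else 0) \<in> D" by (auto simp: D_def pts_def)
    then show "t \<in> (\<lambda>x. x 0) ` D" by (rule image_eqI[rotated]) simp
  qed
  ultimately show ?thesis by (rule finite_surj)
qed

text \<open>The midpoints of the bounded gaps of \<open>C\<close> form a definable discrete set,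
  which is finite. Since \<open>C\<close> contains no interval, any two of its points have a gap
  between them, so a point of \<open>C\<close> is determined by the finite set of midpoints below
  it.\<close>

lemma rdefinable_closed_finite:
  assumes C: "rdefinable C" "closed C" and no_int: "\<And>a b. a < b \<Longrightarrow> \<not> {a<..<b} \<subseteq> C"
  shows "finite C"
proof -
  define gap where "gap a b \<longleftrightarrow> a \<in> C \<and> b \<in> C \<and> a < b \<and> (\<forall>c. a < c \<and> c < b \<longrightarrow> c \<notin> C)" for a b
  define G where "G = {m. \<exists>a b. gap a b \<and> m + m = a + b}"
  note C' = dpred_rdefinable[OF C(1) dterm_var]
  have "finite G"
  proof (rule rdefinable_finite_discrete)
    show "rdefinable G"
      unfolding rdefinable_def G_def gap_def mem_Collect_eq
      by (intro dpred_ex dpred_all dpred_conj dpred_imp dpred_not dpred_eq dpred_less dterm_plus dterm_var C')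
    fix t assume "t \<in> G"
    then obtain a b where ab: "gap a b" "t + t = a + b" by (auto simp: G_def)
    \<comment> \<open>The radius is half the length of the gap, so \<open>u\<close> lies in the gap
      of \<open>t\<close>; and two gaps that overlap coincide.\<close>
    have "u = t" if "u \<in> G" "\<bar>t - u\<bar> < b - t" for u
    proof -
      obtain a' b' where ab': "gap a' b'" "u + u = a' + b'" using \<open>u \<in> G\<close> by (auto simp: G_def)
      have u: "a < u" "u < b" "a' < u" "u < b'" using that ab ab' by (auto simp: gap_def)
      have "a' \<le> a" "b \<le> b'" using u ab(1) ab'(1) unfolding gap_def by (meson less_trans not_le)+
      moreover have "a \<le> a'" "b' \<le> b" using u ab(1) ab'(1) unfolding gap_def by (meson less_trans not_le)+
      ultimately have "a' = a" "b' = b" by simp_all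
      then show ?thesis using ab ab' by simp
    qed
    moreover have "b - t > 0" using ab by (auto simp: gap_def)
    ultimately show "\<exists>\<epsilon>>0. \<forall>u\<in>G. \<bar>t - u\<bar> < \<epsilon> \<longrightarrow> u = t" by blast
  qed
  have between: "\<exists>g\<in>G. c < g \<and> g < d" if cd: "c \<in> C" "d \<in> C" "c < d" for c d
  proof -
    obtain x where x: "c < x" "x < d" "x \<notin> C" using no_int[OF cd(3)] unfolding subset_iff greaterThanLessThan_iff by blast
    define a where "a = Sup (C \<inter> {..x})"
    define b where "b = Inf (C \<inter> {x..})"
    have a: "a \<in> C \<inter> {..x}"
      unfolding a_def using x cd C by (intro closed_contains_Sup) (auto intro: closed_Int)
    have b: "b \<in> C \<inter> {x..}"
      unfolding b_def using x cd C by (intro closed_contains_Inf) (auto intro: closed_Int)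
    have le_a: "y \<le> a" if "y \<in> C" "y \<le> x" for y
      unfolding a_def using that by (intro cSup_upper) auto
    have b_le: "b \<le> y" if "y \<in> C" "x \<le> y" for y
      unfolding b_def using that by (intro cInf_lower) auto
    have "a < x" "x < b" using a b x(3) by (auto simp: order.order_iff_strict)
    then have "a < b" by simp
    have "y \<notin> C" if "a < y" "y < b" for y
      using le_a[of y] b_le[of y] that by (cases "y \<le> x") auto
    then have ab: "gap a b" "c \<le> a" "b \<le> d"
      unfolding gap_def using a b \<open>a < b\<close> le_a[OF cd(1)] b_le[OF cd(2)] x by auto
    have "(a + b) / 2 + (a + b) / 2 = a + b" by simp
    then have "(a + b) / 2 \<in> G" using ab(1) unfolding G_def by blast
    moreover have "c < (a + b) / 2" "(a + b) / 2 < d" using ab \<open>a < b\<close> by auto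
    ultimately show ?thesis by blast
  qed
  have "inj_on (\<lambda>x. {g \<in> G. g < x}) C"
  proof (rule linorder_inj_onI')
    fix x y assume "x \<in> C" "y \<in> C" "x < y"
    then obtain g where "g \<in> G" "x < g" "g < y" using between by blast
    then have "g \<notin> {g \<in> G. g < x}" "g \<in> {g \<in> G. g < y}" by auto
    then show "{g \<in> G. g < x} \<noteq> {g \<in> G. g < y}" by blast
  qed
  moreover have "finite ((\<lambda>x. {g \<in> G. g < x}) ` C)"
    by (rule finite_subset[of _ "Pow G"]) (use \<open>finite G\<close> in auto)
  ultimately show ?thesis by (rule finite_imageD[rotated])
qed

lemma inj_on_graph:
  assumes "\<And>a t u. Q a t \<Longrightarrow> Q a u \<Longrightarrow> t = u"
  shows "inj_on (\<lambda>x. x 0) {x \<in> pts {..<2}. Q (x 0) (x 1)}"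
proof (rule inj_onI)
  fix y z :: point
  assume yz: "y \<in> {x \<in> pts {..<2}. Q (x 0) (x 1)}" "z \<in> {x \<in> pts {..<2}. Q (x 0) (x 1)}" "y 0 = z 0"
  then have "y 1 = z 1" using assms[of "y 0" "y 1" "z 1"] by simp
  show "y = z"
  proof
    fix i :: nat
    consider "i = 0" | "i = 1" | "i \<ge> 2" by linarith
    then show "y i = z i" using yz \<open>y 1 = z 1\<close> by cases (auto simp: pts_def)
  qed
qed

text \<open>The two indices may coincide, so they are copied by quantifiers; an injective renaming
  could not identify them.\<close>

lemma dpred_family:
  assumes "dpred M (\<lambda>e. e 0 \<in> A (e 1))"
  shows "dpred M (\<lambda>e. e i \<in> A (e j))"
proof -
  have "dpred M (\<lambda>e. \<exists>r s. r = e j \<and> s = e i \<and> s \<in> A r)"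
    by (intro dpred_ex dpred_conj dpred_eq dterm_var) (use assms in simp)
  then show ?thesis by simp
qed

text \<open>Each point \<open>a\<close> is paired with the infimum \<open>t\<close> of the
  parameters at which it is present. Pairs with second coordinate near \<open>t\<close> have their
  first coordinate in the finite set \<open>A (t + 1)\<close>, so the graph is locally finite, hence
  finite. \<open>Q\<close> leaves open whether \<open>a\<close> belongs to
  \<open>A t\<close>.\<close>

lemma finite_increasing_union:
  assumes A: "dpred M (\<lambda>e. e 0 \<in> A (e 1))" and mono: "\<And>r s. 0 < r \<Longrightarrow> r \<le> s \<Longrightarrow> A r \<subseteq> A s"
    and fin: "\<And>r. 0 < r \<Longrightarrow> finite (A r)"
  shows "finite (\<Union>r\<in>{0<..}. A r)"
proof -
  define Q where "Q a t \<longleftrightarrow> 0 \<le> t \<and> (\<forall>r. t < r \<longrightarrow> a \<in> A r) \<and> (\<forall>r. 0 < r \<and> r < t \<longrightarrow> a \<notin> A r)" for a t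
  define D where "D = {x \<in> pts {..<2}. Q (x 0) (x 1)}"
  note A' = dpred_family[of A, OF A]
  have uniq: "t = u" if "Q a t" "Q a u" for a t u
  proof -
    have "\<not> v < w" if "Q a v" "Q a w" for v w
    proof
      assume "v < w"
      then obtain r where "v < r" "r < w" using dense by blast
      then show False using that unfolding Q_def by (meson order.strict_trans1)
    qed
    from this[OF that] this[OF that(2,1)] show ?thesis by simp
  qed
  have "finite D"
  proof (rule finite_locally_finite)
    show "definable M 2 D"
      unfolding D_def Q_def
      by (intro definable_dpred dpred_conj dpred_all dpred_imp dpred_not dpred_less dpred_le dterm_var
          dterm_const A')
    fix x assume x: "x \<in> D"
    have "inj_on (\<lambda>y. y 0) D"
      unfolding D_def using uniq by (rule inj_on_graph)
    moreover have "(\<lambda>y. y 0) ` {y \<in> D. dist1 2 x y < 1} \<subseteq> A (x 1 + 1)"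
    proof
      fix a assume "a \<in> (\<lambda>y. y 0) ` {y \<in> D. dist1 2 x y < 1}"
      then obtain y where y: "a = y 0" "y \<in> D" "dist1 2 x y < 1" by blast
      then have "y 1 < x 1 + 1" using coord_le_dist1[of 1 2 x y] by simp
      then show "a \<in> A (x 1 + 1)" using y by (auto simp: D_def Q_def)
    qed
    moreover have "finite (A (x 1 + 1))" using x fin by (auto simp: D_def Q_def)
    ultimately have "finite {y \<in> D. dist1 2 x y < 1}"
      by (intro inj_on_finite[of "\<lambda>y. y 0" _ "A (x 1 + 1)"]) (auto intro: inj_on_subset)
    then show "\<exists>\<delta>>0. finite {y \<in> D. dist1 2 x y < \<delta>}" by (intro exI[of _ 1]) simp
  qed
  moreover have "(\<Union>r\<in>{0<..}. A r) \<subseteq> (\<lambda>x. x 0) ` D"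
  proof
    fix a assume "a \<in> (\<Union>r\<in>{0<..}. A r)"
    then obtain r0 where r0: "0 < r0" "a \<in> A r0" by auto
    let ?R = "{r. 0 < r \<and> a \<in> A r}"
    have ne: "?R \<noteq> {}" using r0 by auto
    have bdd: "bdd_below ?R" by (rule bdd_belowI[of _ 0]) auto
    have "0 \<le> Inf ?R" using r0 by (intro cInf_greatest) auto
    moreover have "a \<in> A r" if "Inf ?R < r" for r
    proof -
      have "\<exists>s\<in>?R. s < r" by (rule cInf_lessD[OF ne that])
      then obtain s where "0 < s" "a \<in> A s" "s < r" by blast
      then show ?thesis using mono[of s r] by auto
    qed
    moreover have "a \<notin> A r" if "0 < r" "r < Inf ?R" for r
    proof
      assume "a \<in> A r"
      then have "Inf ?R \<le> r" by (intro cInf_lower bdd) (use that in simp)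
      then show False using that by simp
    qed
    ultimately have "Q a (Inf ?R)" by (auto simp: Q_def)
    then have "(\<lambda>i::nat. if i = 0 then a else if i = 1 then Inf ?R else 0) \<in> D"
      by (auto simp: D_def pts_def)
    then show "a \<in> (\<lambda>x. x 0) ` D" by (rule image_eqI[rotated]) simp
  qed
  ultimately show ?thesis by (rule finite_surj)
qed

text \<open>Each point is paired with the supremum of the parameters at which it is still present.
  Cutting at 1 keeps the supremum finite without losing points. It is positive, and near a height
  \<open>t\<close> only the finite set \<open>A (t / 2)\<close> can contribute, so the graph is
  again locally finite.\<close>

lemma finite_decreasing_union:
  assumes A: "dpred M (\<lambda>e. e 0 \<in> A (e 1))" and mono: "\<And>r s. 0 < r \<Longrightarrow> r \<le> s \<Longrightarrow> A s \<subseteq> A r"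
    and fin: "\<And>r. 0 < r \<Longrightarrow> finite (A r)"
  shows "finite (\<Union>r\<in>{0<..}. A r)"
proof -
  define Q where "Q a t \<longleftrightarrow> 0 < t \<and> t \<le> 1 \<and> (\<forall>r. 0 < r \<and> r < t \<longrightarrow> a \<in> A r) \<and>
    (\<forall>r. t < r \<and> r \<le> 1 \<longrightarrow> a \<notin> A r)" for a t
  define D where "D = {x \<in> pts {..<2}. Q (x 0) (x 1)}"
  note A' = dpred_family[of A, OF A]
  have uniq: "t = u" if "Q a t" "Q a u" for a t u
  proof -
    have "\<not> v < w" if "Q a v" "Q a w" for v w
    proof
      assume "v < w"
      then obtain r where "v < r" "r < w" using dense by blast
      then show False using that unfolding Q_def by force
    qed
    from this[OF that] this[OF that(2,1)] show ?thesis by simp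
  qed
  have "finite D"
  proof (rule finite_locally_finite)
    show "definable M 2 D"
      unfolding D_def Q_def
      by (intro definable_dpred dpred_conj dpred_all dpred_imp dpred_not dpred_less dpred_le dterm_var
          dterm_const A')
    fix x assume x: "x \<in> D"
    then have pos: "0 < x 1" by (auto simp: D_def Q_def)
    have "inj_on (\<lambda>y. y 0) D"
      unfolding D_def using uniq by (rule inj_on_graph)
    moreover have "(\<lambda>y. y 0) ` {y \<in> D. dist1 2 x y < x 1 / 2} \<subseteq> A (x 1 / 2)"
    proof
      fix a assume "a \<in> (\<lambda>y. y 0) ` {y \<in> D. dist1 2 x y < x 1 / 2}"
      then obtain y where y: "a = y 0" "y \<in> D" "dist1 2 x y < x 1 / 2" by blast
      then have "x 1 / 2 < y 1" using coord_le_dist1[of 1 2 x y] by simp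
      then show "a \<in> A (x 1 / 2)" using y pos by (auto simp: D_def Q_def)
    qed
    moreover have "finite (A (x 1 / 2))" using pos fin by simp
    ultimately have "finite {y \<in> D. dist1 2 x y < x 1 / 2}"
      by (intro inj_on_finite[of "\<lambda>y. y 0" _ "A (x 1 / 2)"]) (auto intro: inj_on_subset)
    then show "\<exists>\<delta>>0. finite {y \<in> D. dist1 2 x y < \<delta>}" using pos by (intro exI[of _ "x 1 / 2"]) simp
  qed
  moreover have "(\<Union>r\<in>{0<..}. A r) \<subseteq> (\<lambda>x. x 0) ` D"
  proof
    fix a assume "a \<in> (\<Union>r\<in>{0<..}. A r)"
    then obtain r1 where r1: "0 < r1" "a \<in> A r1" by auto
    define r0 where "r0 = min 1 r1"
    have r0: "0 < r0" "r0 \<le> 1" "a \<in> A r0" using r1 mono[of r0 r1] by (auto simp: r0_def)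
    let ?R = "{r. 0 < r \<and> r \<le> 1 \<and> a \<in> A r}"
    have ne: "?R \<noteq> {}" using r0 by auto
    have bdd: "bdd_above ?R" by (rule bdd_aboveI[of _ 1]) auto
    have "r0 \<le> Sup ?R" using r0 bdd by (intro cSup_upper) auto
    then have "0 < Sup ?R" using r0 by simp
    moreover have "Sup ?R \<le> 1" using r0 by (intro cSup_least) auto
    moreover have "a \<in> A r" if "0 < r" "r < Sup ?R" for r
    proof -
      have "\<exists>s\<in>?R. r < s" by (rule less_cSupD[OF ne that(2)])
      then obtain s where "a \<in> A s" "r < s" by blast
      then show ?thesis using mono[of r s] that by auto
    qed
    moreover have "a \<notin> A r" if "Sup ?R < r" "r \<le> 1" for r
    proof
      assume "a \<in> A r"
      then have "r \<le> Sup ?R" using that \<open>0 < Sup ?R\<close> by (intro cSup_upper bdd CollectI) auto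
      then show False using that by simp
    qed
    ultimately have "Q a (Sup ?R)" by (auto simp: Q_def)
    then have "(\<lambda>i::nat. if i = 0 then a else if i = 1 then Sup ?R else 0) \<in> D"
      by (auto simp: D_def pts_def)
    then show "a \<in> (\<lambda>x. x 0) ` D" by (rule image_eqI[rotated]) simp
  qed
  ultimately show ?thesis by (rule finite_surj)
qed

text \<open>If the image contained no interval, then neither would the images \<open>S r s\<close>
  of the compact pieces, which are closed and definable and therefore finite. The union over
  \<open>r\<close> is increasing, the one over \<open>s\<close> decreasing, and both preserve
  finiteness.\<close>

lemma infinite_coordinate_imp_interval:
  assumes L: "definable M n L" "lc L" and inf: "infinite ((\<lambda>x. x j) ` L)"
  shows "\<exists>a b. a < b \<and> {a<..<b} \<subseteq> (\<lambda>x. x j) ` L"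
proof (rule ccontr)
  assume no_int: "\<not> ?thesis"
  have pts: "L \<subseteq> pts {..<n}" by (rule definable_subset[OF L(1)])
  have N: "definable M n (closure L - L)" by (intro definable_Diff definable_closure L)
  define S where "S r s = (\<lambda>x. x j) ` exhaust n L r s" for r s
  have S_iff: "a \<in> S r s \<longleftrightarrow> (\<exists>x\<in>L. dist1 n x (\<lambda>_. 0) \<le> r \<and> (\<forall>y \<in> closure L - L. s \<le> dist1 n x y) \<and> a = x j)"
    for a r s by (auto simp: S_def exhaust_def)
  have S_sub: "S r s \<subseteq> (\<lambda>x. x j) ` L" for r s by (auto simp: S_def exhaust_def)
  have S_mono: "S r s \<subseteq> S r' s'" if "r \<le> r'" "s' \<le> s" for r r' s s'
    using exhaust_mono[OF that, of n L] by (auto simp: S_def)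
  have S_fin: "finite (S r s)" if "s > 0" for r s
  proof (rule rdefinable_closed_finite)
    show "rdefinable (S r s)"
      unfolding rdefinable_def S_iff
      by (intro dpred_ex_in[OF L(1)] dpred_all_in[OF N] dpred_conj dpred_le dpred_eq dterm_dist1 dterm_const
          dterm_pr dterm_var)
    have "continuous_on (exhaust n L r s) (\<lambda>x. x j)" by (rule continuous_on_coord_id)
    then have "compact (S r s)"
      unfolding S_def using compact_exhaust[OF pts L(2) that] by (rule compact_continuous_image)
    then show "closed (S r s)" by (rule compact_imp_closed)
    show "\<And>a b. a < b \<Longrightarrow> \<not> {a<..<b} \<subseteq> S r s" using no_int S_sub by blast
  qed
  define B where "B s = (\<Union>r\<in>{0<..}. S r s)" for s
  have B_fin: "finite (B s)" if "s > 0" for s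
    unfolding B_def
  proof (rule finite_increasing_union)
    show "dpred M (\<lambda>e. e 0 \<in> S (e 1) s)"
      unfolding S_iff
      by (intro dpred_ex_in[OF L(1)] dpred_all_in[OF N] dpred_conj dpred_le dpred_eq dterm_dist1 dterm_const
          dterm_pr dterm_var)
  qed (use S_fin S_mono that in auto)
  have "finite (\<Union>s\<in>{0<..}. B s)"
  proof (rule finite_decreasing_union)
    have B_iff: "a \<in> B s \<longleftrightarrow> (\<exists>r. 0 < r \<and> (\<exists>x\<in>L. dist1 n x (\<lambda>_. 0) \<le> r \<and>
        (\<forall>y \<in> closure L - L. s \<le> dist1 n x y) \<and> a = x j))" for a s
      unfolding B_def using S_iff by auto
    show "dpred M (\<lambda>e. e 0 \<in> B (e 1))"
      unfolding B_iff
      by (intro dpred_ex dpred_ex_in[OF L(1)] dpred_all_in[OF N] dpred_conj dpred_le dpred_less dpred_eq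
          dterm_dist1 dterm_const dterm_pr dterm_var)
    show "B s \<subseteq> B r" if "r \<le> s" for r s
      unfolding B_def using S_mono[OF order_refl that] by blast
  qed (use B_fin in auto)
  moreover have "(\<lambda>x. x j) ` L \<subseteq> (\<Union>s\<in>{0<..}. B s)"
  proof
    fix a assume "a \<in> (\<lambda>x. x j) ` L"
    then obtain x where x: "x \<in> L" "a = x j" by blast
    obtain s where s: "s > 0" "x \<in> exhaust n L (dist1 n x (\<lambda>_. 0)) s"
      using exhaust_exhausts[OF pts L(2) x(1)] by blast
    then have "x \<in> exhaust n L (dist1 n x (\<lambda>_. 0) + 1) s"
      using exhaust_mono[of "dist1 n x (\<lambda>_. 0)" "dist1 n x (\<lambda>_. 0) + 1" s s n L] by auto
    then have "a \<in> S (dist1 n x (\<lambda>_. 0) + 1) s" using x by (auto simp: S_def)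
    moreover have "dist1 n x (\<lambda>_. 0) + 1 > 0" using dist1_nonneg[of n x "\<lambda>_. 0"] by linarith
    ultimately show "a \<in> (\<Union>s\<in>{0<..}. B s)" using s by (auto simp: B_def)
  qed
  ultimately show False using inf finite_subset by blast
qed

end

section \<open>Projections of definable locally closed sets\<close>

lemma pr_pr: "pr I (pr J x) = pr (I \<inter> J) x"
  by (auto simp: pr_def)

lemma continuous_on_pr_id [continuous_intros]: "continuous_on S (pr I)"
  using continuous_on_pr[OF continuous_on_id, of S I] by (simp add: eta_contract_eq)

lemma lc_vimage:
  assumes "continuous_on UNIV g" "lc C"
  shows "lc (g -` C)"
proof -
  obtain K U where KU: "closed K" "open U" "C = K \<inter> U" using assms(2) by (auto simp: lc_def)
  have "closed (g -` K)" "open (g -` U)"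
    using KU assms(1) by (auto intro: closed_vimage open_vimage)
  moreover have "g -` C = g -` K \<inter> g -` U" using KU by auto
  ultimately show ?thesis unfolding lc_def by blast
qed

section \<open>Baire category in coordinate subspaces\<close>

lemma baire_cover:
  assumes "completely_metrizable_space X" "countable \<G>" "\<And>T. T \<in> \<G> \<Longrightarrow> closedin X T"
    "topspace X \<subseteq> \<Union>\<G>" "topspace X \<noteq> {}"
  obtains T where "T \<in> \<G>" "X interior_of T \<noteq> {}"
proof -
  have "\<exists>T\<in>\<G>. X interior_of T \<noteq> {}"
  proof (rule ccontr)
    assume "\<not> ?thesis"
    then have "X interior_of (\<Union>\<G>) = {}"
      using Baire_category_alt[of X \<G>] assms(1-3) by blast
    moreover have "\<Union>\<G> = topspace X"
      using assms(3,4) closedin_subset by blast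
    ultimately show False using assms(5) by simp
  qed
  then show ?thesis using that by blast
qed

text \<open>For \<open>I = {}\<close> the only such set is the single point \<open>pts {}\<close>;
  this is the base of the inductions on dimension.\<close>

definition nonempty_open :: "nat set \<Rightarrow> point set \<Rightarrow> bool" where
  "nonempty_open I V \<longleftrightarrow> V \<noteq> {} \<and> (\<exists>U. open U \<and> V = pts I \<inter> U)"

lemma nonempty_open_subset: "nonempty_open I V \<Longrightarrow> V \<subseteq> pts I"
  by (auto simp: nonempty_open_def)

lemma nonempty_open_ball:
  assumes "nonempty_open I V" "p \<in> V" "I \<subseteq> {..<N}"
  obtains \<epsilon> where "\<epsilon> > 0" "\<And>y. y \<in> pts I \<Longrightarrow> dist1 N p y < \<epsilon> \<Longrightarrow> y \<in> V"
proof -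
  obtain U where U: "open U" "V = pts I \<inter> U" using assms(1) by (auto simp: nonempty_open_def)
  have sub: "pts I \<subseteq> pts {..<N}" by (rule pts_mono[OF assms(3)])
  have p: "p \<in> U" "p \<in> pts {..<N}" using assms(2) U sub by auto
  show ?thesis
  proof (rule open_contains_dist1_ball[OF U(1) p])
    fix \<epsilon> :: real
    assume "0 < \<epsilon>" "\<And>y. y \<in> pts {..<N} \<Longrightarrow> dist1 N p y < \<epsilon> \<Longrightarrow> y \<in> U"
    then show ?thesis using that[of \<epsilon>] U sub by blast
  qed
qed

lemma nonempty_open_meets_closure:
  assumes "nonempty_open I V" "V \<subseteq> closure T" "T \<subseteq> pts I"
  shows "V \<inter> T \<noteq> {}"
proof -
  obtain U where U: "open U" "V = pts I \<inter> U" "V \<noteq> {}" using assms(1) by (auto simp: nonempty_open_def)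
  then have "U \<inter> closure T \<noteq> {}" using assms(2) by blast
  then have "U \<inter> T \<noteq> {}" using open_Int_closure_eq_empty[OF U(1), of T] by simp
  then show ?thesis using U assms(3) by blast
qed

lemma baire_nonempty_open:
  assumes V: "nonempty_open I V" and "countable \<G>" "\<And>T. T \<in> \<G> \<Longrightarrow> closed T" "V \<subseteq> \<Union>\<G>"
  obtains T V' where "T \<in> \<G>" "nonempty_open I V'" "V' \<subseteq> V" "V' \<subseteq> T"
proof -
  obtain U where U: "open U" "V = pts I \<inter> U" "V \<noteq> {}" using V by (auto simp: nonempty_open_def)
  have "completely_metrizable_space (top_of_set (pts I))"
    using completely_metrizable_space_closedin[OF completely_metrizable_space_euclidean, of "pts I"]
      closed_pts[of I] by simp
  moreover have "openin (top_of_set (pts I)) V" using U by (auto simp: openin_open)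
  ultimately have "completely_metrizable_space (subtopology (top_of_set (pts I)) V)"
    by (rule completely_metrizable_space_openin)
  moreover have "subtopology (top_of_set (pts I)) V = top_of_set V"
    using U by (simp add: subtopology_subtopology Int_absorb1)
  ultimately have cm: "completely_metrizable_space (top_of_set V)" by simp
  have "\<exists>T\<in>(\<lambda>T. V \<inter> T) ` \<G>. top_of_set V interior_of T \<noteq> {}"
  proof (rule baire_cover[OF cm, of "(\<lambda>T. V \<inter> T) ` \<G>"])
    show "countable ((\<lambda>T. V \<inter> T) ` \<G>)" using assms(2) by simp
    show "closedin (top_of_set V) T" if "T \<in> (\<lambda>T. V \<inter> T) ` \<G>" for T
      using that assms(3) by (auto simp: closedin_closed)
    show "topspace (top_of_set V) \<subseteq> \<Union> ((\<lambda>T. V \<inter> T) ` \<G>)" using assms(4) by auto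
    show "topspace (top_of_set V) \<noteq> {}" using U by simp
  qed blast
  then obtain T where T: "T \<in> \<G>" "top_of_set V interior_of (V \<inter> T) \<noteq> {}" by blast
  define V' where "V' = top_of_set V interior_of (V \<inter> T)"
  have "openin (top_of_set V) V'" by (simp add: V'_def)
  then obtain U' where U': "open U'" "V' = V \<inter> U'" by (auto simp: openin_open)
  have "nonempty_open I V'"
    unfolding nonempty_open_def using U U' T(2) by (auto intro!: exI[of _ "U \<inter> U'"] simp: V'_def)
  moreover have "V' \<subseteq> V \<inter> T" unfolding V'_def by (rule interior_of_subset)
  ultimately show ?thesis using that T(1) by blast
qed

lemma nonempty_open_slab:
  assumes "nonempty_open I V" "c < d" "j \<notin> I"
  shows "nonempty_open (insert j I) {y \<in> pts (insert j I). pr I y \<in> V \<and> c < y j \<and> y j < d}"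
proof -
  obtain U where U: "open U" "V = pts I \<inter> U" "V \<noteq> {}" using assms(1) by (auto simp: nonempty_open_def)
  define W where "W = pr I -` U \<inter> {y. c < y j} \<inter> {y. y j < d}"
  have "open W"
    unfolding W_def
    by (intro open_Int open_vimage U open_Collect_less continuous_on_const continuous_on_coord_id continuous_on_pr_id)
  moreover have "{y \<in> pts (insert j I). pr I y \<in> V \<and> c < y j \<and> y j < d} = pts (insert j I) \<inter> W"
    using U by (auto simp: W_def)
  moreover have "{y \<in> pts (insert j I). pr I y \<in> V \<and> c < y j \<and> y j < d} \<noteq> {}"
  proof -
    obtain p where p: "p \<in> V" using U by blast
    have "p \<in> pts I" using p U by blast
    then have "pr I (p(j := (c + d) / 2)) = p" using assms(3) by (auto simp: pr_def pts_def)
    moreover have "p(j := (c + d) / 2) \<in> pts (insert j I)" using \<open>p \<in> pts I\<close> by (auto simp: pts_def)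
    ultimately have "p(j := (c + d) / 2) \<in> {y \<in> pts (insert j I). pr I y \<in> V \<and> c < y j \<and> y j < d}"
      using p assms(2) by simp
    then show ?thesis by blast
  qed
  ultimately show ?thesis unfolding nonempty_open_def by blast
qed

lemma pts_insert_eqI:
  assumes "y \<in> pts (insert j I)" "pr I w = pr I y" "w j = y j"
  shows "pr (insert j I) w = y"
proof
  fix i
  have "pr I w i = pr I y i" using assms(2) by simp
  then show "pr (insert j I) w i = y i"
    using assms(1,3) by (cases "i = j") (auto simp: pr_def pts_def split: if_splits)
qed

definition rational_pts :: "nat \<Rightarrow> point set" where
  "rational_pts n = {c \<in> pts {..<n}. \<forall>i. c i \<in> \<rat>}"

lemma countable_rational_pts: "countable (rational_pts n)"
proof -
  have "rational_pts n \<subseteq> point_of ` lists \<rat>"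
  proof
    fix c assume c: "c \<in> rational_pts n"
    have "c = point_of (map c [0..<n])"
      using c by (auto simp: rational_pts_def pts_def point_of_def fun_eq_iff)
    moreover have "map c [0..<n] \<in> lists \<rat>" using c by (auto simp: rational_pts_def)
    ultimately show "c \<in> point_of ` lists \<rat>" by blast
  qed
  moreover have "countable (point_of ` lists \<rat>)"
    by (intro countable_image countable_lists countable_rat)
  ultimately show ?thesis by (rule countable_subset)
qed

lemma rational_ball:
  assumes "z \<in> pts {..<n}" "\<delta> > 0"
  obtains c r where "c \<in> rational_pts n" "r \<in> \<rat>" "dist1 n c z < r"
    "\<And>y. dist1 n c y < r \<Longrightarrow> dist1 n z y < \<delta>"
proof -
  \<comment> \<open>Half of \<delta> is reserved because the rational centre is itself displaced
    from \<open>z\<close> by less than \<open>r\<close>.\<close>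
  obtain r where r: "r \<in> \<rat>" "0 < r" "r < \<delta> / 2"
    using Rats_dense_in_real[of 0 "\<delta> / 2"] assms(2) by auto
  have "\<forall>i. \<exists>q\<in>\<rat>. \<bar>q - z i\<bar> < r / real (Suc n)"
  proof
    fix i
    have "z i - r / real (Suc n) < z i + r / real (Suc n)" using r by simp
    then obtain q where "q \<in> \<rat>" "z i - r / real (Suc n) < q" "q < z i + r / real (Suc n)"
      using Rats_dense_in_real by blast
    then show "\<exists>q\<in>\<rat>. \<bar>q - z i\<bar> < r / real (Suc n)" by (intro bexI[of _ q]) (auto simp: abs_less_iff)
  qed
  then obtain q where q: "\<And>i. q i \<in> \<rat>" "\<And>i. \<bar>q i - z i\<bar> < r / real (Suc n)" by metis
  define c where "c = pr {..<n} q"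
  have c: "c \<in> rational_pts n" using q(1) by (auto simp: rational_pts_def c_def pr_def pts_def)
  have "dist1 n c z \<le> (\<Sum>i<n. r / real (Suc n))"
    unfolding dist1_def by (rule sum_mono) (use q(2) in \<open>auto simp: c_def pr_def intro: less_imp_le\<close>)
  also have "\<dots> < r" using r by (simp add: field_simps)
  finally have cz: "dist1 n c z < r" .
  have "dist1 n z y < \<delta>" if "dist1 n c y < r" for y
    using dist1_triangle[of n z y c] dist1_commute[of n z c] cz that r by linarith
  then show ?thesis using that c r(1) cz by blast
qed

text \<open>The base points over which the \<open>j\<close>-th coordinate on \<open>K\<close> takes
  all values in \<open>[c, d]\<close>. Compactness of \<open>K\<close> makes this a closed
  condition, as Baire category requires.\<close>

definition fibre :: "point set \<Rightarrow> nat set \<Rightarrow> nat \<Rightarrow> real \<Rightarrow> real \<Rightarrow> point set" where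
  "fibre K I j c d = (\<Inter>t\<in>{c..d}. pr I ` (K \<inter> {y. y j = t}))"

lemma closed_fibre: "compact K \<Longrightarrow> closed (fibre K I j c d)"
  unfolding fibre_def
proof (intro closed_INT ballI)
  fix t assume "compact K"
  have "closed {y::point. y j = t}" by (intro closed_Collect_eq continuous_on_coord_id continuous_on_const)
  then have "compact (K \<inter> {y. y j = t})" using \<open>compact K\<close> by (rule compact_Int_closed[rotated])
  then show "closed (pr I ` (K \<inter> {y. y j = t}))"
    by (intro compact_imp_closed compact_continuous_image continuous_on_pr_id)
qed

lemma finite_if_finite_coords:
  assumes "S \<subseteq> pts {..<n}" "\<And>j. j < n \<Longrightarrow> finite ((\<lambda>x. x j) ` S)"
  shows "finite S"
proof -
  let ?B = "\<Union>j<n. (\<lambda>x. x j) ` S"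
  have "x i \<in> ?B" if "x \<in> S" "i < n" for x i
    using that by (intro UN_I[of i]) auto
  then have "(\<lambda>x. map x [0..<n]) ` S \<subseteq> {xs. set xs \<subseteq> ?B \<and> length xs = n}"
    by (auto simp del: UN_iff)
  moreover have "finite {xs. set xs \<subseteq> ?B \<and> length xs = n}"
    using assms(2) by (intro finite_lists_length_eq) auto
  ultimately have "finite ((\<lambda>x. map x [0..<n]) ` S)" by (rule finite_subset)
  moreover have "inj_on (\<lambda>x. map x [0..<n]) S"
  proof (rule inj_onI)
    fix x y assume xy: "x \<in> S" "y \<in> S" "map x [0..<n] = map y [0..<n]"
    then have "x \<in> pts {..<n}" "y \<in> pts {..<n}" using assms(1) by auto
    then show "x = y" using xy(3) by (auto simp: pts_def fun_eq_iff)
  qed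
  ultimately show ?thesis by (rule finite_imageD)
qed

context no_infinite_discrete
begin

text \<open>The projections of definable locally closed sets take the place of the
  \<open>D\<^sub>\<Sigma>\<close> sets of Miller and Speissegger.\<close>

definition proj_lc :: "nat \<Rightarrow> point set \<Rightarrow> bool" where
  "proj_lc N A \<longleftrightarrow> (\<exists>n L I. I \<subseteq> {..<N} \<and> definable M n L \<and> lc L \<and> A = pr I ` L)"

lemma proj_lc_lc: "definable M N L \<Longrightarrow> lc L \<Longrightarrow> proj_lc N L"
  unfolding proj_lc_def
proof (intro exI conjI)
  assume "definable M N L"
  then have "L \<subseteq> pts {..<N}" by (rule definable_subset)
  then have "pr {..<N} x = x" if "x \<in> L" for x using that pr_id by blast
  then show "L = pr {..<N} ` L" by simp
qed auto

lemma proj_lc_pr: "proj_lc N A \<Longrightarrow> proj_lc N (pr J ` A)"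
proof -
  assume "proj_lc N A"
  then obtain n L I where *: "I \<subseteq> {..<N}" "definable M n L" "lc L" "A = pr I ` L" by (auto simp: proj_lc_def)
  have "pr J ` A = pr (J \<inter> I) ` L" using *(4) by (simp add: image_image pr_pr)
  moreover have "J \<inter> I \<subseteq> {..<N}" using * by blast
  ultimately show ?thesis unfolding proj_lc_def using * by blast
qed

lemma proj_lc_Int:
  assumes "proj_lc N A" "definable M N C" "lc C"
  shows "proj_lc N (A \<inter> C)"
proof -
  obtain n L I where *: "I \<subseteq> {..<N}" "definable M n L" "lc L" "A = pr I ` L"
    using assms(1) by (auto simp: proj_lc_def)
  have "definable M n {x \<in> pts {..<n}. pr {..<n} x \<in> L \<and> pr I x \<in> C}"
    by (intro definable_dpred dpred_conj dpred_definable *(2) dpred_in[OF assms(2)] dterm_pr dterm_var)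
      (use *(1) in \<open>auto simp: pr_def pts_def\<close>)
  moreover have "{x \<in> pts {..<n}. pr {..<n} x \<in> L \<and> pr I x \<in> C} = L \<inter> pr I -` C"
    using definable_subset[OF *(2)] by (auto simp: pr_id)
  ultimately have "definable M n (L \<inter> pr I -` C)" by simp
  moreover have "lc (L \<inter> pr I -` C)"
    by (intro lc_Int lc_vimage * assms continuous_on_pr_id)
  moreover have "A \<inter> C = pr I ` (L \<inter> pr I -` C)" using *(4) by auto
  ultimately show ?thesis unfolding proj_lc_def using *(1) by blast
qed

lemma proj_lc_subset: "proj_lc N A \<Longrightarrow> A \<subseteq> pts {..<N}"
  unfolding proj_lc_def using pts_mono pr_in_pts by blast

lemma proj_lc_definable:
  assumes "proj_lc N A"
  shows "definable M N A"
proof -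
  obtain n L I where *: "I \<subseteq> {..<N}" "definable M n L" "A = pr I ` L"
    using assms(1) by (auto simp: proj_lc_def)
  show ?thesis
  proof (rule definableI[OF proj_lc_subset[OF assms]])
    show "dpred M (\<lambda>x. \<exists>y\<in>L. pr {..<N} x = pr I y)"
      by (intro dpred_ex_in[OF *(2)] dpred_vec_eq[of _ N] dterm_pr dterm_var)
        (use *(1) in \<open>auto simp: pr_def pts_def\<close>)
    show "x \<in> A \<longleftrightarrow> (\<exists>y\<in>L. pr {..<N} x = pr I y)" if "x \<in> pts {..<N}" for x
      using that *(3) by (auto simp: pr_id)
  qed
qed

lemma proj_lc_coordinate:
  assumes "proj_lc N A" "infinite ((\<lambda>x. x j) ` A)"
  shows "\<exists>a b. a < b \<and> {a<..<b} \<subseteq> (\<lambda>x. x j) ` A"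
proof -
  obtain n L I where *: "I \<subseteq> {..<N}" "definable M n L" "lc L" "A = pr I ` L"
    using assms(1) by (auto simp: proj_lc_def)
  have "j \<in> I"
  proof (rule ccontr)
    assume "j \<notin> I"
    then have "(\<lambda>x. x j) ` A \<subseteq> {0}" using * by (auto simp: pr_def)
    then show False using assms(2) finite_subset by blast
  qed
  then have "(\<lambda>x. x j) ` A = (\<lambda>x. x j) ` L" unfolding *(4) image_image by (simp add: pr_def)
  then show ?thesis using infinite_coordinate_imp_interval[OF *(2,3), of j] assms(2) by simp
qed

lemma proj_lc_compacts:
  assumes "proj_lc N A"
  obtains K :: "nat \<Rightarrow> point set" where "\<And>k. compact (K k)" "A = (\<Union>k. K k)"
proof -
  obtain n L I where *: "I \<subseteq> {..<N}" "definable M n L" "lc L" "A = pr I ` L"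
    using assms(1) by (auto simp: proj_lc_def)
  note pts = definable_subset[OF *(2)]
  define K where "K k = pr I ` exhaust n L (real k) (1 / real (Suc k))" for k
  have "compact (K k)" for k
    unfolding K_def
    by (intro compact_continuous_image continuous_on_pr_id compact_exhaust pts *(3)) simp
  moreover have "A = (\<Union>k. K k)"
    unfolding *(4) K_def using exhaust_UN_nat[OF pts *(3)] by (metis image_UN)
  ultimately show ?thesis using that by blast
qed

lemma definable_ball: "definable M N {y \<in> pts {..<N}. dist1 N c y < r}"
  by (intro definable_dpred dpred_less dterm_dist1 dterm_const dterm_var)

lemma lc_ball: "lc {y \<in> pts {..<N}. dist1 N c y < r}"
proof -
  have "{y \<in> pts {..<N}. dist1 N c y < r} = pts {..<N} \<inter> {y. dist1 N c y < r}" by auto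
  then show ?thesis by (simp add: lc_Int lc_closed lc_open closed_pts open_dist1_ball)
qed

text \<open>The part of \<open>A\<close> over \<open>p\<close> is again a projection of a locally
  closed set, so its infinite coordinate image contains an interval. Baire category in this interval
  finds a subinterval covered by a single compact piece. Rational endpoints keep the family of all
  \<open>fibre\<close> sets countable.\<close>

lemma fiber_interval:
  assumes A: "proj_lc N A" and K: "\<And>k::nat. compact (K k)" "A = (\<Union>k. K k)" and p: "p \<in> pts I" "I \<subseteq> {..<N}"
    and inf: "infinite ((\<lambda>y. y j) ` {y \<in> A. pr I y = p})"
  obtains k c d where "c \<in> \<rat>" "d \<in> \<rat>" "c < d" "p \<in> fibre (K k) I j c d"
proof -
  let ?C = "{y \<in> pts {..<N}. pr I y = p}"
  have "p \<in> pts {..<N}" "\<And>y. pr I y \<in> pts {..<N}" using p pts_mono[OF p(2)] pr_in_pts by blast+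
  then have "definable M N ?C"
    by (intro definable_dpred dpred_vec_eq[of _ N] dterm_pr dterm_var dterm_const)
  moreover have "closed ?C"
  proof -
    have "?C = pts {..<N} \<inter> pr I -` {p}" by auto
    moreover have "closed (pr I -` {p})" by (intro closed_vimage closed_singleton continuous_on_pr_id)
    ultimately show ?thesis by (simp add: closed_Int closed_pts)
  qed
  ultimately have "proj_lc N (A \<inter> ?C)" by (intro proj_lc_Int[OF A] lc_closed)
  moreover have "A \<inter> ?C = {y \<in> A. pr I y = p}" using proj_lc_subset[OF A] by auto
  ultimately obtain a b where ab: "a < b" "{a<..<b} \<subseteq> (\<lambda>y. y j) ` {y \<in> A. pr I y = p}"
    using proj_lc_coordinate[of N "A \<inter> ?C" j] inf by auto
  define S where "S k = (\<lambda>y. y j) ` (K k \<inter> pr I -` {p})" for k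
  have "closed (pr I -` {p})" by (intro closed_vimage closed_singleton continuous_on_pr_id)
  then have "compact (K k \<inter> pr I -` {p})" for k by (rule compact_Int_closed[OF K(1)])
  then have S: "closed (S k)" for k
    unfolding S_def by (intro compact_imp_closed compact_continuous_image continuous_on_coord_id)
  have cover: "{a<..<b} \<subseteq> (\<Union>k. S k)"
  proof
    fix t assume "t \<in> {a<..<b}"
    then obtain y where y: "y \<in> A" "pr I y = p" "t = y j" using ab(2) by blast
    obtain k where "y \<in> K k" using y(1) unfolding K(2) by blast
    then have "t \<in> S k" unfolding S_def using y by blast
    then show "t \<in> (\<Union>k. S k)" by blast
  qed
  have "completely_metrizable_space (top_of_set {a<..<b})"
    by (rule completely_metrizable_space_openin[OF completely_metrizable_space_euclidean]) simp
  then have "\<exists>T\<in>range (\<lambda>k. {a<..<b} \<inter> S k). top_of_set {a<..<b} interior_of T \<noteq> {}"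
  proof (rule baire_cover)
    show "closedin (top_of_set {a<..<b}) T" if "T \<in> range (\<lambda>k. {a<..<b} \<inter> S k)" for T
      using that S by (auto simp: closedin_closed)
    show "topspace (top_of_set {a<..<b}) \<subseteq> \<Union> (range (\<lambda>k. {a<..<b} \<inter> S k))" using cover by auto
    show "topspace (top_of_set {a<..<b}) \<noteq> {}" using ab(1) by simp
  qed auto
  then obtain k where k: "top_of_set {a<..<b} interior_of ({a<..<b} \<inter> S k) \<noteq> {}" by blast
  define W where "W = top_of_set {a<..<b} interior_of ({a<..<b} \<inter> S k)"
  have "openin (top_of_set {a<..<b}) W" by (simp add: W_def)
  then have "open W" by (rule openin_open_trans) simp
  have W: "W \<subseteq> S k" using interior_of_subset[of "top_of_set {a<..<b}" "{a<..<b} \<inter> S k"] by (auto simp: W_def)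
  obtain t where "t \<in> W" using k by (auto simp: W_def)
  then obtain e where e: "e > 0" "\<And>u. dist u t < e \<Longrightarrow> u \<in> W" using \<open>open W\<close> unfolding open_dist by metis
  obtain c where c: "c \<in> \<rat>" "t - e < c" "c < t" using Rats_dense_in_real[of "t - e" t] e by auto
  obtain d where d: "d \<in> \<rat>" "t < d" "d < t + e" using Rats_dense_in_real[of t "t + e"] e by auto
  have "p \<in> pr I ` (K k \<inter> {y. y j = u})" if "u \<in> {c..d}" for u
  proof -
    have "u \<in> S k" using W e(2)[of u] that c d by (auto simp: dist_real_def)
    then obtain y where "y \<in> K k" "pr I y = p" "y j = u" by (auto simp: S_def)
    then show ?thesis by blast
  qed
  then have "p \<in> fibre (K k) I j c d" by (auto simp: fibre_def)
  then show ?thesis using that c d by fastforce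
qed

text \<open>An open set of such base points thus produces interior in one more coordinate.\<close>

lemma fibre_slab:
  assumes "p \<in> fibre K I j c d" "y \<in> pts (insert j I)" "pr I y = p" "c < y j" "y j < d"
  shows "y \<in> pr (insert j I) ` K"
proof -
  have "p \<in> pr I ` (K \<inter> {w. w j = y j})" using assms(1,4,5) by (auto simp: fibre_def)
  then obtain w where w: "w \<in> K" "w j = y j" "pr I w = p" by blast
  have "pr I w = pr I y" using w assms(3) by simp
  then have "pr (insert j I) w = y" using pts_insert_eqI assms(2) w(2) by blast
  then show ?thesis using w(1) by blast
qed

text \<open>A countable union of compact sets can be dense and codense, as \<open>\<rat>\<close> is; the interval
  property of infinite fibres excludes this.\<close>

lemma proj_lc_dichotomy:
  assumes "finite I" "I \<subseteq> {..<N}" "proj_lc N A" "A \<subseteq> pts I" "nonempty_open I V"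
  shows "\<exists>V'. nonempty_open I V' \<and> V' \<subseteq> V \<and> (V' \<subseteq> A \<or> V' \<inter> A = {})"
  using assms
proof (induction I arbitrary: A V rule: finite_induct)
  case empty
  have "pts {} = {\<lambda>_. 0}" by (auto simp: pts_def)
  then have "V = {\<lambda>_. 0}" using empty.prems(4) by (auto simp: nonempty_open_def)
  then show ?case using empty.prems(4) by (intro exI[of _ V]) auto
next
  case (insert j I)
  have IN: "I \<subseteq> {..<N}" and jN: "j < N" using insert.prems(1) by auto
  show ?case
  proof (rule ccontr)
    assume none: "\<not> ?case"
    obtain x where x: "x \<in> V" using insert.prems(4) by (auto simp: nonempty_open_def)
    obtain \<epsilon> where e: "\<epsilon> > 0" "\<And>y. y \<in> pts (insert j I) \<Longrightarrow> dist1 N x y < \<epsilon> \<Longrightarrow> y \<in> V"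
      by (rule nonempty_open_ball[OF insert.prems(4) x insert.prems(1)]) blast
    have xp: "x \<in> pts (insert j I)" using x nonempty_open_subset[OF insert.prems(4)] by blast
    \<comment> \<open>A product neighbourhood of \<open>x\<close> inside \<open>V\<close>: base
      \<open>U\<close> and height in \<open>(a, b)\<close>, each with half of the radius.\<close>
    define U where "U = {q \<in> pts I. dist1 N (pr I x) q < \<epsilon> / 2}"
    define a b where "a = x j - \<epsilon> / 2" and "b = x j + \<epsilon> / 2"
    have inV: "y \<in> V" if y: "y \<in> pts (insert j I)" "pr I y \<in> U" "a < y j" "y j < b" for y
    proof -
      have "dist1 N x y \<le> (\<Sum>i<N. \<bar>pr I x i - pr I y i\<bar> + (if i = j then \<bar>x j - y j\<bar> else 0))"
        unfolding dist1_def by (rule sum_mono) (use xp y(1) in \<open>auto simp: pr_def pts_def\<close>)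
      also have "\<dots> = dist1 N (pr I x) (pr I y) + \<bar>x j - y j\<bar>"
        using jN by (simp add: sum.distrib dist1_def)
      also have "\<dots> < \<epsilon>" using y by (auto simp: U_def a_def b_def abs_less_iff)
      finally show ?thesis using e(2) y(1) by blast
    qed
    have U: "nonempty_open I U"
    proof -
      have "U = pts I \<inter> {q. dist1 N (pr I x) q < \<epsilon> / 2}" by (auto simp: U_def)
      moreover have "pr I x \<in> U" using e by (simp add: U_def)
      ultimately show ?thesis unfolding nonempty_open_def using open_dist1_ball by blast
    qed
    have slabs: "definable M N {y \<in> pts {..<N}. c < y j \<and> y j < d}" "lc {y \<in> pts {..<N}. c < y j \<and> y j < d}" for c d
    proof -
      show "definable M N {y \<in> pts {..<N}. c < y j \<and> y j < d}"
        by (intro definable_dpred dpred_conj dpred_less dterm_const dterm_var)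
      have "{y \<in> pts {..<N}. c < y j \<and> y j < d} = pts {..<N} \<inter> ({y. c < y j} \<inter> {y. y j < d})" by auto
      moreover have "open ({y::point. c < y j} \<inter> {y. y j < d})"
        by (intro open_Int open_Collect_less continuous_on_const continuous_on_coord_id)
      ultimately show "lc {y \<in> pts {..<N}. c < y j \<and> y j < d}"
        by (simp add: lc_Int lc_closed lc_open closed_pts)
    qed
    define B where "B c d = A \<inter> {y \<in> pts {..<N}. c < y j \<and> y j < d}" for c d
    have B_iff: "y \<in> B c d \<longleftrightarrow> y \<in> A \<and> c < y j \<and> y j < d" for y c d
      using proj_lc_subset[OF insert.prems(2)] by (auto simp: B_def)
    have B: "proj_lc N (B c d)" for c d unfolding B_def by (intro proj_lc_Int insert.prems slabs)
    obtain K :: "nat \<Rightarrow> point set" where K: "\<And>k. compact (K k)" "B a b = (\<Union>k. K k)"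
      by (rule proj_lc_compacts[OF B]) blast
    \<comment> \<open>On \<open>pts I\<close> this is the relative interior of the projection of
      \<open>B c d\<close>.\<close>
    define O' where "O' c d = \<Union>{G. open G \<and> pts I \<inter> G \<subseteq> pr I ` B c d}" for c d
    define \<Q> where "\<Q> = {(c, d). c \<in> \<rat> \<and> d \<in> \<rat> \<and> a < c \<and> c < d \<and> d < b}"
    define \<P> where "\<P> = {(c, d). c \<in> \<rat> \<and> d \<in> \<rat> \<and> c < (d::real)}"
    \<comment> \<open>This covers \<open>U\<close>: if \<open>q\<close> lies in every
      \<open>O' c d\<close>, then the part of \<open>A\<close> over \<open>q\<close> has a point in
      each rational subinterval of \<open>(a, b)\<close>. Its heights are then dense and so
      infinite, and they fill an interval within one compact piece.\<close>
    define \<G> where "\<G> = (\<lambda>(c, d). - O' c d) ` \<Q> \<union> (\<lambda>(k, c, d). fibre (K k) I j c d) ` (UNIV \<times> \<P>)"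
    have "countable \<Q>" "countable \<P>"
      by (rule countable_subset[of _ "\<rat> \<times> \<rat>"]; auto simp: \<Q>_def \<P>_def countable_rat)+
    then have "countable \<G>" unfolding \<G>_def by (intro countable_Un countable_image countable_SIGMA) auto
    moreover have "closed T" if "T \<in> \<G>" for T
    proof -
      have "open (O' c d)" for c d by (auto simp: O'_def)
      then show ?thesis using that K(1) by (auto simp: \<G>_def closed_fibre)
    qed
    moreover have "U \<subseteq> \<Union>\<G>"
    proof
      fix q assume q: "q \<in> U"
      show "q \<in> \<Union>\<G>"
      proof (cases "\<exists>(c, d)\<in>\<Q>. q \<notin> O' c d")
        case True
        then show ?thesis by (auto simp: \<G>_def)
      next
        case False
        have "q \<in> pts I" using q by (simp add: U_def)
        have dense: "\<exists>y\<in>B a b. pr I y = q \<and> c < y j \<and> y j < d" if cd: "(c, d) \<in> \<Q>" for c d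
        proof -
          have "q \<in> O' c d" using False cd by auto
          then have "q \<in> pr I ` B c d" using \<open>q \<in> pts I\<close> by (auto simp: O'_def)
          then show ?thesis using cd by (auto simp: B_iff \<Q>_def)
        qed
        have "infinite ((\<lambda>y. y j) ` {y \<in> B a b. pr I y = q})" (is "infinite ?S")
        proof
          assume fin: "finite ?S"
          have "a < b" using e by (simp add: a_def b_def)
          then have "infinite ({a<..<b} - ?S)" using fin by (simp add: infinite_Ioo)
          have "open ({a<..<b} - ?S)" using fin by (intro open_Diff finite_imp_closed) auto
          obtain t where t: "t \<in> {a<..<b} - ?S"
            using infinite_imp_nonempty[OF \<open>infinite ({a<..<b} - ?S)\<close>] by blast
          have "\<exists>\<eta>>0. \<forall>u. dist u t < \<eta> \<longrightarrow> u \<in> {a<..<b} - ?S"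
            using \<open>open ({a<..<b} - ?S)\<close> t by (simp only: open_dist)
          then obtain \<eta> where \<eta>: "\<eta> > 0" "\<And>u. dist u t < \<eta> \<Longrightarrow> u \<in> {a<..<b} - ?S" by blast
          obtain c where c: "c \<in> \<rat>" "t - \<eta> < c" "c < t" using Rats_dense_in_real[of "t - \<eta>" t] \<eta> by auto
          obtain d where d: "d \<in> \<rat>" "t < d" "d < t + \<eta>" using Rats_dense_in_real[of t "t + \<eta>"] \<eta> by auto
          have "c \<in> {a<..<b}" "d \<in> {a<..<b}" using \<eta>(2)[of c] \<eta>(2)[of d] c d by (auto simp: dist_real_def)
          then have "(c, d) \<in> \<Q>" using c d by (auto simp: \<Q>_def)
          then obtain y where y: "y \<in> B a b" "pr I y = q" "c < y j" "y j < d" using dense by blast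
          have "\<bar>y j - t\<bar> < \<eta>" using y(3,4) c d by (simp add: abs_less_iff)
          then have "y j \<in> {a<..<b} - ?S" by (intro \<eta>(2)) (simp add: dist_real_def)
          then show False using y by blast
        qed
        then obtain k c d where "c \<in> \<rat>" "d \<in> \<rat>" "c < d" "q \<in> fibre (K k) I j c d"
          by (rule fiber_interval[OF B K \<open>q \<in> pts I\<close> IN]) blast
        moreover then have "fibre (K k) I j c d \<in> \<G>"
          unfolding \<G>_def \<P>_def by (intro UnI2 image_eqI[of _ _ "(k, c, d)"]) auto
        ultimately show ?thesis by blast
      qed
    qed
    ultimately obtain T V1 where T: "T \<in> \<G>" "nonempty_open I V1" "V1 \<subseteq> U" "V1 \<subseteq> T"
      by (rule baire_nonempty_open[OF U]) blast
    consider c d where "(c, d) \<in> \<Q>" "T = - O' c d" | k c d where "c < d" "T = fibre (K k) I j c d"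
      using T(1) by (auto simp: \<G>_def \<P>_def)
    then show False
    proof cases
      case 1
      \<comment> \<open>No nonempty open subset of \<open>V1\<close> lies in the projection of
        \<open>B c d\<close>. The induction hypothesis therefore yields one that misses it, and the
        slab over that set misses \<open>A\<close>.\<close>
      have cd: "a < c" "c < d" "d < b" using 1(1) by (auto simp: \<Q>_def)
      have "proj_lc N (pr I ` B c d)" by (rule proj_lc_pr[OF B])
      moreover have "pr I ` B c d \<subseteq> pts I" by auto
      ultimately obtain V2 where V2: "nonempty_open I V2" "V2 \<subseteq> V1" "V2 \<subseteq> pr I ` B c d \<or> V2 \<inter> pr I ` B c d = {}"
        using insert.IH[OF IN _ _ T(2)] by blast
      obtain G where G: "open G" "V2 = pts I \<inter> G" "V2 \<noteq> {}" using V2(1) by (auto simp: nonempty_open_def)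
      show False
      proof (cases "V2 \<subseteq> pr I ` B c d")
        case True
        then have "V2 \<subseteq> O' c d" using G by (auto simp: O'_def)
        then show False using V2(2) T(4) 1(2) G(3) by blast
      next
        case False
        then have disj: "V2 \<inter> pr I ` B c d = {}" using V2(3) by blast
        let ?W = "{y \<in> pts (insert j I). pr I y \<in> V2 \<and> c < y j \<and> y j < d}"
        have "nonempty_open (insert j I) ?W" by (rule nonempty_open_slab[OF V2(1) cd(2) insert.hyps(2)])
        moreover have "?W \<subseteq> V" using inV V2(2) T(3) cd by force
        moreover have "?W \<inter> A = {}" using disj by (auto simp: B_iff)
        ultimately show False using none by blast
      qed
    next
      case 2
      \<comment> \<open>Here every point of \<open>V1\<close> carries the full segment, so the slab
        lies in \<open>A\<close>.\<close>
      let ?W = "{y \<in> pts (insert j I). pr I y \<in> V1 \<and> c < y j \<and> y j < d}"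
      have W: "nonempty_open (insert j I) ?W" by (rule nonempty_open_slab[OF T(2) 2(1) insert.hyps(2)])
      have "y \<in> B a b" if "y \<in> ?W" for y
      proof -
        have "y \<in> pr (insert j I) ` K k" using fibre_slab[of "pr I y" "K k" I j c d y] that T(4) 2(2) by auto
        then obtain w where "w \<in> B a b" "y = pr (insert j I) w" using K(2) by blast
        moreover then have "w \<in> pts (insert j I)" using insert.prems(3) by (auto simp: B_iff)
        ultimately show ?thesis by (simp add: pr_id)
      qed
      then have WB: "?W \<subseteq> B a b" by blast
      have "?W \<subseteq> A" using WB B_iff by blast
      moreover have "?W \<subseteq> V"
      proof
        fix y assume y: "y \<in> ?W"
        then have "y \<in> B a b" using WB by blast
        then show "y \<in> V" using inV[of y] y T(3) unfolding B_iff by blast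
      qed
      ultimately show False using none W by blast
    qed
  qed
qed

end

section \<open>Finite unions of definable locally closed sets\<close>

text \<open>In applications \<open>P\<close> is either inclusion in \<open>T\<close> or definability.\<close>

definition closure_algebra :: "point set \<Rightarrow> (point set \<Rightarrow> bool) \<Rightarrow> bool" where
  "closure_algebra T P \<longleftrightarrow> closed T \<and> P T \<and> (\<forall>A. P A \<longrightarrow> A \<subseteq> T \<and> P (closure A)) \<and>
     (\<forall>A B. P A \<longrightarrow> P B \<longrightarrow> P (A \<inter> B) \<and> P (A - B))"

definition lc_union :: "(point set \<Rightarrow> bool) \<Rightarrow> point set \<Rightarrow> bool" where
  "lc_union P A \<longleftrightarrow> (\<exists>\<L>. finite \<L> \<and> (\<forall>L\<in>\<L>. P L \<and> lc L) \<and> A = \<Union>\<L>)"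

lemma lc_union_lc: "P L \<Longrightarrow> lc L \<Longrightarrow> lc_union P L"
  unfolding lc_union_def by (intro exI[of _ "{L}"]) simp

lemma lc_union_empty: "lc_union P {}"
  unfolding lc_union_def by (intro exI[of _ "{}"]) simp

lemma lc_union_Un: "lc_union P A \<Longrightarrow> lc_union P B \<Longrightarrow> lc_union P (A \<union> B)"
proof -
  assume "lc_union P A" "lc_union P B"
  then obtain \<A> \<B> where "finite \<A>" "\<forall>L\<in>\<A>. P L \<and> lc L" "A = \<Union>\<A>"
    "finite \<B>" "\<forall>L\<in>\<B>. P L \<and> lc L" "B = \<Union>\<B>" unfolding lc_union_def by metis
  then show ?thesis unfolding lc_union_def by (intro exI[of _ "\<A> \<union> \<B>"]) auto
qed

lemma lc_union_Union: "finite \<A> \<Longrightarrow> (\<And>A. A \<in> \<A> \<Longrightarrow> lc_union P (f A)) \<Longrightarrow> lc_union P (\<Union>A\<in>\<A>. f A)"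
  by (induction \<A> rule: finite_induct) (auto simp: lc_union_empty lc_union_Un)

lemma lc_union_Int:
  assumes P: "closure_algebra T P" and "lc_union P A" "lc_union P B"
  shows "lc_union P (A \<inter> B)"
proof -
  obtain \<A> \<B> where *: "finite \<A>" "\<forall>L\<in>\<A>. P L \<and> lc L" "A = \<Union>\<A>"
    "finite \<B>" "\<forall>L\<in>\<B>. P L \<and> lc L" "B = \<Union>\<B>" using assms(2,3) unfolding lc_union_def by metis
  have "lc_union P (\<Union>L\<in>\<A>. \<Union>L'\<in>\<B>. L \<inter> L')"
    using * P by (intro lc_union_Union lc_union_lc lc_Int) (auto simp: closure_algebra_def)
  moreover have "(\<Union>L\<in>\<A>. \<Union>L'\<in>\<B>. L \<inter> L') = A \<inter> B" using * by blast
  ultimately show ?thesis by simp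
qed

text \<open>The complement of a locally closed \<open>L\<close> consists of two locally closed
  parts, the complement of its closure and its closed frontier. An intersection over the finitely
  many pieces finishes the argument.\<close>

lemma lc_union_Diff:
  assumes P: "closure_algebra T P" and "lc_union P A"
  shows "lc_union P (T - A)"
proof -
  have PD: "\<And>A. P A \<Longrightarrow> A \<subseteq> T \<and> P (closure A)" "\<And>A B. P A \<Longrightarrow> P B \<Longrightarrow> P (A - B)" "P T" "closed T"
    using P by (auto simp: closure_algebra_def)
  have one: "lc_union P (T - L)" if L: "P L" "lc L" for L
  proof -
    have "closed (closure L - L)" by (rule closed_closure_diff_lc[OF L(2)])
    then have "lc_union P (closure L - L)" using PD L by (intro lc_union_lc lc_closed) auto
    moreover have "T - closure L = T \<inter> - closure L" by auto
    then have "lc (T - closure L)" using PD by (simp add: lc_Int lc_closed lc_open open_Compl)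
    then have "lc_union P (T - closure L)" using PD L by (intro lc_union_lc) auto
    ultimately have "lc_union P ((T - closure L) \<union> (closure L - L))" by (intro lc_union_Un)
    moreover have "closure L \<subseteq> T" using PD L by (simp add: closure_minimal)
    then have "(T - closure L) \<union> (closure L - L) = T - L" using closure_subset[of L] by blast
    ultimately show ?thesis by simp
  qed
  obtain \<A> where *: "finite \<A>" "\<forall>L\<in>\<A>. P L \<and> lc L" "A = \<Union>\<A>"
    using assms(2) unfolding lc_union_def by metis
  have "lc_union P (T - \<Union>\<A>)" using *(1,2)
  proof (induction \<A> rule: finite_induct)
    case empty
    then show ?case using PD by (simp add: lc_union_lc lc_closed)
  next
    case (insert L \<A>)
    have "T - \<Union>(insert L \<A>) = (T - L) \<inter> (T - \<Union>\<A>)" by auto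
    then show ?case using insert one by (simp add: lc_union_Int[OF P])
  qed
  then show ?thesis using * by simp
qed

section \<open>Points at which a set fails to be locally closed\<close>

definition residue_set :: "point set \<Rightarrow> point set" where
  "residue_set Y = Y \<inter> closure (closure Y - Y)"

text \<open>The second part is locally closed and contained in \<open>Y\<close>. The residue
  consists of the points of \<open>Y\<close> without a neighbourhood in which \<open>Y\<close>
  agrees with its closure, so iterating peels off locally closed layers.\<close>

lemma residue_split: "Y = residue_set Y \<union> (closure Y \<inter> - closure (closure Y - Y))"
  using closure_subset[of Y] closure_subset[of "closure Y - Y"] by (auto simp: residue_set_def)

text \<open>Each step lowers the number of pieces whose closure contains a given point.\<close>

lemma residue_rank:
  assumes \<L>: "finite \<L>" "\<And>L. L \<in> \<L> \<Longrightarrow> lc L" and X: "X = \<Union>\<L>"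
  shows "x \<in> (residue_set ^^ j) X \<Longrightarrow> j < card {L \<in> \<L>. x \<in> closure L}"
proof (induction j arbitrary: x)
  case 0
  then obtain L where "L \<in> \<L>" "x \<in> L" using X by auto
  then have "L \<in> {L \<in> \<L>. x \<in> closure L}" using closure_subset by auto
  then show ?case using \<L>(1) card_gt_0_iff[of "{L \<in> \<L>. x \<in> closure L}"] by auto
next
  case (Suc j)
  define Y where "Y = (residue_set ^^ j) X"
  \<comment> \<open>All iterates are closed relative to \<open>X\<close>; this is what later allows
    a point of \<open>closure Y\<close> outside \<open>Y\<close> to be moved outside all of
    \<open>X\<close>.\<close>
  have "\<exists>D. closed D \<and> (residue_set ^^ i) X = X \<inter> D" for i
  proof (induction i)
    case 0
    then show ?case by (intro exI[of _ UNIV]) simp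
  next
    case (Suc i)
    then obtain D where D: "closed D" "(residue_set ^^ i) X = X \<inter> D" by blast
    have "(residue_set ^^ Suc i) X = X \<inter> (D \<inter> closure (closure (X \<inter> D) - X \<inter> D))"
      by (simp add: D(2) residue_set_def Int_assoc)
    moreover have "closed (D \<inter> closure (closure (X \<inter> D) - X \<inter> D))" using D(1) by (intro closed_Int closed_closure)
    ultimately show ?case by blast
  qed
  then obtain D where D: "closed D" "Y = X \<inter> D" unfolding Y_def by blast
  have "x \<in> residue_set Y" using Suc.prems by (simp add: Y_def)
  then have x: "x \<in> Y" "x \<in> closure (closure Y - Y)" by (auto simp: residue_set_def)
  then obtain L where L: "L \<in> \<L>" "x \<in> L" using X D by auto
  obtain C U where CU: "closed C" "open U" "L = C \<inter> U" using \<L>(2)[OF L(1)] by (auto simp: lc_def)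
  \<comment> \<open>A neighbourhood of \<open>x\<close> that meets no closure of a piece except
    those containing \<open>x\<close>. Points in it can only lose pieces.\<close>
  define O' where "O' = U \<inter> (\<Inter>L'\<in>{L' \<in> \<L>. x \<notin> closure L'}. - closure L')"
  have "open O'" unfolding O'_def using \<L>(1) CU by (intro open_Int open_INT) auto
  moreover have "x \<in> O'" using L CU by (auto simp: O'_def)
  ultimately have "O' \<inter> (closure Y - Y) \<noteq> {}"
    using x(2) open_Int_closure_eq_empty[of O' "closure Y - Y"] by blast
  then obtain y where y: "y \<in> O'" "y \<in> closure Y" "y \<notin> Y" by blast
  have "closure Y \<subseteq> D" using D by (simp add: closure_minimal)
  then have "y \<notin> X" using y D by blast
  \<comment> \<open>Inside \<open>U\<close>, being outside \<open>X\<close> and hence outside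
    \<open>L\<close> means being outside the closed set \<open>C\<close>. So \<open>y\<close> avoids
    the closure of \<open>L\<close>, and a nearby point \<open>z\<close> of \<open>Y\<close> has
    lost the piece \<open>L\<close>.\<close>
  then have "y \<notin> C" using y(1) CU L X by (auto simp: O'_def)
  moreover have "closure L \<subseteq> C" using CU by (simp add: closure_minimal)
  ultimately have "y \<in> O' \<inter> - closure L" using y by blast
  moreover have "open (O' \<inter> - closure L)" using \<open>open O'\<close> by auto
  ultimately have "O' \<inter> - closure L \<inter> Y \<noteq> {}"
    using y(2) open_Int_closure_eq_empty[of "O' \<inter> - closure L" Y] by blast
  then obtain z where z: "z \<in> O'" "z \<notin> closure L" "z \<in> Y" by blast
  have "j < card {L \<in> \<L>. z \<in> closure L}" using Suc.IH z(3) by (simp add: Y_def)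
  moreover have "{L \<in> \<L>. z \<in> closure L} \<subset> {L \<in> \<L>. x \<in> closure L}"
  proof -
    have "L \<in> {L \<in> \<L>. x \<in> closure L}" using L closure_subset by auto
    moreover have "{L \<in> \<L>. z \<in> closure L} \<subseteq> {L \<in> \<L>. x \<in> closure L}" using z(1) by (auto simp: O'_def)
    ultimately show ?thesis using z(2) by blast
  qed
  then have "card {L \<in> \<L>. z \<in> closure L} < card {L \<in> \<L>. x \<in> closure L}"
    using \<L>(1) by (intro psubset_card_mono) auto
  ultimately show ?case by linarith
qed

text \<open>The given pieces need not satisfy \<open>P\<close>; only their number matters, as a
  bound for the number of residues. The residues themselves, and the layers between them, arise from
  \<open>X\<close> by closures, intersections and differences and hence satisfy
  \<open>P\<close>.\<close>

lemma lc_union_refine: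
  assumes P: "closure_algebra T P" and X: "P X" "lc_union Q X"
  shows "lc_union P X"
proof -
  obtain \<L> where \<L>: "finite \<L>" "\<And>L. L \<in> \<L> \<Longrightarrow> lc L" "X = \<Union>\<L>"
    using X(2) unfolding lc_union_def by metis
  have PD: "\<And>A. P A \<Longrightarrow> P (closure A)" "\<And>A B. P A \<Longrightarrow> P B \<Longrightarrow> P (A \<inter> B) \<and> P (A - B)"
    using P by (auto simp: closure_algebra_def)
  have "P (residue_set Y)" if "P Y" for Y unfolding residue_set_def using PD that by blast
  then have Pj: "P ((residue_set ^^ j) X)" for j by (induction j) (use X(1) in simp_all)
  \<comment> \<open>Backward induction from the empty iterate with index \<open>card \<L>\<close>
    down to \<open>X\<close>, adding one layer at a time.\<close>
  have "lc_union P ((residue_set ^^ (card \<L> - i)) X)" for i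
  proof (induction i)
    case 0
    have "(residue_set ^^ card \<L>) X = {}"
    proof (rule ccontr)
      assume "\<not> ?thesis"
      then obtain x where "x \<in> (residue_set ^^ card \<L>) X" by blast
      then have "card \<L> < card {L \<in> \<L>. x \<in> closure L}"         using residue_rank[of \<L> X x "card \<L>"] \<L> by blast
      then show False using card_mono[OF \<L>(1), of "{L \<in> \<L>. x \<in> closure L}"] by auto
    qed
    then show ?case by (simp add: lc_union_empty)
  next
    case (Suc i)
    show ?case
    proof (cases "i < card \<L>")
      case True
      define Y where "Y = (residue_set ^^ (card \<L> - Suc i)) X"
      have "card \<L> - i = Suc (card \<L> - Suc i)" using True by simp
      then have "lc_union P (residue_set Y)" using Suc by (simp add: Y_def)
      moreover have "P Y" by (simp add: Y_def Pj)
      then have "P (closure Y - closure (closure Y - Y))" using PD by blast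
      then have "lc_union P (closure Y \<inter> - closure (closure Y - Y))"
        by (intro lc_union_lc lc_Int lc_closed lc_open) (auto simp: Diff_eq)
      ultimately have "lc_union P Y" using residue_split[of Y] lc_union_Un by metis
      then show ?thesis by (simp add: Y_def)
    next
      case False
      then show ?thesis using Suc by simp
    qed
  qed
  from this[of "card \<L>"] show ?thesis by simp
qed

lemma closure_algebra_subset: "closure_algebra (pts I) (\<lambda>A. A \<subseteq> pts I)"
  by (auto simp: closure_algebra_def closed_pts closure_minimal subset_iff[of "closure _"] dest: subsetD[OF closure_minimal])

lemma boolean_combination_lc_union:
  assumes "boolean_combination_of_opens (Euclidean_space n) X"
  shows "X \<subseteq> pts {..<n} \<and> lc_union (\<lambda>A. A \<subseteq> pts {..<n}) X"
  using assms
proof induction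
  case (1 U)
  have eq: "Euclidean_space n = top_of_set (pts {..<n})"
    using subtopology_Euclidean_space[of "pts {..<n}" n]
    by (simp add: topspace_Euclidean_space_pts flip: topspace_Euclidean_space_pts)
  have "openin (top_of_set (pts {..<n})) U" using 1 by (simp add: eq)
  then obtain G where G: "open G" "U = pts {..<n} \<inter> G" by (auto simp: openin_open)
  then have "lc U" by (simp add: lc_Int lc_closed lc_open closed_pts)
  then show ?case using G by (auto intro: lc_union_lc)
next
  case (2 A)
  then show ?case
    unfolding topspace_Euclidean_space_pts using lc_union_Diff[OF closure_algebra_subset] by blast
next
  case (3 A B)
  then show ?case using lc_union_Un by blast
next
  case (4 A B)
  then show ?case using lc_union_Int[OF closure_algebra_subset] by blast
qed

section \<open>Decomposition of projections by induction on dimension\<close>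

context no_infinite_discrete
begin

lemma definable_pts: "definable M N (pts {..<N})"
  using definable_dpred[OF dpred_const[of True], of N] by simp

lemma closure_algebra_definable: "closure_algebra (pts {..<N}) (definable M N)"
  unfolding closure_algebra_def
  using definable_closure definable_Int definable_Diff definable_subset closed_pts definable_pts by auto

text \<open>Pairs of distinct points over the same base point form a locally closed set in the
  doubled space: equality of projections is a closed condition and distinctness an open one. Thus
  failure of uniqueness over a base point is accessible to the dichotomy.\<close>

lemma proj_lc_double_points:
  assumes "I \<subseteq> {..<N}" "definable M N F" "lc F"
  shows "proj_lc N {p. \<exists>y\<in>F. \<exists>z\<in>F. pr I y = p \<and> pr I z = p \<and> y \<noteq> z}"
proof -
  define f where "f = pr {..<N}"
  define g where "g u = pr {..<N} (\<lambda>i. u (i + N))" for u :: point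
  define L where "L = {u \<in> pts {..<2 * N}. f u \<in> F \<and> g u \<in> F \<and> pr I (f u) = pr I (g u) \<and> f u \<noteq> g u}"
  have fp: "f u \<in> pts {..<N}" "g u \<in> pts {..<N}" "pr I (f u) \<in> pts {..<N}" "pr I (g u) \<in> pts {..<N}" for u
    using assms(1) by (auto simp: f_def g_def pr_def pts_def)
  have dt: "dterm (\<lambda>u. f u k)" "dterm (\<lambda>u. g u k)" "dterm (\<lambda>u. pr I (f u) k)" "dterm (\<lambda>u. pr I (g u) k)" for k
    unfolding f_def g_def by (intro dterm_pr dterm_var)+
  have cont: "continuous_on UNIV f" "continuous_on UNIV g"
    "continuous_on UNIV (\<lambda>u. pr I (f u))" "continuous_on UNIV (\<lambda>u. pr I (g u))"
    unfolding f_def g_def by (intro continuous_on_pr continuous_on_reindex continuous_on_id continuous_on_pr_id)+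
  have "definable M (2 * N) L"
    unfolding L_def
    by (intro definable_dpred dpred_conj dpred_not dpred_in[OF assms(2)] dpred_vec_eq[of _ N] fp dt)
  moreover have "lc L"
  proof -
    have "L = pts {..<2 * N} \<inter> (f -` F \<inter> (g -` F \<inter> ({u. pr I (f u) = pr I (g u)} \<inter> {u. f u \<noteq> g u})))"
      by (auto simp: L_def)
    moreover have "closed {u. pr I (f u) = pr I (g u)}" by (intro closed_Collect_eq cont)
    moreover have "open {u. f u \<noteq> g u}" by (intro open_Collect_neq cont)
    moreover have "lc (f -` F)" "lc (g -` F)" using lc_vimage[OF _ assms(3)] cont by auto
    ultimately show ?thesis by (simp add: lc_Int lc_closed lc_open closed_pts)
  qed
  moreover have "pr I ` L = {p. \<exists>y\<in>F. \<exists>z\<in>F. pr I y = p \<and> pr I z = p \<and> y \<noteq> z}"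
  proof -
    have pr_f: "pr I (f u) = pr I u" for u using assms(1) by (auto simp: f_def pr_def fun_eq_iff)
    have "p \<in> pr I ` L" if "y \<in> F" "z \<in> F" "pr I y = p" "pr I z = p" "y \<noteq> z" for p y z
    proof -
      define u where "u = (\<lambda>i. if i < N then y i else if i < 2 * N then z (i - N) else 0)"
      have "y \<in> pts {..<N}" "z \<in> pts {..<N}" using that definable_subset[OF assms(2)] by auto
      then have "f u = y" "g u = z" by (auto simp: f_def g_def u_def pr_def pts_def fun_eq_iff)
      moreover have "u \<in> pts {..<2 * N}" by (auto simp: u_def pts_def)
      ultimately have "u \<in> L" "pr I u = p" using that pr_f[of u] by (auto simp: L_def)
      then show ?thesis by blast
    qed
    moreover have "\<exists>y\<in>F. \<exists>z\<in>F. pr I y = p \<and> pr I z = p \<and> y \<noteq> z" if "p \<in> pr I ` L" for p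
    proof -
      from that obtain u where u: "u \<in> L" "p = pr I u" by blast
      then have "f u \<in> F" "g u \<in> F" "pr I (f u) = p" "pr I (g u) = p" "f u \<noteq> g u"
        using pr_f[of u] by (simp_all add: L_def)
      then show ?thesis by blast
    qed
    ultimately show ?thesis by blast
  qed
  ultimately show ?thesis unfolding proj_lc_def using assms(1) by blast
qed

text \<open>Over part of the base, \<open>F\<close> has exactly one point in a fixed ball, and it
  lies in \<open>Z\<close>. Infinite fibres over an open set would give \<open>F\<close> a
  projection with interior in one more coordinate, which \<open>no_int\<close> forbids. In a finite
  fibre a rational ball isolates the point of \<open>Z\<close>, and Baire category selects one ball
  that works on a dense subset of an open set; the dichotomy turns density into validity throughout
  a smaller open set.\<close>

lemma sheet:
  assumes F: "definable M N F" "lc F" and Z: "definable M N Z" "lc Z" "Z \<subseteq> F" and I: "I \<subseteq> {..<N}"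
    and no_int: "\<And>I' V. I' \<subseteq> {..<N} \<Longrightarrow> card I < card I' \<Longrightarrow> nonempty_open I' V \<Longrightarrow> \<not> V \<subseteq> pr I' ` F"
    and V0: "nonempty_open I V0" "V0 \<subseteq> pr I ` Z"
  obtains V c r where "nonempty_open I V"
    "\<And>p. p \<in> V \<Longrightarrow> \<exists>z\<in>Z. pr I z = p \<and> dist1 N c z < r \<and> (\<forall>y\<in>F. pr I y = p \<longrightarrow> dist1 N c y < r \<longrightarrow> y = z)"
proof -
  have finI: "finite I" using I finite_subset by blast
  have FN: "F \<subseteq> pts {..<N}" by (rule definable_subset[OF F(1)])
  have ptsI: "pts I \<subseteq> pts {..<N}" by (rule pts_mono[OF I])
  have sF: "proj_lc N F" and sZ: "proj_lc N Z" using F Z by (auto intro: proj_lc_lc)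
  obtain K :: "nat \<Rightarrow> point set" where K: "\<And>k. compact (K k)" "F = (\<Union>k. K k)"
    by (rule proj_lc_compacts[OF sF]) blast
  define \<P> where "\<P> = {(c, d). c \<in> \<rat> \<and> d \<in> \<rat> \<and> c < (d::real)}"
  define T where "T c r = {p. \<exists>z\<in>Z. pr I z = p \<and> dist1 N c z < r \<and>
    (\<forall>y\<in>F. pr I y = p \<longrightarrow> dist1 N c y < r \<longrightarrow> y = z)}" for c r
  define \<G> where "\<G> = (\<lambda>(j, k, c, d). fibre (K k) I j c d) ` (({..<N} - I) \<times> UNIV \<times> \<P>) \<union>
    (\<lambda>(c, r). closure (T c r)) ` (rational_pts N \<times> \<rat>)"
  have "countable \<P>"
    by (rule countable_subset[of _ "\<rat> \<times> \<rat>"]; auto simp: \<P>_def countable_rat)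
  then have "countable \<G>"
    unfolding \<G>_def
    by (intro countable_Un countable_image countable_SIGMA countable_rational_pts countable_rat) auto
  moreover have "closed G" if "G \<in> \<G>" for G
    using that K(1) by (auto simp: \<G>_def closed_fibre)
  moreover have "V0 \<subseteq> \<Union>\<G>"
  proof
    fix p assume p: "p \<in> V0"
    then have pI: "p \<in> pts I" using nonempty_open_subset[OF V0(1)] by blast
    obtain z where z: "z \<in> Z" "pr I z = p" using p V0(2) by blast
    define S where "S = {y \<in> F. pr I y = p}"
    show "p \<in> \<Union>\<G>"
    proof (cases "finite S")
      case False
      have "S \<subseteq> pts {..<N}" using FN by (auto simp: S_def)
      then obtain j where j: "j < N" "infinite ((\<lambda>y. y j) ` S)"
        using finite_if_finite_coords[of S N] False by blast
      have "j \<notin> I"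
      proof
        assume "j \<in> I"
        have "y j = p j" if "y \<in> S" for y
        proof -
          have "pr I y j = p j" using that by (simp add: S_def)
          then show ?thesis using \<open>j \<in> I\<close> by (simp add: pr_def)
        qed
        then have "(\<lambda>y. y j) ` S \<subseteq> {p j}" by blast
        then show False using j(2) finite_subset by blast
      qed
      obtain k c d where *: "c \<in> \<rat>" "d \<in> \<rat>" "c < d" "p \<in> fibre (K k) I j c d"
        by (rule fiber_interval[OF sF K pI I j(2)[unfolded S_def]]) blast
      have "fibre (K k) I j c d \<in> \<G>"
        unfolding \<G>_def \<P>_def using * j(1) \<open>j \<notin> I\<close> by (intro UnI1 image_eqI[of _ _ "(j, k, c, d)"]) auto
      then show ?thesis using *(4) by blast
    next
      case True
      define \<delta> where "\<delta> = Min (insert 1 (dist1 N z ` (S - {z})))"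
      have fin: "finite (insert 1 (dist1 N z ` (S - {z})))" using True by simp
      have zN: "z \<in> pts {..<N}" using z Z(3) FN by blast
      have "0 < dist1 N z y" if "y \<in> S - {z}" for y
      proof (rule ccontr)
        assume "\<not> 0 < dist1 N z y"
        moreover have "y \<in> pts {..<N}" using that FN by (auto simp: S_def)
        ultimately have "z = y" using dist1_eq_0D[OF zN] by simp
        then show False using that by simp
      qed
      then have "\<delta> > 0" unfolding \<delta>_def using fin by (subst Min_gr_iff) auto
      obtain c r where cr: "c \<in> rational_pts N" "r \<in> \<rat>" "dist1 N c z < r"
        "\<And>y. dist1 N c y < r \<Longrightarrow> dist1 N z y < \<delta>"
        by (rule rational_ball[OF zN \<open>\<delta> > 0\<close>]) blast
      have "y = z" if "y \<in> F" "pr I y = p" "dist1 N c y < r" for y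
      proof (rule ccontr)
        assume "y \<noteq> z"
        then have "\<delta> \<le> dist1 N z y" unfolding \<delta>_def using fin that by (intro Min_le) (auto simp: S_def)
        then show False using cr(4)[OF that(3)] by simp
      qed
      then have "p \<in> T c r" unfolding T_def using z cr(3) by blast
      then have "p \<in> closure (T c r)" using closure_subset by blast
      moreover have "closure (T c r) \<in> \<G>"
        unfolding \<G>_def using cr(1,2) by (intro UnI2 image_eqI[of _ _ "(c, r)"]) auto
      ultimately show ?thesis by blast
    qed
  qed
  ultimately obtain G V1 where G: "G \<in> \<G>" "nonempty_open I V1" "V1 \<subseteq> V0" "V1 \<subseteq> G"
    by (rule baire_nonempty_open[OF V0(1)]) blast
  consider j k c d where "j < N" "j \<notin> I" "c < d" "G = fibre (K k) I j c d" | c r where "G = closure (T c r)"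
    using G(1) by (auto simp: \<G>_def \<P>_def)
  then show ?thesis
  proof cases
    case 1
    let ?W = "{y \<in> pts (insert j I). pr I y \<in> V1 \<and> c < y j \<and> y j < d}"
    have "?W \<subseteq> pr (insert j I) ` F"
    proof
      fix y assume "y \<in> ?W"
      then have "y \<in> pr (insert j I) ` K k"
        using fibre_slab[of "pr I y" "K k" I j c d y] G(4) 1(4) by auto
      then show "y \<in> pr (insert j I) ` F" using K(2) by blast
    qed
    moreover have "nonempty_open (insert j I) ?W" by (rule nonempty_open_slab[OF G(2) 1(3,2)])
    moreover have "insert j I \<subseteq> {..<N}" "card I < card (insert j I)" using I 1 finI by auto
    ultimately show ?thesis using no_int by blast
  next
    case 2
    define Q where "Q = {y \<in> pts {..<N}. dist1 N c y < r}"
    have Q: "definable M N Q" "lc Q" unfolding Q_def by (rule definable_ball lc_ball)+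
    have T_pts: "T c r \<subseteq> pts I" by (auto simp: T_def)
    have meets: "V \<inter> T c r \<noteq> {}" if "nonempty_open I V" "V \<subseteq> V1" for V
      using nonempty_open_meets_closure[OF that(1) _ T_pts] that(2) G(4) 2 by blast
    \<comment> \<open>\<open>T c r\<close> is the difference of these sets: existence of a point of
      \<open>Z\<close> in the ball, and failure of uniqueness in \<open>F\<close>. Both are
      projections of locally closed sets. As \<open>T c r\<close> meets every open part of
      \<open>V1\<close>, the dichotomy must decide for \<open>P1\<close> and against
      \<open>P2\<close>.\<close>
    define P1 where "P1 = pr I ` (Z \<inter> Q)"
    define P2 where "P2 = {p. \<exists>y\<in>F \<inter> Q. \<exists>z\<in>F \<inter> Q. pr I y = p \<and> pr I z = p \<and> y \<noteq> z}"
    have P: "proj_lc N P1" "P1 \<subseteq> pts I" "proj_lc N P2" "P2 \<subseteq> pts I"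
    proof -
      show "proj_lc N P1" unfolding P1_def by (intro proj_lc_pr proj_lc_Int sZ Q)
      show "proj_lc N P2" unfolding P2_def by (intro proj_lc_double_points I definable_Int F Q lc_Int)
    qed (auto simp: P1_def P2_def)
    have "T c r \<subseteq> P1"
    proof
      fix p assume "p \<in> T c r"
      then obtain z where "z \<in> Z" "pr I z = p" "dist1 N c z < r" by (auto simp: T_def)
      moreover have "z \<in> pts {..<N}" using \<open>z \<in> Z\<close> Z(3) FN by blast
      ultimately show "p \<in> P1" by (auto simp: P1_def Q_def)
    qed
    obtain V2 where V2: "nonempty_open I V2" "V2 \<subseteq> V1" "V2 \<subseteq> P1 \<or> V2 \<inter> P1 = {}"
      using proj_lc_dichotomy[OF finI I P(1,2) G(2)] by blast
    then have "V2 \<subseteq> P1" using meets[of V2] \<open>T c r \<subseteq> P1\<close> by blast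
    have "T c r \<inter> P2 = {}"
    proof -
      have False if "p \<in> T c r" "p \<in> P2" for p
      proof -
        from that(1) obtain z where z: "\<forall>y\<in>F. pr I y = p \<longrightarrow> dist1 N c y < r \<longrightarrow> y = z"
          unfolding T_def by blast
        from that(2) obtain y y' where y: "y \<in> F" "y' \<in> F" "dist1 N c y < r" "dist1 N c y' < r" "pr I y = p"
          "pr I y' = p" "y \<noteq> y'" unfolding P2_def Q_def by blast
        have "y = z" using z y(1,3,5) by blast
        moreover have "y' = z" using z y(2,4,6) by blast
        ultimately have "y = y'" by simp
        then show False using y(7) by simp
      qed
      then show ?thesis by blast
    qed
    obtain V3 where V3: "nonempty_open I V3" "V3 \<subseteq> V2" "V3 \<subseteq> P2 \<or> V3 \<inter> P2 = {}"
      using proj_lc_dichotomy[OF finI I P(3,4) V2(1)] by blast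
    then have disj: "V3 \<inter> P2 = {}" using meets[of V3] V2(2) \<open>T c r \<inter> P2 = {}\<close> by blast
    show ?thesis
    proof (rule that[OF V3(1)])
      fix p assume p: "p \<in> V3"
      then have "p \<in> P1" using V3(2) \<open>V2 \<subseteq> P1\<close> by blast
      then obtain z where z: "z \<in> Z" "z \<in> Q" "pr I z = p" by (auto simp: P1_def)
      have "y = z" if "y \<in> F" "pr I y = p" "dist1 N c y < r" for y
      proof (rule ccontr)
        assume "y \<noteq> z"
        moreover have "y \<in> F \<inter> Q" "z \<in> F \<inter> Q" using that z Z(3) FN by (auto simp: Q_def)
        ultimately have "p \<in> P2" unfolding P2_def using that(2) z(3) by blast
        then show False using disj p by blast
      qed
      then show "\<exists>z\<in>Z. pr I z = p \<and> dist1 N c z < r \<and> (\<forall>y\<in>F. pr I y = p \<longrightarrow> dist1 N c y < r \<longrightarrow> y = z)"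
        using z by (auto simp: Q_def)
    qed
  qed
qed

text \<open>The relative boundary \<open>Z\<close> of \<open>A\<close> in \<open>F\<close> has smaller dimension than \<open>F\<close>, where dimension
  is measured by coordinate projections with interior.\<close>

lemma proj_lc_lc_union_on:
  assumes "definable M N F" "closed F"
    "\<And>I V. I \<subseteq> {..<N} \<Longrightarrow> d \<le> card I \<Longrightarrow> nonempty_open I V \<Longrightarrow> \<not> V \<subseteq> pr I ` F"
    and A: "proj_lc N A"
  shows "lc_union (definable M N) (A \<inter> F)"
  using assms(1-3)
proof (induction d arbitrary: F)
  case 0
  \<comment> \<open>Dimension below 0: even the projection to a point has no interior, so
    \<open>F\<close> is empty.\<close>
  have "nonempty_open {} (pts {})" by (auto simp: nonempty_open_def pts_def)
  then have "\<not> pts {} \<subseteq> pr {} ` F" using 0(3)[of "{}"] by simp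
  moreover have "pts {} = {\<lambda>_. 0}" "pr {} = (\<lambda>_ _. 0)" by (auto simp: pts_def pr_def)
  ultimately have "F = {}" by auto
  then show ?case by (simp add: lc_union_empty)
next
  case (Suc d)
  define Z where "Z = closure (A \<inter> F) \<inter> closure (F - A)"
  have dA: "definable M N A" by (rule proj_lc_definable[OF A])
  have Z: "definable M N Z" "closed Z" unfolding Z_def
    by (intro definable_Int definable_closure definable_Diff dA Suc.prems(1) closed_Int closed_closure)+
  have ZF: "Z \<subseteq> F"
    unfolding Z_def using Suc.prems(2) closure_minimal[of "F - A" F] by blast
  have "lc_union (definable M N) (A \<inter> Z)"
  proof (rule Suc.IH[OF Z])
    fix I V assume I: "I \<subseteq> {..<N}" "d \<le> card I" and V: "nonempty_open I V"
    show "\<not> V \<subseteq> pr I ` Z"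
    proof
      assume VZ: "V \<subseteq> pr I ` Z"
      have finI: "finite I" using I(1) finite_subset by blast
      have "\<not> Suc d \<le> card I" using Suc.prems(3)[OF I(1) _ V] VZ ZF by blast
      then have "card I = d" using I(2) by simp
      then have no_int: "\<And>I' V. I' \<subseteq> {..<N} \<Longrightarrow> card I < card I' \<Longrightarrow> nonempty_open I' V \<Longrightarrow> \<not> V \<subseteq> pr I' ` F"
        using Suc.prems(3) by simp
      obtain V1 c r where V1: "nonempty_open I V1"
        and sh: "\<And>p. p \<in> V1 \<Longrightarrow> \<exists>z\<in>Z. pr I z = p \<and> dist1 N c z < r \<and>
          (\<forall>y\<in>F. pr I y = p \<longrightarrow> dist1 N c y < r \<longrightarrow> y = z)"
        by (rule sheet[OF Suc.prems(1) lc_closed[OF Suc.prems(2)] Z(1) lc_closed[OF Z(2)] ZF I(1)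
              no_int V VZ]) blast+
      define Q where "Q = {y \<in> pts {..<N}. dist1 N c y < r}"
      have FN: "F \<subseteq> pts {..<N}" by (rule definable_subset[OF Suc.prems(1)])
      define A' where "A' = pr I ` (A \<inter> F \<inter> Q)"
      have "proj_lc N A'"
        unfolding A'_def Q_def
        by (intro proj_lc_pr proj_lc_Int A Suc.prems lc_closed definable_ball lc_ball)
      moreover have "A' \<subseteq> pts I" by (auto simp: A'_def)
      ultimately obtain V2 where V2: "nonempty_open I V2" "V2 \<subseteq> V1" "V2 \<subseteq> A' \<or> V2 \<inter> A' = {}"
        using proj_lc_dichotomy[OF finI I(1) _ _ V1] by blast
      obtain G where G: "open G" "V2 = pts I \<inter> G" "V2 \<noteq> {}" using V2(1) by (auto simp: nonempty_open_def)
      obtain p where p: "p \<in> V2" using G by blast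
      then obtain z where z: "z \<in> Z" "pr I z = p" "dist1 N c z < r" using sh V2(2) by blast
      \<comment> \<open>Inside \<open>B\<close> a point of \<open>F\<close> is determined by its
        projection, and over \<open>V2\<close> these points are either all in \<open>A\<close> or
        all outside \<open>A\<close>. But \<open>z\<close> is a limit both of
        \<open>A \<inter> F\<close> and of \<open>F - A\<close>, so either case is
        contradictory.\<close>
      define B where "B = pr I -` G \<inter> {y. dist1 N c y < r}"
      have "open B" unfolding B_def by (intro open_Int open_vimage G open_dist1_ball continuous_on_pr_id)
      have zB: "z \<in> B" using z p G by (auto simp: B_def)
      have B: "pr I y \<in> V2" "dist1 N c y < r" if "y \<in> B" for y using that G by (auto simp: B_def)
      show False
      proof (cases "V2 \<subseteq> A'")
        case True
        have "B \<inter> (F - A) \<noteq> {}"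
          using z(1) zB open_Int_closure_eq_empty[OF \<open>open B\<close>, of "F - A"] by (auto simp: Z_def)
        then obtain y where y: "y \<in> B" "y \<in> F" "y \<notin> A" by blast
        then have "pr I y \<in> A'" using B True by blast
        then obtain a where a: "a \<in> A" "a \<in> F" "dist1 N c a < r" "pr I a = pr I y"
          by (auto simp: A'_def Q_def)
        have "pr I y \<in> V1" using B(1)[OF y(1)] V2(2) by blast
        then obtain z' where "\<forall>w\<in>F. pr I w = pr I y \<longrightarrow> dist1 N c w < r \<longrightarrow> w = z'"
          using sh[of "pr I y"] by blast
        then have "a = z'" "y = z'" using a y B(2)[OF y(1)] by blast+
        then have "a = y" by simp
        then show False using a y by blast
      next
        case False
        then have disj: "V2 \<inter> A' = {}" using V2(3) by blast
        have "B \<inter> (A \<inter> F) \<noteq> {}"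
          using z(1) zB open_Int_closure_eq_empty[OF \<open>open B\<close>, of "A \<inter> F"] by (auto simp: Z_def)
        then obtain y where y: "y \<in> B" "y \<in> A" "y \<in> F" by blast
        then have "pr I y \<in> A'" using B FN by (auto simp: A'_def Q_def)
        then show False using disj B(1)[OF y(1)] by blast
      qed
    qed
  qed
  \<comment> \<open>Outside \<open>Z\<close>, a point of \<open>A \<inter> F\<close> is interior to
    \<open>A\<close> relative to \<open>F\<close>; this interior is a single locally closed
    piece.\<close>
  moreover have "lc_union (definable M N) (F - closure (F - A))"
  proof (rule lc_union_lc)
    show "definable M N (F - closure (F - A))" by (intro definable_Diff definable_closure Suc.prems(1) dA)
    show "lc (F - closure (F - A))"
      unfolding Diff_eq[of F "closure _"] by (intro lc_Int lc_closed lc_open Suc.prems(2) open_Compl closed_closure)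
  qed
  ultimately have "lc_union (definable M N) (A \<inter> Z \<union> (F - closure (F - A)))" by (rule lc_union_Un)
  moreover have "A \<inter> Z \<union> (F - closure (F - A)) = A \<inter> F"
    using ZF closure_subset[of "F - A"] closure_subset[of "A \<inter> F"] by (auto simp: Z_def)
  ultimately show ?case by simp
qed

theorem proj_lc_lc_union:
  assumes "proj_lc N A"
  shows "lc_union (definable M N) A"
proof -
  \<comment> \<open>The induction starts with \<open>d = Suc N\<close>, where the dimension
    hypothesis is vacuous since no subset of \<open>{..<N}\<close> has that many elements.\<close>
  have "lc_union (definable M N) (A \<inter> pts {..<N})"
  proof (rule proj_lc_lc_union_on[where d = "Suc N", OF definable_pts closed_pts _ assms])
    fix I V
    assume "I \<subseteq> {..<N}" "Suc N \<le> card I"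
    then show "\<not> V \<subseteq> pr I ` pts {..<N}" using card_mono[of "{..<N}" I] by simp
  qed
  then show ?thesis using proj_lc_subset[OF assms] by (simp add: Int_absorb2)
qed

end

section \<open>O-minimality\<close>

fun vars_tm :: "tm \<Rightarrow> nat set" where
  "vars_tm (Var i) = {i}"
| "vars_tm (App n f ts) = (\<Union>t \<in> set ts. vars_tm t)"

text \<open>Bound variables are included, so that a formula and all its subformulas are interpreted
  in one space \<open>pts {..<N}\<close>.\<close>

fun vars_fm :: "fm \<Rightarrow> nat set" where
  "vars_fm (Eq s t) = vars_tm s \<union> vars_tm t"
| "vars_fm (Rel n X ts) = (\<Union>t \<in> set ts. vars_tm t)"
| "vars_fm (Neg \<phi>) = vars_fm \<phi>"
| "vars_fm (Conj \<phi> \<psi>) = vars_fm \<phi> \<union> vars_fm \<psi>"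
| "vars_fm (Ex i \<phi>) = insert i (vars_fm \<phi>)"

lemma finite_vars_tm: "finite (vars_tm t)"
  by (induction t) auto

lemma finite_vars_fm: "finite (vars_fm \<phi>)"
  by (induction \<phi>) (auto simp: finite_vars_tm)

lemma eval_tm_cong: "(\<And>i. i \<in> vars_tm t \<Longrightarrow> e i = e' i) \<Longrightarrow> eval_tm e t = eval_tm e' t"
proof (induction t)
  case (App n f ts)
  then have "map (eval_tm e) ts = map (eval_tm e') ts" by (intro map_cong) auto
  then show ?case by (simp only: eval_tm.simps)
qed simp

lemma sat_cong: "(\<And>i. i \<in> vars_fm \<phi> \<Longrightarrow> e i = e' i) \<Longrightarrow> sat e \<phi> = sat e' \<phi>"
proof (induction \<phi> arbitrary: e e')
  case (Eq s t)
  then have "eval_tm e s = eval_tm e' s" "eval_tm e t = eval_tm e' t" by (intro eval_tm_cong; simp)+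
  then show ?case by simp
next
  case (Rel n X ts)
  then have "map (eval_tm e) ts = map (eval_tm e') ts" by (intro map_cong eval_tm_cong) auto
  then show ?case by (simp only: sat.simps)
next
  case (Neg \<phi>)
  then have "sat e \<phi> = sat e' \<phi>" by (intro Neg.IH) simp
  then show ?case by simp
next
  case (Conj \<phi> \<psi>)
  have "sat e \<phi> = sat e' \<phi>" "sat e \<psi> = sat e' \<psi>" by (rule Conj.IH; use Conj.prems in simp)+
  then show ?case by simp
next
  case (Ex i \<phi>)
  have "sat (e(i := r)) \<phi> = sat (e'(i := r)) \<phi>" for r
    by (rule Ex.IH) (use Ex.prems in simp)
  then show ?case by simp
qed

locale constructible_structure = no_infinite_discrete +
  assumes Funs_eq: "Funs M = {(2, \<lambda>x. x 0 + x 1)}"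
    and Rels_lc_union: "(n, X) \<in> Rels M \<Longrightarrow> lc_union (definable M n) X"
begin

lemma wf_tm_definable_continuous:
  "wf_tm M t \<Longrightarrow> dterm (\<lambda>e. eval_tm e t) \<and> continuous_on UNIV (\<lambda>e. eval_tm e t)"
proof (induction t)
  case (Var i)
  then show ?case by (simp add: dterm_var continuous_on_coord_id)
next
  case (App n f ts)
  then have f: "n = 2" "f = (\<lambda>x. x 0 + x 1)" and "length ts = 2" by (auto simp: Funs_eq)
  then obtain s t where ts: "ts = [s, t]" by (auto simp: length_Suc_conv numeral_2_eq_2)
  have s: "dterm (\<lambda>e. eval_tm e s)" "continuous_on UNIV (\<lambda>e. eval_tm e s)"
    and t: "dterm (\<lambda>e. eval_tm e t)" "continuous_on UNIV (\<lambda>e. eval_tm e t)"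
    using App by (simp_all add: ts)
  have "eval_tm e (App n f ts) = eval_tm e s + eval_tm e t" for e
    by (simp add: f ts point_of_def)
  then show ?case using s t by (simp add: dterm_plus continuous_on_add)
qed

lemma lc_union_vimage:
  assumes "\<And>e. g e \<in> pts {..<n}" "\<And>k. dterm (\<lambda>e. g e k)" "continuous_on UNIV g" "lc_union (definable M n) X"
  shows "lc_union (definable M N) {x \<in> pts {..<N}. g x \<in> X}"
proof -
  obtain \<L> where \<L>: "finite \<L>" "\<forall>L\<in>\<L>. definable M n L \<and> lc L" "X = \<Union>\<L>"
    using assms(4) unfolding lc_union_def by metis
  have "lc_union (definable M N) {x \<in> pts {..<N}. g x \<in> L}" if L: "definable M n L" "lc L" for L
  proof (rule lc_union_lc)
    show "definable M N {x \<in> pts {..<N}. g x \<in> L}"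
      by (intro definable_dpred dpred_in[OF L(1)] assms)
    have "{x \<in> pts {..<N}. g x \<in> L} = pts {..<N} \<inter> g -` L" by auto
    then show "lc {x \<in> pts {..<N}. g x \<in> L}"
      using lc_vimage[OF assms(3) L(2)] by (simp add: lc_Int lc_closed closed_pts)
  qed
  then have "lc_union (definable M N) (\<Union>L\<in>\<L>. {x \<in> pts {..<N}. g x \<in> L})"
    using \<L> by (intro lc_union_Union) auto
  moreover have "(\<Union>L\<in>\<L>. {x \<in> pts {..<N}. g x \<in> L}) = {x \<in> pts {..<N}. g x \<in> X}"
    unfolding \<L>(3) by blast
  ultimately show ?thesis by simp
qed

lemma lc_union_pr:
  assumes "lc_union (definable M N) A"
  shows "lc_union (definable M N) (pr J ` A)"
proof -
  obtain \<L> where \<L>: "finite \<L>" "\<forall>L\<in>\<L>. definable M N L \<and> lc L" "A = \<Union>\<L>"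
    using assms unfolding lc_union_def by metis
  have "lc_union (definable M N) (\<Union>L\<in>\<L>. pr J ` L)"
    using \<L> by (intro lc_union_Union proj_lc_lc_union proj_lc_pr proj_lc_lc) auto
  moreover have "(\<Union>L\<in>\<L>. pr J ` L) = pr J ` A" unfolding \<L>(3) by blast
  ultimately show ?thesis by simp
qed

lemma lc_union_sat:
  "wf_fm M \<phi> \<Longrightarrow> vars_fm \<phi> \<subseteq> {..<N} \<Longrightarrow> lc_union (definable M N) {x \<in> pts {..<N}. sat x \<phi>}"
proof (induction \<phi>)
  case (Eq s t)
  then have s: "dterm (\<lambda>e. eval_tm e s)" "continuous_on UNIV (\<lambda>e. eval_tm e s)"
    and t: "dterm (\<lambda>e. eval_tm e t)" "continuous_on UNIV (\<lambda>e. eval_tm e t)"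
    using wf_tm_definable_continuous by auto
  have "closed {x. eval_tm x s = eval_tm x t}" by (intro closed_Collect_eq s t)
  moreover have "{x \<in> pts {..<N}. sat x (Eq s t)} = pts {..<N} \<inter> {x. eval_tm x s = eval_tm x t}" by auto
  ultimately have "lc {x \<in> pts {..<N}. sat x (Eq s t)}" by (simp add: lc_Int lc_closed closed_pts)
  moreover have "definable M N {x \<in> pts {..<N}. sat x (Eq s t)}"
    unfolding sat.simps by (intro definable_dpred dpred_eq s t)
  ultimately show ?case by (intro lc_union_lc)
next
  case (Rel n X ts)
  define g where "g e = point_of (map (eval_tm e) ts)" for e
  have len: "length ts = n" using Rel.prems by simp
  have t: "dterm (\<lambda>e. eval_tm e (ts ! k))" "continuous_on UNIV (\<lambda>e. eval_tm e (ts ! k))" if "k < n" for k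
    using wf_tm_definable_continuous[of "ts ! k"] Rel.prems that len by auto
  have g: "g e k = (if k < n then eval_tm e (ts ! k) else 0)" for e k
    using len by (simp add: g_def point_of_def)
  have "lc_union (definable M N) {x \<in> pts {..<N}. g x \<in> X}"
  proof (rule lc_union_vimage)
    show "g e \<in> pts {..<n}" for e by (simp add: pts_def g)
    show "dterm (\<lambda>e. g e k)" for k unfolding g by (cases "k < n") (simp_all add: t dterm_const)
    show "continuous_on UNIV g"
    proof (rule continuous_on_coordinatewise_then_product)
      show "continuous_on UNIV (\<lambda>x. g x k)" for k unfolding g by (cases "k < n") (simp_all add: t)
    qed
    show "lc_union (definable M n) X" using Rels_lc_union Rel.prems by simp
  qed
  then show ?case by (simp add: g_def)
next
  case (Neg \<phi>)
  then have "lc_union (definable M N) (pts {..<N} - {x \<in> pts {..<N}. sat x \<phi>})"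
    by (intro lc_union_Diff[OF closure_algebra_definable]) simp
  moreover have "pts {..<N} - {x \<in> pts {..<N}. sat x \<phi>} = {x \<in> pts {..<N}. sat x (Neg \<phi>)}" by auto
  ultimately show ?case by simp
next
  case (Conj \<phi> \<psi>)
  then have "lc_union (definable M N) ({x \<in> pts {..<N}. sat x \<phi>} \<inter> {x \<in> pts {..<N}. sat x \<psi>})"
    by (intro lc_union_Int[OF closure_algebra_definable]) auto
  moreover have "{x \<in> pts {..<N}. sat x \<phi>} \<inter> {x \<in> pts {..<N}. sat x \<psi>} = {x \<in> pts {..<N}. sat x (Conj \<phi> \<psi>)}"
    by auto
  ultimately show ?case by simp
next
  case (Ex i \<phi>)
  \<comment> \<open>The truth of \<open>Ex i \<phi>\<close> does not depend on coordinate
    \<open>i\<close>. The set is the cylinder over a projection, that is, the preimage under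
    \<open>pr J\<close> of the image under \<open>pr J\<close>.\<close>
  define J where "J = {..<N} - {i}"
  define S where "S = {x \<in> pts {..<N}. sat x \<phi>}"
  have iN: "i < N" using Ex.prems by simp
  have "lc_union (definable M N) (pr J ` S)"
    unfolding S_def using Ex by (intro lc_union_pr) auto
  then have "lc_union (definable M N) {x \<in> pts {..<N}. pr J x \<in> pr J ` S}"
  proof (rule lc_union_vimage[rotated 3])
    show "pr J e \<in> pts {..<N}" for e by (auto simp: J_def pr_def pts_def)
    show "dterm (\<lambda>e. pr J e k)" for k by (intro dterm_pr dterm_var)
    show "continuous_on UNIV (pr J)" by (rule continuous_on_pr_id)
  qed
  moreover have "pr J x \<in> pr J ` S \<longleftrightarrow> sat x (Ex i \<phi>)" if x: "x \<in> pts {..<N}" for x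
  proof
    assume "pr J x \<in> pr J ` S"
    then obtain y where y: "y \<in> S" "pr J x = pr J y" by blast
    have "x(i := y i) = y"
    proof
      fix k
      have "pr J x k = pr J y k" using y(2) by simp
      then show "(x(i := y i)) k = y k"
        using x y(1) by (cases "k = i"; cases "k < N") (auto simp: pr_def J_def S_def pts_def)
    qed
    then show "sat x (Ex i \<phi>)" using y(1) by (auto simp: S_def intro!: exI[of _ "y i"])
  next
    assume "sat x (Ex i \<phi>)"
    then obtain r where r: "sat (x(i := r)) \<phi>" by auto
    have "x(i := r) \<in> S" using r x iN by (auto simp: S_def pts_def)
    moreover have "pr J x = pr J (x(i := r))" by (auto simp: pr_def J_def fun_eq_iff)
    ultimately show "pr J x \<in> pr J ` S" by blast
  qed
  then have "{x \<in> pts {..<N}. pr J x \<in> pr J ` S} = {x \<in> pts {..<N}. sat x (Ex i \<phi>)}" by blast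
  ultimately show ?case by simp
qed

text \<open>Parameters are treated as extra coordinates: they are fixed by the closed set
  \<open>C\<close> and then projected away. The ambient dimension \<open>N\<close> has to
  accommodate all variables of the formula, bound ones included.\<close>

lemma definable_lc_union:
  assumes "definable M n E"
  obtains N where "lc_union (definable M N) E"
proof -
  obtain \<phi> a where \<phi>: "wf_fm M \<phi>" "E = {x \<in> pts {..<n}. sat (\<lambda>i. if i < n then x i else a i) \<phi>}"
    using assms unfolding definable_def topspace_Euclidean_space_pts by blast
  obtain m where m: "\<And>i. i \<in> vars_fm \<phi> \<Longrightarrow> i < m"
    using finite_nat_set_iff_bounded[of "vars_fm \<phi>"] finite_vars_fm by blast
  define N where "N = max n m"
  define S where "S = {x \<in> pts {..<N}. sat x \<phi>}"
  define C where "C = {x \<in> pts {..<N}. \<forall>i\<in>{n..<N}. x i = a i}"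
  have S: "lc_union (definable M N) S"
    unfolding S_def by (rule lc_union_sat[OF \<phi>(1)]) (use m in \<open>force simp: N_def\<close>)
  have "lc_union (definable M N) C"
  proof (rule lc_union_lc)
    show "definable M N C"
      unfolding C_def by (intro definable_dpred dpred_finite_all dpred_eq dterm_var dterm_const) simp
    have "C = pts {..<N} \<inter> (\<Inter>i\<in>{n..<N}. {x. x i = a i})" by (auto simp: C_def)
    moreover have "closed (\<Inter>i\<in>{n..<N}. {x::point. x i = a i})"
      by (intro closed_INT ballI closed_Collect_eq continuous_on_coord_id continuous_on_const)
    ultimately show "lc C" by (simp add: lc_Int lc_closed closed_pts)
  qed
  then have "lc_union (definable M N) (pr {..<n} ` (S \<inter> C))"
    by (intro lc_union_pr lc_union_Int[OF closure_algebra_definable] S)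
  moreover have "pr {..<n} ` (S \<inter> C) = E"
  proof (intro equalityI subsetI)
    fix x assume "x \<in> pr {..<n} ` (S \<inter> C)"
    then obtain y where y: "y \<in> S" "y \<in> C" "x = pr {..<n} y" by blast
    have "sat y \<phi>" using y(1) by (simp add: S_def)
    moreover have "sat (\<lambda>i. if i < n then x i else a i) \<phi> = sat y \<phi>"
    proof (rule sat_cong)
      fix i assume "i \<in> vars_fm \<phi>"
      then have "i < N" using m by (force simp: N_def)
      then show "(if i < n then x i else a i) = y i" using y by (auto simp: pr_def C_def)
    qed
    ultimately have "sat (\<lambda>i. if i < n then x i else a i) \<phi>" by simp
    moreover have "x \<in> pts {..<n}" using y(3) by simp
    ultimately show "x \<in> E" unfolding \<phi>(2) by blast
  next
    fix x assume x: "x \<in> E"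
    define y where "y = (\<lambda>i. if i < n then x i else if i < N then a i else 0)"
    have "sat y \<phi> = sat (\<lambda>i. if i < n then x i else a i) \<phi>"
    proof (rule sat_cong)
      fix i assume "i \<in> vars_fm \<phi>"
      then have "i < N" using m by (force simp: N_def)
      then show "y i = (if i < n then x i else a i)" by (simp add: y_def)
    qed
    then have "y \<in> S \<inter> C" using x by (auto simp: S_def C_def y_def pts_def \<phi>(2) N_def)
    moreover have "x = pr {..<n} y" using x by (auto simp: pr_def y_def \<phi>(2) pts_def fun_eq_iff)
    ultimately show "x \<in> pr {..<n} ` (S \<inter> C)" by blast
  qed
  ultimately show ?thesis using that by simp
qed

lemma definable_infinite_imp_interval:
  assumes "definable M n E" "infinite ((\<lambda>x. x j) ` E)"
  obtains a b where "a < b" "{a<..<b} \<subseteq> (\<lambda>x. x j) ` E"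
proof -
  obtain N where "lc_union (definable M N) E" by (rule definable_lc_union[OF assms(1)])
  then obtain \<L> where \<L>: "finite \<L>" "\<forall>L\<in>\<L>. definable M N L \<and> lc L" "E = \<Union>\<L>"
    unfolding lc_union_def by metis
  have "\<exists>L\<in>\<L>. infinite ((\<lambda>x. x j) ` L)"
  proof (rule ccontr)
    assume "\<not> ?thesis"
    then have "finite (\<Union>L\<in>\<L>. (\<lambda>x. x j) ` L)" using \<L>(1) by blast
    moreover have "(\<Union>L\<in>\<L>. (\<lambda>x. x j) ` L) = (\<lambda>x. x j) ` E" unfolding \<L>(3) by blast
    ultimately show False using assms(2) by simp
  qed
  then obtain L where L: "L \<in> \<L>" "infinite ((\<lambda>x. x j) ` L)" by blast
  then obtain a b where "a < b" "{a<..<b} \<subseteq> (\<lambda>x. x j) ` L"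
    using infinite_coordinate_imp_interval \<L>(2) by blast
  moreover have "(\<lambda>x. x j) ` L \<subseteq> (\<lambda>x. x j) ` E" using L(1) \<L>(3) by blast
  ultimately show ?thesis using that by blast
qed

text \<open>An infinite boundary \<open>B\<close> of \<open>S\<close> would contain an interval, in
  which \<open>S\<close> is both dense and codense. A finite trace of \<open>S\<close> there is not
  dense, and an infinite one contains an interval, so is not codense. Hence \<open>B\<close> is
  finite, and by connectedness an interval that avoids \<open>B\<close> and meets \<open>S\<close>
  lies in \<open>S\<close>.\<close>

theorem o_minimal_structure: "o_minimal M"
  unfolding o_minimal_def
proof (intro allI impI)
  fix E assume E: "definable M 1 E"
  have E_pts: "E \<subseteq> pts {..<1}" by (rule definable_subset[OF E])
  define S where "S = (\<lambda>x. x 0) ` E"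
  define v where "v t = (\<lambda>i::nat. if i = 0 then t else 0::real)" for t
  have S_iff: "t \<in> S \<longleftrightarrow> v t \<in> E" for t
  proof
    assume "t \<in> S"
    then obtain x where x: "x \<in> E" "t = x 0" by (auto simp: S_def)
    then have "x = v t" using E_pts by (auto simp: v_def pts_def fun_eq_iff)
    then show "v t \<in> E" using x by simp
  next
    assume "v t \<in> E"
    then show "t \<in> S" unfolding S_def by (rule image_eqI[rotated]) (simp add: v_def)
  qed
  have dS: "dpred M (\<lambda>e. t e \<in> S)" if "dterm t" for t
    unfolding S_iff
    by (rule dpred_in[OF E]) (auto simp: v_def pts_def intro!: dterm_if that dterm_const)
  have tame: "\<exists>a b. a < b \<and> {a<..<b} \<subseteq> X" if X: "rdefinable X" "infinite X" for X
  proof -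
    have d: "definable M 1 {x \<in> pts {..<1}. x 0 \<in> X}"
      by (intro definable_dpred dpred_rdefinable[OF X(1)] dterm_var)
    have im: "(\<lambda>x. x 0) ` {x \<in> pts {..<1}. x 0 \<in> X} = X"
    proof (intro equalityI subsetI)
      fix t assume "t \<in> X"
      then have "v t \<in> {x \<in> pts {..<1}. x 0 \<in> X}" by (auto simp: v_def pts_def)
      then show "t \<in> (\<lambda>x. x 0) ` {x \<in> pts {..<1}. x 0 \<in> X}"
        by (rule image_eqI[rotated]) (simp add: v_def)
    qed auto
    show ?thesis
    proof (rule definable_infinite_imp_interval[OF d, of 0])
      show "infinite ((\<lambda>x. x 0) ` {x \<in> pts {..<1}. x 0 \<in> X})" unfolding im by (rule X(2))
    qed (unfold im, blast)
  qed
  define B where "B = {t. \<forall>\<epsilon>. 0 < \<epsilon> \<longrightarrow> (\<exists>u. u \<in> S \<and> \<bar>u - t\<bar> < \<epsilon>) \<and> (\<exists>u. u \<notin> S \<and> \<bar>u - t\<bar> < \<epsilon>)}"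
  have not_B: "(\<exists>\<epsilon>>0. \<forall>u. \<bar>u - t\<bar> < \<epsilon> \<longrightarrow> u \<in> S) \<or> (\<exists>\<epsilon>>0. \<forall>u. \<bar>u - t\<bar> < \<epsilon> \<longrightarrow> u \<notin> S)" if "t \<notin> B" for t
    using that unfolding B_def by blast
  have "finite B"
  proof (rule ccontr)
    assume inf: "infinite B"
    have "rdefinable B"
      unfolding rdefinable_def B_def mem_Collect_eq
      by (intro dpred_all dpred_ex dpred_conj dpred_imp dpred_not dS dpred_less dterm_abs dterm_diff
          dterm_var dterm_const)
    then obtain a b where ab: "a < b" "{a<..<b} \<subseteq> B" using tame inf by blast
    have near: "\<exists>u\<in>{a<..<b}. u \<in> S \<and> u \<in> W" "\<exists>u\<in>{a<..<b}. u \<notin> S \<and> u \<in> W"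
      if W: "open W" "t \<in> W" "t \<in> {a<..<b}" for W t
    proof -
      have "open (W \<inter> {a<..<b})" "t \<in> W \<inter> {a<..<b}" using W by auto
      then obtain \<epsilon> where e: "\<epsilon> > 0" "\<forall>u. dist u t < \<epsilon> \<longrightarrow> u \<in> W \<inter> {a<..<b}"
        unfolding open_dist by blast
      have "t \<in> B" using W ab by blast
      then obtain u u' where "u \<in> S" "\<bar>u - t\<bar> < \<epsilon>" "u' \<notin> S" "\<bar>u' - t\<bar> < \<epsilon>"
        using e(1) unfolding B_def by blast
      then show "\<exists>u\<in>{a<..<b}. u \<in> S \<and> u \<in> W" "\<exists>u\<in>{a<..<b}. u \<notin> S \<and> u \<in> W"
        using e(2) by (auto simp: dist_real_def)
    qed
    show False
    proof (cases "finite (S \<inter> {a<..<b})")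
      case True
      have "infinite ({a<..<b} - S \<inter> {a<..<b})" using True ab(1) by (simp add: infinite_Ioo)
      then obtain t where t: "t \<in> {a<..<b} - S \<inter> {a<..<b}" using infinite_imp_nonempty by blast
      have "open (- (S \<inter> {a<..<b}))" using True finite_imp_closed by blast
      then show False using near(1)[of "- (S \<inter> {a<..<b})" t] t by blast
    next
      case False
      have "rdefinable (S \<inter> {a<..<b})"
        unfolding rdefinable_def Int_iff greaterThanLessThan_iff
        by (intro dpred_conj dS dpred_less dterm_var dterm_const)
      then obtain c d where cd: "c < d" "{c<..<d} \<subseteq> S \<inter> {a<..<b}" using tame False by blast
      have mid: "(c + d) / 2 \<in> {c<..<d}" using cd(1) by simp
      then have "(c + d) / 2 \<in> {a<..<b}" using cd(2) by blast
      from near(2)[OF _ mid this] have "\<exists>u\<in>{a<..<b}. u \<notin> S \<and> u \<in> {c<..<d}" by simp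
      then show False using cd(2) by blast
    qed
  qed
  define \<E> where "\<E> = insert (-\<infinity>) (insert \<infinity> (ereal ` B))"
  define \<I> where "\<I> = (\<lambda>c. {c}) ` (B \<inter> S) \<union> {I. I \<subseteq> S \<and> (\<exists>a\<in>\<E>. \<exists>b\<in>\<E>. I = einterval a b)}"
  have "finite \<E>" using \<open>finite B\<close> by (simp add: \<E>_def)
  have "finite \<I>"
  proof -
    have "{I. I \<subseteq> S \<and> (\<exists>a\<in>\<E>. \<exists>b\<in>\<E>. I = einterval a b)} \<subseteq> (\<lambda>(a, b). einterval a b) ` (\<E> \<times> \<E>)"
      by auto
    then have "finite {I. I \<subseteq> S \<and> (\<exists>a\<in>\<E>. \<exists>b\<in>\<E>. I = einterval a b)}"
      by (rule finite_subset) (intro finite_imageI finite_cartesian_product \<open>finite \<E>\<close>)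
    then show ?thesis using \<open>finite B\<close> by (simp add: \<I>_def)
  qed
  moreover have "\<forall>I\<in>\<I>. (\<exists>c. I = {c}) \<or> (\<exists>a b. I = einterval a b)" by (auto simp: \<I>_def)
  moreover have "S = \<Union>\<I>"
  proof
    show "\<Union>\<I> \<subseteq> S" by (auto simp: \<I>_def)
    show "S \<subseteq> \<Union>\<I>"
    proof
      fix s assume s: "s \<in> S"
      show "s \<in> \<Union>\<I>"
      proof (cases "s \<in> B")
        case True
        then show ?thesis using s by (auto simp: \<I>_def)
      next
        case False
        \<comment> \<open>The neighbours of \<open>s\<close> in \<open>\<E>\<close> bound an
          interval without points of \<open>B\<close>; the infinite endpoints ensure that they
          exist.\<close>
        define a where "a = Max {x \<in> \<E>. x < ereal s}"
        define b where "b = Min {x \<in> \<E>. ereal s < x}"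
        have fin: "finite {x \<in> \<E>. x < ereal s}" "finite {x \<in> \<E>. ereal s < x}" using \<open>finite \<E>\<close> by auto
        have ne: "-\<infinity> \<in> {x \<in> \<E>. x < ereal s}" "\<infinity> \<in> {x \<in> \<E>. ereal s < x}" by (auto simp: \<E>_def)
        have a: "a \<in> \<E>" "a < ereal s" using Max_in[OF fin(1)] ne(1) unfolding a_def by blast+
        have b: "b \<in> \<E>" "ereal s < b" using Min_in[OF fin(2)] ne(2) unfolding b_def by blast+
        have s_in: "s \<in> einterval a b" using a b by (simp add: einterval_def)
        have avoid: "t \<notin> B" if "t \<in> einterval a b" for t
        proof
          assume "t \<in> B"
          then have tE: "ereal t \<in> \<E>" by (simp add: \<E>_def)
          have "t \<noteq> s" using \<open>t \<in> B\<close> False by blast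
          then consider "t < s" | "s < t" by linarith
          then show False
          proof cases
            case 1
            then have "ereal t \<le> a" unfolding a_def using tE fin(1) by (intro Max_ge) auto
            moreover have "a < ereal t" using that by (simp add: einterval_def)
            ultimately show ?thesis by (meson leD)
          next
            case 2
            then have "b \<le> ereal t" unfolding b_def using tE fin(2) by (intro Min_le) auto
            moreover have "ereal t < b" using that by (simp add: einterval_def)
            ultimately show ?thesis by (meson leD)
          qed
        qed
        have "einterval a b \<subseteq> S"
        proof (rule ccontr)
          assume "\<not> ?thesis"
          then have ne2: "einterval a b - S \<noteq> {}" by blast
          define P where "P = interior S"
          define Q where "Q = interior (- S)"
          have cover: "einterval a b \<subseteq> P \<union> Q"
          proof
            fix t assume "t \<in> einterval a b"
            then consider "\<exists>\<epsilon>>0. \<forall>u. \<bar>u - t\<bar> < \<epsilon> \<longrightarrow> u \<in> S" | "\<exists>\<epsilon>>0. \<forall>u. \<bar>u - t\<bar> < \<epsilon> \<longrightarrow> u \<notin> S"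
              using not_B avoid by blast
            then show "t \<in> P \<union> Q"
            proof cases
              case 1
              then obtain \<epsilon> where "\<epsilon> > 0" "\<forall>u. \<bar>u - t\<bar> < \<epsilon> \<longrightarrow> u \<in> S" by blast
              then have "ball t \<epsilon> \<subseteq> S" by (auto simp: dist_real_def abs_minus_commute)
              then have "t \<in> P" unfolding P_def using \<open>\<epsilon> > 0\<close> by (intro interiorI[OF open_ball]) auto
              then show ?thesis by blast
            next
              case 2
              then obtain \<epsilon> where "\<epsilon> > 0" "\<forall>u. \<bar>u - t\<bar> < \<epsilon> \<longrightarrow> u \<notin> S" by blast
              then have "ball t \<epsilon> \<subseteq> - S" by (auto simp: dist_real_def abs_minus_commute)
              then have "t \<in> Q" unfolding Q_def using \<open>\<epsilon> > 0\<close> by (intro interiorI[OF open_ball]) auto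
              then show ?thesis by blast
            qed
          qed
          have "connected (einterval a b)"
          proof -
            have "is_interval (einterval a b)"
              unfolding is_interval_1 einterval_def
              by (metis (mono_tags, lifting) ereal_less_eq(3) less_le_trans le_less_trans mem_Collect_eq)
            then show ?thesis by (rule is_interval_connected)
          qed
          moreover have "open P" "open Q" by (simp_all add: P_def Q_def)
          moreover have "P \<inter> Q \<inter> einterval a b = {}" using interior_subset by (auto simp: P_def Q_def)
          moreover have "P \<inter> einterval a b \<noteq> {}"
            using cover s_in s interior_subset[of "- S"] by (auto simp: Q_def)
          moreover have "Q \<inter> einterval a b \<noteq> {}"
            using cover ne2 interior_subset[of S] by (auto simp: P_def)
          ultimately show False using cover by (auto simp: connected_def)
        qed
        then have "einterval a b \<in> \<I>" using a b by (auto simp: \<I>_def)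
        then show ?thesis using s_in by blast
      qed
    qed
  qed
  ultimately show "\<exists>\<I>. finite \<I> \<and> (\<forall>I\<in>\<I>. (\<exists>c. I = {c}) \<or> (\<exists>a b. I = einterval a b)) \<and> (\<lambda>x. x 0) ` E = \<Union>\<I>"
    unfolding S_def by blast
qed

end

lemma definable_primitive:
  assumes "(n, X) \<in> Rels M" "X \<subseteq> pts {..<n}"
  shows "definable M n X"
  unfolding definable_def topspace_Euclidean_space_pts
proof (intro exI conjI)
  show "wf_fm M (Rel n X (map Var [0..<n]))" using assms(1) by simp
  have "point_of (map (eval_tm (\<lambda>i. if i < n then x i else 0)) (map Var [0..<n])) = x"
    if "x \<in> pts {..<n}" for x
    using that by (auto simp: point_of_def pts_def fun_eq_iff)
  then show "X = {x \<in> pts {..<n}. sat (\<lambda>i. if i < n then x i else 0) (Rel n X (map Var [0..<n]))}"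
    using assms(2) by auto
qed

theorem theorem1p2:
  fixes \<S> :: "(nat \<times> (nat \<Rightarrow> real) set) set" and \<RR> :: rstruct
  assumes "\<And>n X. (n, X) \<in> \<S> \<Longrightarrow> boolean_combination_of_opens (Euclidean_space n) X"
    and "\<RR> = expansion_of_reals \<S>"
    and "PCC \<RR> \<or> CC \<RR> \<or> QCC \<RR>"
  shows "o_minimal \<RR> \<or>
    (\<exists>\<sigma> :: nat \<Rightarrow> real. strict_mono \<sigma> \<and>
       definable \<RR> 2 {point_of [\<sigma> m, \<sigma> n] | m n. m dvd n})"
proof -
  interpret ordered_group_structure \<RR>
    by unfold_locales (simp_all add: assms(2) expansion_of_reals_def)
  show ?thesis
  proof (cases "\<exists>n D. definable \<RR> n D \<and> infinite D \<and>
      (\<forall>x\<in>D. \<exists>\<epsilon>>0. \<forall>y\<in>D. dist1 n x y < \<epsilon> \<longrightarrow> y = x)")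
    case True
    then obtain n D where D: "definable \<RR> n D" "infinite D"
      "\<And>x. x \<in> D \<Longrightarrow> \<exists>\<epsilon>>0. \<forall>y\<in>D. dist1 n x y < \<epsilon> \<longrightarrow> y = x" by blast
    obtain T where T: "rdefinable T" "infinite T" "\<And>t. t \<in> T \<Longrightarrow> finite {u \<in> T. u \<le> t}"
      by (rule infinite_discrete_imp_omega[OF D]) blast+
    obtain \<sigma> :: "nat \<Rightarrow> real" where \<sigma>: "strict_mono \<sigma>" "range \<sigma> = T"
      by (rule enumerate_omega[OF T(2,3)]) blast+
    have "definable \<RR> 2 {point_of [\<sigma> m, \<sigma> n] | m n. m dvd n}"
      by (rule omega_imp_divisibility[OF assms(3) \<sigma>(1)]) (use T \<sigma> in simp)
    then show ?thesis using \<sigma>(1) by blast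
  next
    case False
    interpret no_infinite_discrete \<RR>
      by unfold_locales (use False in blast)
    interpret constructible_structure \<RR>
    proof unfold_locales
      show "Funs \<RR> = {(2, \<lambda>x. x 0 + x 1)}" by (simp add: assms(2) expansion_of_reals_def)
      fix n X assume X: "(n, X) \<in> Rels \<RR>"
      show "lc_union (definable \<RR> n) X"
      proof (cases "(n, X) \<in> \<S>")
        case True
        have *: "X \<subseteq> pts {..<n}" "lc_union (\<lambda>A. A \<subseteq> pts {..<n}) X"
          using boolean_combination_lc_union[OF assms(1)[OF True]] by auto
        show ?thesis
          by (rule lc_union_refine[OF closure_algebra_definable definable_primitive[OF X *(1)] *(2)])
      next
        case False
        then have nX: "n = 2" "X = {x \<in> pts {..<2}. x 0 < x 1}"
          using X by (auto simp: assms(2) expansion_of_reals_def topspace_Euclidean_space_pts)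
        have "X = pts {..<2} \<inter> {x. x 0 < x 1}" using nX by auto
        moreover have "open {x::point. x 0 < x 1}" by (intro open_Collect_less continuous_on_coord_id)
        ultimately have "lc X" by (simp add: lc_Int lc_closed lc_open closed_pts)
        moreover have "definable \<RR> n X"
          unfolding nX by (intro definable_dpred dpred_less dterm_var)
        ultimately show ?thesis by (intro lc_union_lc)
      qed
    qed
    show ?thesis using o_minimal_structure by blast
  qed
qed

end
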